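(* For any $m\in\mathbb{N}_0=\{0,1,2,\dots\}$, there is an $l\in\mathbb{N}=\{1,2,\dots\}$ with $l\le m+1$ (depending only on $m$) such that the following holds: for every Borel probability measure $\mu$ on the unit circle $\partial\mathbb{D}$ whose support is not a finite set, with Lebesgue decomposition $d\mu=w(\theta)\frac{d\theta}{2\pi}+d\mu_{\mathrm s}$, and whose Verblunsky coefficients $\alpha=\{\alpha_n\}_{n=0}^\infty\in\mathbb{D}^\infty$ satisfy $\delta\alpha\in\ell^2$, the condition \[ \int (1-\cos\theta)^m\log w(\theta)\,\frac{d\theta}{2\pi} > -\infty \] is equivalent to $\alpha\in\ell^{2l}$.
   Context: $\mathbb{D}=\{z\in\mathbb{C}:|z|<1\}$ and $\partial\mathbb{D}$ is the unit circle, parametrized by $z=e^{i\theta}$; integrals in $\theta$ are over one period, $\theta\in[0,2\pi)$. Verblunsky coefficients: let $\mu$ be a Borel probability measure on $\partial\mathbb{D}$ whose support is not a finite set. Let $\varphi_n(z)$, $\deg\varphi_n=n$, be the orthonormal polynomials obtained by orthonormalizing (Gram--Schmidt, positive leading coefficients) the sequence $1,z,z^2,\dots$ in $L^2(\partial\mathbb{D},d\mu)$. They obey the recursion \[ \varphi_{n+1}(z)=\frac{1}{\sqrt{1-|\alpha_n|^2}}\left(z\varphi_n(z)-\bar\alpha_n z^n\overline{\varphi_n(1/\bar z)}\right),\qquad n\ge 0, \] for uniquely determined $\alpha_n\in\mathbb{D}$, the Verblunsky coefficients of $\mu$. The map $\mu\mapsto\alpha=\{\alpha_n\}_{n=0}^\infty$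 is a bijection from such measures onto $\mathbb{D}^\infty$. In the Lebesgue decomposition, $w\ge 0$ is the density of the absolutely continuous part and $\mu_{\mathrm s}$ is singular with respect to Lebesgue measure. $\delta$ is the forward difference: $(\delta\alpha)_n=\alpha_{n+1}-\alpha_n$ for $n\ge0$. The integral in the claim (with $\log 0=-\infty$) is always well defined with values in $[-\infty,\infty)$, since the positive part of the integrand is integrable. *)

theory Defs
  imports "HOL-Probability.Probability" "HOL-Computational_Algebra.Polynomial"
begin

definition circle_borel :: "complex measure" where
  "circle_borel = restrict_space borel (sphere 0 1)"

definition measure_support :: "'a::topological_space measure \<Rightarrow> 'a set" where
  "measure_support M =
     {x \<in> space M. \<forall>U. open U \<longrightarrow> x \<in> U \<longrightarrow> emeasure M (U \<inter> space M) > 0}"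

definition nontrivial_circle_prob :: "complex measure \<Rightarrow> bool" where
  "nontrivial_circle_prob M \<longleftrightarrow>
     sets M = sets circle_borel \<and> prob_space M \<and> infinite (measure_support M)"

text \<open>The inner product is antilinear in the first argument.\<close>

definition L2_inner :: "complex measure \<Rightarrow> complex poly \<Rightarrow> complex poly \<Rightarrow> complex" where
  "L2_inner M p q = (LINT z|M. cnj (poly p z) * poly q z)"

definition L2_norm :: "complex measure \<Rightarrow> complex poly \<Rightarrow> real" where
  "L2_norm M p = sqrt (LINT z|M. (cmod (poly p z))\<^sup>2)"

text \<open>Gram--Schmidt applied to the monomials; the normalised polynomial inherits a positive
  leading coefficient from the monomial.\<close>

fun orthonormal_poly :: "complex measure \<Rightarrow> nat \<Rightarrow> complex poly" where
  "orthonormal_poly M n =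
     (let P = monom 1 n
            - (\<Sum>k<n. smult (L2_inner M (orthonormal_poly M k) (monom 1 n)) (orthonormal_poly M k))
      in smult (complex_of_real (1 / L2_norm M P)) P)"

declare orthonormal_poly.simps [simp del]

text \<open>The expression \<open>z ^ n * cnj (poly p (1 / cnj z))\<close> is a polynomial in \<open>z\<close>, but it must not
  be evaluated literally at \<open>z = 0\<close>; the identity of polynomials is therefore imposed for
  \<open>z \<noteq> 0\<close>.\<close>

definition verblunsky_coeffs :: "complex measure \<Rightarrow> (nat \<Rightarrow> complex) \<Rightarrow> bool" where
  "verblunsky_coeffs M \<alpha> \<longleftrightarrow>
     (\<forall>n. cmod (\<alpha> n) < 1 \<and>
       (\<forall>z. z \<noteq> 0 \<longrightarrow>
         poly (orthonormal_poly M (Suc n)) z =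
           complex_of_real (1 / sqrt (1 - (cmod (\<alpha> n))\<^sup>2)) *
             (z * poly (orthonormal_poly M n) z
              - cnj (\<alpha> n) * z ^ n * cnj (poly (orthonormal_poly M n) (1 / cnj z)))))"

text \<open>The measure \<open>d\<theta> / (2 * pi)\<close> on one period, and its image on the circle.\<close>

definition angle_measure :: "real measure" where
  "angle_measure = uniform_measure lborel {0..<2 * pi}"

definition circle_lebesgue :: "complex measure" where
  "circle_lebesgue = distr angle_measure circle_borel cis"

definition singular_wrt :: "'a measure \<Rightarrow> 'a measure \<Rightarrow> bool" where
  "singular_wrt S L \<longleftrightarrow>
     sets S = sets L \<and>
     (\<exists>N\<in>sets L. emeasure L N = 0 \<and> emeasure S (space L - N) = 0)"

text \<open>The density is a function of the angle; only its values on one period matter.\<close>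

definition circle_lebesgue_decomposition ::
    "complex measure \<Rightarrow> (real \<Rightarrow> real) \<Rightarrow> complex measure \<Rightarrow> bool" where
  "circle_lebesgue_decomposition M w S \<longleftrightarrow>
     w \<in> borel_measurable borel \<and> (\<forall>\<theta>\<in>{0..<2 * pi}. 0 \<le> w \<theta>) \<and>
     singular_wrt S circle_lebesgue \<and>
     (\<forall>A\<in>sets circle_borel.
        emeasure M A =
          emeasure (distr (density angle_measure (\<lambda>\<theta>. ennreal (w \<theta>))) circle_borel cis) A
          + emeasure S A)"

definition ext_log :: "real \<Rightarrow> ereal" where
  "ext_log x = (if x \<le> 0 then - \<infinity> else ereal (ln x))"

text \<open>Integral of an extended real valued function. The function \<open>e2ennreal\<close> sends negative
  arguments to \<open>0\<close>, so the two terms integrate the positive and the negative part. The value is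
  meaningful if at least one of them is finite.\<close>

definition ext_integral :: "'a measure \<Rightarrow> ('a \<Rightarrow> ereal) \<Rightarrow> ereal" where
  "ext_integral M f =
     enn2ereal (\<integral>\<^sup>+x. e2ennreal (f x) \<partial>M) - enn2ereal (\<integral>\<^sup>+x. e2ennreal (- f x) \<partial>M)"

definition forward_diff :: "(nat \<Rightarrow> complex) \<Rightarrow> nat \<Rightarrow> complex" where
  "forward_diff \<alpha> n = \<alpha> (Suc n) - \<alpha> n"

definition in_ell :: "nat \<Rightarrow> (nat \<Rightarrow> complex) \<Rightarrow> bool" where
  "in_ell p \<alpha> \<longleftrightarrow> summable (\<lambda>n. cmod (\<alpha> n) ^ p)"

end

theory Submission
  imports Defs "HOL-Complex_Analysis.Complex_Analysis"
begin

text \<open>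
  Let \<open>\<phi>\<^sub>n\<close> be the orthonormal polynomials, \<open>\<phi>\<^sub>n\<^sup>*\<close> their reversals and \<open>h(\<theta>) = (1 - cos \<theta>)\<^sup>m\<close>.
  The Bernstein--Szego measures \<open>|\<phi>\<^sub>N|\<^sup>-\<^sup>2 d\<theta>/2\<pi>\<close> have the same moments as \<open>\<mu>\<close> up to order \<open>N\<close>,
  so that \<open>\<integral> h log w > -\<infinity>\<close> holds if and only if \<open>Z\<^sub>N = - \<integral> h log |\<phi>\<^sub>N|\<^sup>2\<close> is bounded
  below: one direction is \<open>log t \<le> t\<close> for \<open>t = w |\<phi>\<^sub>N|\<^sup>2\<close>; for the other, \<open>log t \<le> t\<close> for
  \<open>t = f / |\<phi>\<^sub>N|\<^sup>2\<close> bounds \<open>\<integral> h log f\<close> by \<open>2\<^sup>m \<integral> f d\<mu> - Z\<^sub>N\<close> for all positive trigonometric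
  polynomials \<open>f\<close>, and \<open>f\<close> approximates a truncation of \<open>1 / w\<close>.

  With \<open>u\<^sub>n = z \<phi>\<^sub>n / \<phi>\<^sub>n\<^sup>*\<close> the increment \<open>Z\<^sub>n\<^sub>+\<^sub>1 - Z\<^sub>n\<close> equals \<open>c log (1 - |\<alpha>\<^sub>n|\<^sup>2)\<close>, where \<open>c\<close> is the
  mean of \<open>h\<close>, plus a real linear combination of Taylor coefficients of \<open>log (1 - \<alpha>\<^sub>n u\<^sub>n)\<close>. The
  recursion for \<open>u\<^sub>n\<close> makes these coefficients polynomials in finitely many products
  \<open>\<alpha>\<^sub>i cnj \<alpha>\<^sub>j\<close>. As \<open>\<delta>\<alpha>\<close> is square summable, they may be replaced, up to bounded partial sums, by
  their values for a constant sequence. There \<open>V = \<alpha> u\<close> solves \<open>V\<^sup>2 - (1 - z) V - z |\<alpha>|\<^sup>2 = 0\<close>, and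
  the combination becomes explicit: with \<open>x\<^sub>n = |\<alpha>\<^sub>n|\<^sup>2\<close>,
  \<open>Z\<^sub>N = c \<Sum>\<^sub>n\<^sub><\<^sub>N (log (1 - x\<^sub>n) + x\<^sub>n + \<dots> + x\<^sub>n\<^sup>m / m) + O(1)\<close>. Each summand is negative and comparable
  to \<open>- x\<^sub>n\<^sup>m\<^sup>+\<^sup>1\<close> for small \<open>x\<^sub>n\<close>, whence \<open>l = m + 1\<close>.
\<close>

unbundle no vec_syntax

subsection \<open>Integrals over the circle\<close>

lemma angle_measure_density:
  "angle_measure = density lborel (\<lambda>\<theta>. ennreal (indicator {0..<2 * pi} \<theta> / (2 * pi)))"
proof -
  have "(\<lambda>\<theta>. indicator {0..<2 * pi} \<theta> / emeasure lborel {0..<2 * pi}) = (\<lambda>\<theta>. ennreal (indicator {0..<2 * pi} \<theta> / (2 * pi)))"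
    by (auto simp: fun_eq_iff indicator_def divide_ennreal simp flip: ennreal_1)
  then show ?thesis by (simp add: angle_measure_def uniform_measure_def)
qed

lemma sets_angle_measure [measurable_cong]: "sets angle_measure = sets borel"
  by (simp add: angle_measure_def)

lemma space_angle_measure [simp]: "space angle_measure = UNIV"
  by (simp add: angle_measure_def)

lemma prob_space_angle_measure: "prob_space angle_measure"
  unfolding angle_measure_def by (rule prob_space_uniform_measure) auto

lemma AE_angle_measure: "AE \<theta> in angle_measure. \<theta> \<in> {0..<2 * pi}"
  unfolding angle_measure_def by (rule AE_uniform_measureI) auto

lemma
  fixes f :: "real \<Rightarrow> 'a::euclidean_space"
  assumes "continuous_on UNIV f"
  shows integrable_angle_measure: "integrable angle_measure f"
    and integral_angle_measure: "(LINT \<theta>|angle_measure. f \<theta>) = (1 / (2 * pi)) *\<^sub>R integral {0..2 * pi} f"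
proof -
  have f: "f \<in> borel_measurable lborel"
    using borel_measurable_continuous_onI[OF assms] by simp
  have int: "set_integrable lborel {0..2 * pi} f"
    unfolding set_integrable_def
    by (rule borel_integrable_compact) (auto intro: continuous_on_subset[OF assms])
  have ae: "AE \<theta> in lborel. indicator {0..2 * pi} \<theta> *\<^sub>R f \<theta> = indicator {0..<2 * pi} \<theta> *\<^sub>R f \<theta>"
    using AE_lborel_singleton[of "2 * pi"] by eventually_elim (auto simp: indicator_def)
  have int': "integrable lborel (\<lambda>\<theta>. indicator {0..<2 * pi} \<theta> *\<^sub>R f \<theta>)"
    using int unfolding set_integrable_def
    by (rule integrable_cong_AE_imp) (use ae f in auto)
  have eq: "(\<lambda>\<theta>. (indicator {0..<2 * pi} \<theta> / (2 * pi)) *\<^sub>R f \<theta>) = (\<lambda>\<theta>. (1 / (2 * pi)) *\<^sub>R (indicator {0..<2 * pi} \<theta> *\<^sub>R f \<theta>))"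
    by (simp add: fun_eq_iff)
  have m: "(\<lambda>\<theta>. indicator {0..<2 * pi} \<theta> / (2 * pi) :: real) \<in> borel_measurable lborel" by simp
  have nn: "AE \<theta> in lborel. 0 \<le> (indicator {0..<2 * pi} \<theta> / (2 * pi) :: real)" by simp
  show "integrable angle_measure f"
    unfolding angle_measure_density integrable_density[OF f m nn] eq
    by (intro integrable_scaleR_right int')
  have "(LINT \<theta>|angle_measure. f \<theta>) = (LINT \<theta>|lborel. (indicator {0..<2 * pi} \<theta> / (2 * pi)) *\<^sub>R f \<theta>)"
    unfolding angle_measure_density by (rule integral_density[OF f m nn])
  also have "\<dots> = (1 / (2 * pi)) *\<^sub>R (LINT \<theta>|lborel. indicator {0..<2 * pi} \<theta> *\<^sub>R f \<theta>)"
    unfolding eq by (rule integral_scaleR_right)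
  also have "(LINT \<theta>|lborel. indicator {0..<2 * pi} \<theta> *\<^sub>R f \<theta>) = (LINT \<theta>|lborel. indicator {0..2 * pi} \<theta> *\<^sub>R f \<theta>)"
    by (rule integral_cong_AE) (use ae f in auto)
  also have "\<dots> = integral {0..2 * pi} f"
    using set_borel_integral_eq_integral(2)[OF int] by (simp add: set_lebesgue_integral_def)
  finally show "(LINT \<theta>|angle_measure. f \<theta>) = (1 / (2 * pi)) *\<^sub>R integral {0..2 * pi} f" .
qed

lemma mult_cnj_circle: "cmod z = 1 \<Longrightarrow> z * cnj z = 1"
  using complex_norm_square[of z] by simp

lemma continuous_on_cis_compose:
  "continuous_on (sphere 0 1) g \<Longrightarrow> continuous_on UNIV (\<lambda>\<theta>. g (cis \<theta>))"
  by (rule continuous_on_compose2[of "sphere 0 1" g UNIV cis]) (auto intro: continuous_intros)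

text \<open>Cauchy's formula for derivatives on the unit circle itself, where continuity up to the
  boundary is enough. Naming the expansion \<open>G\<close> turns later integrals into power series
  algebra.\<close>

lemma integral_circle_coeff:
  assumes "continuous_on (cball 0 1) g" "g holomorphic_on ball 0 1" "g has_fps_expansion G"
  shows "(LINT \<theta>|angle_measure. g (cis \<theta>) / cis \<theta> ^ k) = fps_nth G k"
proof -
  have "((\<lambda>u. g u / (u - 0) ^ (Suc k)) has_contour_integral ((2 * pi * \<i>) / (fact k) * (deriv ^^ k) g 0))
           (circlepath 0 1)"
    by (rule Cauchy_has_contour_integral_higher_derivative_circlepath) (use assms in auto)
  also have "(2 * pi * \<i>) / (fact k) * (deriv ^^ k) g 0 = 2 * pi * \<i> * fps_nth G k"
    using fps_nth_fps_expansion[OF assms(3), of k] by simp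
  finally have "((\<lambda>t. g (cis t) / cis t ^ Suc k * \<i> * cis t) has_integral (2 * pi * \<i> * fps_nth G k)) {0..2 * pi}"
    unfolding circlepath_def by (subst (asm) has_contour_integral_part_circlepath_iff) auto
  then have "((\<lambda>t. (1 / \<i>) * (g (cis t) / cis t ^ Suc k * \<i> * cis t)) has_integral (1 / \<i>) * (2 * pi * \<i> * fps_nth G k)) {0..2 * pi}"
    by (rule has_integral_mult_right)
  moreover have "(\<lambda>t. (1 / \<i>) * (g (cis t) / cis t ^ Suc k * \<i> * cis t)) = (\<lambda>t. g (cis t) / cis t ^ k)"
    by (auto simp: fun_eq_iff field_simps)
  moreover have "(1 / \<i>) * (2 * pi * \<i> * fps_nth G k) = 2 * pi * fps_nth G k"
    by (simp add: field_simps)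
  ultimately have "((\<lambda>t. g (cis t) / cis t ^ k) has_integral 2 * pi * fps_nth G k) {0..2 * pi}"
    by (simp only:)
  then have "integral {0..2 * pi} (\<lambda>t. g (cis t) / cis t ^ k) = 2 * pi * fps_nth G k"
    by (rule integral_unique)
  moreover have "continuous_on UNIV (\<lambda>t. g (cis t) / cis t ^ k)"
    by (intro continuous_on_divide continuous_on_cis_compose continuous_on_subset[OF assms(1)]
        continuous_intros) auto
  ultimately show ?thesis
    by (simp add: integral_angle_measure scaleR_conv_of_real)
qed

lemma integral_circle_mean_value:
  assumes "continuous_on (cball 0 1) g" "g holomorphic_on ball 0 1"
  shows "(LINT \<theta>|angle_measure. g (cis \<theta>)) = g 0"
proof -
  have "g has_fps_expansion fps_expansion g 0"
    using assms by (intro has_fps_expansion_fps_expansion[of "ball 0 1"]) auto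
  from integral_circle_coeff[OF assms this, of 0] show ?thesis
    by (simp add: fps_expansion_def)
qed

subsection \<open>The Szego recursion\<close>

text \<open>The orthonormal polynomial and its reversal evolve together, so both are polynomials by
  construction, also at 0, and depend on the coefficients alone; the link with a measure comes
  later.\<close>

primrec szego_pair :: "(nat \<Rightarrow> complex) \<Rightarrow> nat \<Rightarrow> complex poly \<times> complex poly" where
  "szego_pair \<alpha> 0 = (1, 1)"
| "szego_pair \<alpha> (Suc n) =
    (let r = complex_of_real (1 / sqrt (1 - (cmod (\<alpha> n))\<^sup>2));
         p = pCons 0 (fst (szego_pair \<alpha> n)); q = snd (szego_pair \<alpha> n)
     in (smult r (p - smult (cnj (\<alpha> n)) q), smult r (q - smult (\<alpha> n) p)))"

locale verblunsky_sequence =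
  fixes \<alpha> :: "nat \<Rightarrow> complex"
  assumes cmod_less_1: "cmod (\<alpha> n) < 1"
begin

definition phi_poly :: "nat \<Rightarrow> complex poly" where "phi_poly n = fst (szego_pair \<alpha> n)"
definition phis_poly :: "nat \<Rightarrow> complex poly" where "phis_poly n = snd (szego_pair \<alpha> n)"

abbreviation phi :: "nat \<Rightarrow> complex \<Rightarrow> complex" where "phi n \<equiv> poly (phi_poly n)"
abbreviation phis :: "nat \<Rightarrow> complex \<Rightarrow> complex" where "phis n \<equiv> poly (phis_poly n)"

definition rho :: "nat \<Rightarrow> real" where "rho n = sqrt (1 - (cmod (\<alpha> n))\<^sup>2)"

lemma cmod_square_less_1: "(cmod (\<alpha> n))\<^sup>2 < 1"
  using cmod_less_1[of n] abs_square_less_1[of "cmod (\<alpha> n)"] by simp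

lemma rho_pos: "rho n > 0" and rho_square: "(rho n)\<^sup>2 = 1 - (cmod (\<alpha> n))\<^sup>2"
  using cmod_square_less_1[of n] by (simp_all add: rho_def)

lemma phi_poly_0 [simp]: "phi_poly 0 = 1" and phis_poly_0 [simp]: "phis_poly 0 = 1"
  by (simp_all add: phi_poly_def phis_poly_def)

lemma phi_poly_Suc: "phi_poly (Suc n) = smult (of_real (1 / rho n)) (pCons 0 (phi_poly n) - smult (cnj (\<alpha> n)) (phis_poly n))"
  and phis_poly_Suc: "phis_poly (Suc n) = smult (of_real (1 / rho n)) (phis_poly n - smult (\<alpha> n) (pCons 0 (phi_poly n)))"
  by (simp_all add: phi_poly_def phis_poly_def rho_def Let_def)

lemma phi_Suc: "phi (Suc n) z = of_real (1 / rho n) * (z * phi n z - cnj (\<alpha> n) * phis n z)"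
  and phis_Suc: "phis (Suc n) z = of_real (1 / rho n) * (phis n z - \<alpha> n * (z * phi n z))"
  by (simp_all add: phi_poly_Suc phis_poly_Suc)

lemma phis_eq:
  assumes "z \<noteq> 0"
  shows "phis n z = z ^ n * cnj (phi n (1 / cnj z))"
  using assms
proof (induction n arbitrary: z)
  case (Suc n)
  \<comment> \<open>Reflection in the circle is an involution: the induction hypothesis at
    \<open>1 / cnj z\<close> returns \<open>phi n z\<close>.\<close>
  have "phis n (1 / cnj z) = (1 / cnj z) ^ n * cnj (phi n z)"
    using Suc.IH[of "1 / cnj z"] Suc.prems by simp
  then have 1: "cnj (phis n (1 / cnj z)) = phi n z / z ^ n"
    by (simp add: power_one_over field_simps)
  have "z ^ Suc n * cnj (phi (Suc n) (1 / cnj z))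
      = of_real (1 / rho n) * (z ^ Suc n * ((1 / z) * cnj (phi n (1 / cnj z)) - \<alpha> n * (phi n z / z ^ n)))"
    by (simp add: phi_Suc 1)
  also have "z ^ Suc n * ((1 / z) * cnj (phi n (1 / cnj z)) - \<alpha> n * (phi n z / z ^ n))
      = z ^ n * cnj (phi n (1 / cnj z)) - \<alpha> n * (z * phi n z)"
    using Suc.prems by (simp add: right_diff_distrib)
  also have "of_real (1 / rho n) * (z ^ n * cnj (phi n (1 / cnj z)) - \<alpha> n * (z * phi n z)) = phis (Suc n) z"
    using Suc.prems by (simp add: phis_Suc Suc.IH[of z])
  finally show ?case by simp
qed simp

lemma phis_circle:
  assumes "cmod z = 1"
  shows "phis n z = z ^ n * cnj (phi n z)"
proof -
  have z: "z \<noteq> 0" using assms by auto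
  have "z * cnj z = 1" using assms by (rule mult_cnj_circle)
  then have "1 / cnj z = z" using z by (simp add: field_simps)
  then show ?thesis using phis_eq[OF z, of n] by simp
qed

lemma cmod_phis_circle: "cmod z = 1 \<Longrightarrow> cmod (phis n z) = cmod (phi n z)"
  by (simp add: phis_circle norm_mult norm_power)

text \<open>With \<open>p = z * phi n z\<close> and \<open>q = phis n z\<close>, the identity |q - a
  p|^2 - |p - cnj a q|^2 = (1 - |a|^2) (|q|^2 - |p|^2) carries |p| \<le> |q| to the next index, and
  |a| < 1 keeps q - a p away from 0. The nonvanishing uses the inequality, hence the joint
  induction.\<close>

lemma phis_disc:
  assumes "cmod z \<le> 1"
  shows "phis n z \<noteq> 0 \<and> cmod (z * phi n z) \<le> cmod (phis n z)"
proof (induction n)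
  case (Suc n)
  define p q a where "p = z * phi n z" and "q = phis n z" and "a = \<alpha> n"
  have pq: "q \<noteq> 0" "cmod p \<le> cmod q" using Suc by (auto simp: p_def q_def)
  have a: "cmod a < 1" using cmod_less_1 by (simp add: a_def)
  have "cmod (a * p) < cmod q"
  proof -
    have "cmod (a * p) \<le> cmod a * cmod q" unfolding norm_mult by (rule mult_left_mono) (use pq in auto)
    also have "\<dots> < 1 * cmod q" by (rule mult_strict_right_mono) (use a pq in auto)
    finally show ?thesis by simp
  qed
  then have ne: "q - a * p \<noteq> 0" by auto
  have "(cmod (p - cnj a * q))\<^sup>2 = (cmod (q - a * p))\<^sup>2 - (1 - (cmod a)\<^sup>2) * ((cmod q)\<^sup>2 - (cmod p)\<^sup>2)"
    unfolding cmod_power2 by (simp add: power2_eq_square algebra_simps)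
  also have "\<dots> \<le> (cmod (q - a * p))\<^sup>2"
  proof -
    have "(cmod p)\<^sup>2 \<le> (cmod q)\<^sup>2" using pq by (simp add: power_mono)
    moreover have "(cmod a)\<^sup>2 \<le> 1" using a by (simp add: power_le_one)
    ultimately show ?thesis by simp
  qed
  finally have le: "cmod (p - cnj a * q) \<le> cmod (q - a * p)"
    by (rule power2_le_imp_le) simp
  have "cmod (z * phi (Suc n) z) = cmod z * ((1 / rho n) * cmod (p - cnj a * q))"
    using rho_pos[of n] by (simp add: phi_Suc p_def q_def a_def norm_mult norm_divide)
  also have "\<dots> \<le> 1 * ((1 / rho n) * cmod (q - a * p))"
    using rho_pos[of n] assms le by (intro mult_mono mult_nonneg_nonneg) auto
  also have "\<dots> = cmod (phis (Suc n) z)"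
    using rho_pos[of n] by (simp add: phis_Suc p_def q_def a_def norm_mult norm_divide)
  finally have "cmod (z * phi (Suc n) z) \<le> cmod (phis (Suc n) z)" .
  moreover have "phis (Suc n) z \<noteq> 0"
    using ne rho_pos[of n] by (simp add: phis_Suc p_def q_def a_def)
  ultimately show ?case by blast
qed (use assms in auto)

lemma phi_circle_nonzero: "cmod z = 1 \<Longrightarrow> phi n z \<noteq> 0"
  using phis_disc[of z n] cmod_phis_circle[of z n] by force

lemma degree_phi: "degree (phi_poly n) \<le> n" and degree_phis: "degree (phis_poly n) \<le> n"
proof (induction n)
  case (Suc n)
  have 1: "degree (pCons 0 (phi_poly n)) \<le> Suc n"
    using Suc.IH(1) by (meson Suc_le_mono degree_pCons_le order_trans)
  have 2: "degree (phis_poly n) \<le> Suc n" using Suc.IH(2) by simp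
  { case 1
    show ?case unfolding phi_poly_Suc
      by (intro order.trans[OF degree_smult_le] degree_diff_le order.trans[OF degree_smult_le] \<open>degree (pCons 0 (phi_poly n)) \<le> Suc n\<close> 2) }
  { case 2
    show ?case unfolding phis_poly_Suc
      by (intro order.trans[OF degree_smult_le] degree_diff_le order.trans[OF degree_smult_le] 1 \<open>degree (phis_poly n) \<le> Suc n\<close>) }
qed simp_all

text \<open>Each step multiplies the leading coefficient by 1 / \<open>rho n\<close>, as the degree
  of \<open>phis_poly n\<close> is too small to contribute. This makes the system in
  \<open>moments_determined\<close> solvable.\<close>

lemma coeff_phi_nonzero: "coeff (phi_poly n) n \<noteq> 0"
proof (induction n)
  case (Suc n)
  have "coeff (phis_poly n) (Suc n) = 0"
    by (rule coeff_eq_0) (use degree_phis[of n] in simp)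
  then show ?case using Suc rho_pos[of n] by (simp add: phi_poly_Suc)
qed simp

section \<open>Bernstein--Szego densities\<close>

definition bs_density :: "nat \<Rightarrow> real \<Rightarrow> real" where
  "bs_density N \<theta> = 1 / (cmod (phi N (cis \<theta>)))\<^sup>2"

lemma bs_density_pos: "bs_density N \<theta> > 0"
  using phi_circle_nonzero[of "cis \<theta>" N] by (simp add: bs_density_def)

lemma continuous_bs_density [continuous_intros]: "continuous_on A (bs_density N)"
  unfolding bs_density_def
  by (intro continuous_intros) (use phi_circle_nonzero in auto)

text \<open>Downward induction from n = N. At n = N the integrand is the boundary value of z^(N - j)
  / \<open>phis N z\<close>, holomorphic in the disc with a zero at 0; below N the Szego recursion
  is inverted.\<close>

lemma bs_orthogonal:
  assumes "n \<le> N" "j < n"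
  shows "(LINT \<theta>|angle_measure. cnj (cis \<theta>) ^ j * phi n (cis \<theta>) * of_real (bs_density N \<theta>)) = 0"
  using assms
proof (induction n arbitrary: j rule: inc_induct)
  case base
  define g where "g z = z ^ (N - j) / phis N z" for z
  have "(LINT \<theta>|angle_measure. cnj (cis \<theta>) ^ j * phi N (cis \<theta>) * of_real (bs_density N \<theta>))
     = (LINT \<theta>|angle_measure. g (cis \<theta>))"
  proof (intro Bochner_Integration.integral_cong refl)
    fix \<theta>
    define z where "z = cis \<theta>"
    have z: "cmod z = 1" "z * cnj z = 1" by (simp_all add: z_def mult_cnj_circle)
    have nz: "phi N z \<noteq> 0" using phi_circle_nonzero z by blast
    have zz: "cnj z ^ j * z ^ N = z ^ (N - j)"
    proof -
      have "cnj z ^ j * z ^ N = (z * cnj z) ^ j * z ^ (N - j)"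
        using base by (simp add: power_mult_distrib flip: power_add)
      then show ?thesis by (simp add: z)
    qed
    have "g z = cnj z ^ j * z ^ N / (z ^ N * cnj (phi N z))"
      by (simp add: g_def phis_circle[OF z(1)] zz)
    also have "\<dots> = cnj z ^ j / cnj (phi N z)" using z by auto
    also have "\<dots> = cnj z ^ j * phi N z * of_real (bs_density N \<theta>)"
      using nz by (simp add: bs_density_def z_def[symmetric] complex_norm_square del: of_real_power)
    finally show "cnj (cis \<theta>) ^ j * phi N (cis \<theta>) * of_real (bs_density N \<theta>) = g (cis \<theta>)"
      by (simp add: z_def)
  qed
  also have "\<dots> = g 0"
    unfolding g_def using phis_disc
    by (intro integral_circle_mean_value continuous_intros holomorphic_intros) auto
  also have "\<dots> = 0" using base by (simp add: g_def)
  finally show ?case .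
next
  case (step n)
  define I where "I j = (\<lambda>\<theta>. cnj (cis \<theta>) ^ j * phi (Suc n) (cis \<theta>) * of_real (bs_density N \<theta>))" for j
  have int: "integrable angle_measure (I j)" for j
    unfolding I_def by (intro integrable_angle_measure continuous_intros)
  \<comment> \<open>Solving the recursion for z phi_n gives a combination of phi_(n+1) and its
    reversal, and on the circle the reversal becomes a conjugate. Both exponents
    \<open>Suc j\<close> and \<open>n - j\<close> lie below \<open>Suc n\<close>.\<close>
  have eq: "cnj (cis \<theta>) ^ j * phi n (cis \<theta>) * of_real (bs_density N \<theta>)
     = of_real (1 / rho n) * (I (Suc j) \<theta> + cnj (\<alpha> n) * cnj (I (n - j) \<theta>))" for \<theta>
  proof -
    define z where "z = cis \<theta>"
    have z: "cmod z = 1" "z * cnj z = 1" by (simp_all add: z_def mult_cnj_circle)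
    have "phi (Suc n) z + cnj (\<alpha> n) * phis (Suc n) z = of_real (1 / rho n) * (1 - \<alpha> n * cnj (\<alpha> n)) * (z * phi n z)"
      by (simp add: phi_Suc phis_Suc algebra_simps)
    also have "1 - \<alpha> n * cnj (\<alpha> n) = of_real ((rho n)\<^sup>2)"
      by (simp add: rho_square complex_norm_square[symmetric])
    also have "of_real (1 / rho n) * of_real ((rho n)\<^sup>2) * (z * phi n z) = of_real (rho n) * (z * phi n z)"
      using rho_pos[of n] by (simp add: power2_eq_square)
    finally have "z * phi n z = of_real (1 / rho n) * (phi (Suc n) z + cnj (\<alpha> n) * phis (Suc n) z)"
      using rho_pos[of n] by (simp add: field_simps)
    then have "cnj z ^ Suc j * (z * phi n z) = of_real (1 / rho n) * (cnj z ^ Suc j * phi (Suc n) z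
        + cnj (\<alpha> n) * (cnj z ^ Suc j * z ^ Suc n) * cnj (phi (Suc n) z))"
      by (simp add: phis_circle[OF z(1)] algebra_simps)
    also have "cnj z ^ Suc j * (z * phi n z) = cnj z ^ j * phi n z * (z * cnj z)"
      by (simp add: algebra_simps)
    also have "cnj z ^ Suc j * z ^ Suc n = (z * cnj z) ^ Suc j * z ^ (n - j)"
      using step.prems by (simp add: power_mult_distrib flip: power_add)
    finally have "cnj z ^ j * phi n z = of_real (1 / rho n) * (cnj z ^ Suc j * phi (Suc n) z
        + cnj (\<alpha> n) * z ^ (n - j) * cnj (phi (Suc n) z))"
      by (simp add: z)
    then show ?thesis by (simp add: I_def z_def[symmetric] algebra_simps)
  qed
  have "(LINT \<theta>|angle_measure. I k \<theta>) = 0" if "k < Suc n" for k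
    unfolding I_def by (rule step.IH) (use that in auto)
  then have "(LINT \<theta>|angle_measure. I (Suc j) \<theta>) = 0" "(LINT \<theta>|angle_measure. I (n - j) \<theta>) = 0"
    using step.prems by auto
  then show ?case unfolding eq using int by simp
qed

end

subsection \<open>The Taylor coefficients for a constant sequence\<close>

text \<open>Coefficients in z of the solution V = \<alpha> u, V(0) = 0, of V = z V - x z + V^2, as
  polynomials in x = |\<alpha>|^2; this is the form of the recursion for u along a constant
  sequence.\<close>

fun quad_symbol :: "nat \<Rightarrow> real poly" where
  "quad_symbol 0 = 0"
| "quad_symbol (Suc k) = quad_symbol k - (if k = 0 then [:0, 1:] else 0)
     + (\<Sum>i\<in>{1..k}. quad_symbol i * quad_symbol (Suc k - i))"

text \<open>Coefficients of L = log (1 - V), read off from z L' = z L' V - z V'. At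
  \<open>k = 0\<close> division by zero gives the correct value 0.\<close>

fun log_symbol :: "nat \<Rightarrow> real poly" where
  "log_symbol k = smult (1 / real k)
     ((\<Sum>i\<in>{1..<k}. smult (real i) (log_symbol i) * quad_symbol (k - i)) - smult (real k) (quad_symbol k))"

declare quad_symbol.simps(2) [simp del] log_symbol.simps [simp del]

definition quad_fps :: "real \<Rightarrow> real fps" where
  "quad_fps x = Abs_fps (\<lambda>k. poly (quad_symbol k) x)"

definition log_fps :: "real \<Rightarrow> real fps" where
  "log_fps x = Abs_fps (\<lambda>k. poly (log_symbol k) x)"

text \<open>Without constant terms the two outer summands vanish, so coefficient
  \<open>Suc k\<close> of the product involves only indices up to k. This matches the ranges in the
  recursions for the symbols.\<close>

lemma fps_mult_nth_Suc_inner: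
  fixes F G :: "'a::comm_ring_1 fps"
  assumes "F $ 0 = 0" "G $ 0 = 0"
  shows "(F * G) $ Suc k = (\<Sum>i\<in>{1..k}. F $ i * G $ (Suc k - i))"
proof -
  have "(F * G) $ Suc k = (\<Sum>i\<in>{0..Suc k}. F $ i * G $ (Suc k - i))"
    by (simp add: fps_mult_nth)
  also have "\<dots> = (\<Sum>i\<in>{1..k}. F $ i * G $ (Suc k - i))"
  proof (rule sum.mono_neutral_right)
    show "\<forall>i\<in>{0..Suc k} - {1..k}. F $ i * G $ (Suc k - i) = 0"
    proof
      fix i assume "i \<in> {0..Suc k} - {1..k}"
      then have "i = 0 \<or> i = Suc k" by auto
      then show "F $ i * G $ (Suc k - i) = 0" using assms by auto
    qed
  qed auto
  finally show ?thesis .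
qed

lemma quad_fps_equation:
  "(quad_fps x)\<^sup>2 - (1 - fps_X) * quad_fps x - fps_const x * fps_X = 0"
proof -
  have "quad_fps x $ k = (fps_X * quad_fps x - fps_const x * fps_X + quad_fps x * quad_fps x) $ k" for k
  proof (cases k)
    case 0 then show ?thesis by (simp add: quad_fps_def)
  next
    case (Suc j)
    then show ?thesis
      by (subst fps_add_nth, subst Suc, subst Suc, subst Suc, subst fps_mult_nth_Suc_inner)
         (auto simp: quad_fps_def quad_symbol.simps(2) poly_sum)
  qed
  then have "quad_fps x = fps_X * quad_fps x - fps_const x * fps_X + quad_fps x * quad_fps x"
    by (rule fps_ext)
  then show ?thesis
    by (simp add: power2_eq_square algebra_simps)
qed

lemma log_fps_equation:
  "fps_deriv (log_fps x) * (1 - quad_fps x) = - fps_deriv (quad_fps x)"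
proof -
  have "fps_deriv (log_fps x) $ k
      = (fps_deriv (log_fps x) * quad_fps x - fps_deriv (quad_fps x)) $ k" for k
  proof -
    have "fps_deriv (log_fps x) $ k = real (Suc k) * poly (log_symbol (Suc k)) x"
      by (simp add: log_fps_def)
    also have "\<dots> = (\<Sum>i\<in>{1..<Suc k}. real i * poly (log_symbol i) x * poly (quad_symbol (Suc k - i)) x)
        - real (Suc k) * poly (quad_symbol (Suc k)) x"
      by (subst log_symbol.simps) (simp add: poly_sum right_diff_distrib mult.assoc)
    also have "(\<Sum>i\<in>{1..<Suc k}. real i * poly (log_symbol i) x * poly (quad_symbol (Suc k - i)) x)
      = (fps_X * fps_deriv (log_fps x) * quad_fps x) $ Suc k"
      by (subst fps_mult_nth_Suc_inner)
         (auto simp: quad_fps_def log_fps_def atLeastLessThanSuc_atLeastAtMost intro!: sum.cong)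
    also have "\<dots> = (fps_deriv (log_fps x) * quad_fps x) $ k"
      by (simp add: mult.assoc)
    finally show ?thesis by (simp add: quad_fps_def)
  qed
  then have "fps_deriv (log_fps x) = fps_deriv (log_fps x) * quad_fps x - fps_deriv (quad_fps x)"
    by (rule fps_ext)
  then show ?thesis by (simp add: algebra_simps)
qed

text \<open>\<open>R\<close> = 1 - z - 2 V is a square root of the discriminant (1 - z)^2 + 4 x z of
  the quadratic equation, and \<open>T x * R\<close> = 1 - z. Stating the square avoids naming a
  root of a power series.\<close>

lemma log_fps_square:
  defines "T x \<equiv> 1 - 2 * (fps_X * fps_deriv (log_fps x))"
  shows "(T x)\<^sup>2 * ((1 - fps_X)\<^sup>2 + fps_const (4 * x) * fps_X) = (1 - fps_X)\<^sup>2"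
proof -
  define V Q c where "V = quad_fps x" and "Q = fps_deriv (log_fps x)" and "c = fps_const x"
  define R where "R = 1 - fps_X - 2 * V"
  have V: "V\<^sup>2 - (1 - fps_X) * V - c * fps_X = 0"
    using quad_fps_equation by (simp add: V_def c_def)
  have Q: "Q * (1 - V) = - fps_deriv V"
    using log_fps_equation by (simp add: V_def Q_def)
  have "fps_deriv (V\<^sup>2 - (1 - fps_X) * V - c * fps_X) = 0" by (simp only: V fps_deriv_0)
  then have V': "fps_deriv V * R = V - c"
    by (simp add: R_def c_def power2_eq_square algebra_simps)
  \<comment> \<open>The factor 1 - V brings in the equation for \<open>Q\<close>; it is a nonzero
    series and is cancelled afterwards.\<close>
  have "(1 - V) * (fps_X * Q * R + V) = 0"
  proof -
    have "(1 - V) * (fps_X * Q * R + V) = fps_X * ((Q * (1 - V)) * R) + V * (1 - V)"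
      by (simp add: algebra_simps)
    also have "\<dots> = - fps_X * (fps_deriv V * R) + V * (1 - V)" by (simp add: Q)
    also have "\<dots> = - (V\<^sup>2 - (1 - fps_X) * V - c * fps_X)"
      unfolding V' by (simp add: power2_eq_square algebra_simps)
    finally show ?thesis by (simp add: V)
  qed
  moreover have "1 - V \<noteq> 0"
  proof
    assume "1 - V = 0"
    then have "(1 - V) $ 0 = 0" by simp
    then show False by (simp add: V_def quad_fps_def)
  qed
  ultimately have "fps_X * Q * R = - V" by (simp add: eq_neg_iff_add_eq_0)
  moreover have "T x * R = R - 2 * (fps_X * Q * R)"
    unfolding T_def Q_def[symmetric] by (simp add: algebra_simps)
  ultimately have "T x * R = 1 - fps_X" by (simp add: R_def)
  then have "(T x)\<^sup>2 * R\<^sup>2 = (1 - fps_X)\<^sup>2" by (simp add: power_mult_distrib[symmetric])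
  moreover have "R\<^sup>2 = (1 - fps_X)\<^sup>2 + fps_const (4 * x) * fps_X + 4 * (V\<^sup>2 - (1 - fps_X) * V - c * fps_X)"
  proof -
    have "fps_const (4 * x) = 4 * c"
      by (simp add: c_def numeral_fps_const)
    then show ?thesis by (simp add: R_def power2_eq_square algebra_simps)
  qed
  ultimately show ?thesis by (simp add: V)
qed

section \<open>Closed form of the logarithmic coefficients\<close>

text \<open>The series of (1 + 4 x t)^(-1/2) in t.\<close>

definition central_fps :: "real \<Rightarrow> real fps" where
  "central_fps x = Abs_fps (\<lambda>j. real ((2 * j) choose j) * (- x) ^ j)"

lemma central_binomial_Suc:
  "real (Suc j) * real ((2 * Suc j) choose Suc j) = (4 * real j + 2) * real ((2 * j) choose j)"
proof -
  have 1: "Suc j * ((2 * Suc j) choose Suc j) = Suc (2 * j + 1) * ((2 * j + 1) choose j)"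
    using Suc_times_binomial[of j "2 * j + 1"] by simp
  have 2: "(2 * j + 1) * ((2 * j) choose j) = Suc j * ((2 * j + 1) choose j)"
    using binomial_absorb_comp[of "2 * j + 1" j] by (simp add: mult.commute)
  have "Suc j * (Suc j * ((2 * Suc j) choose Suc j)) = (2 * Suc j) * (Suc j * ((2 * j + 1) choose j))"
    unfolding 1 by simp
  also have "\<dots> = Suc j * ((4 * j + 2) * ((2 * j) choose j))"
    unfolding 2[symmetric] by simp
  finally have "Suc j * ((2 * Suc j) choose Suc j) = (4 * j + 2) * ((2 * j) choose j)"
    by (simp only: mult_cancel1) simp
  from arg_cong[OF this, of real] show ?thesis by (simp only: of_nat_mult) simp
qed

text \<open>The ratio of consecutive central binomials is the differential equation B' D = - 2 x B
  with D = 1 + 4 x t, and this makes the derivative of B^2 D vanish.\<close>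

lemma central_fps_square: "(central_fps x)\<^sup>2 * (1 + fps_const (4 * x) * fps_X) = 1"
proof -
  define B c D where "B = central_fps x" and "c = fps_const (2 * x)" and "D = 1 + 2 * c * fps_X"
  have D: "D = 1 + fps_const (4 * x) * fps_X"
    by (simp add: D_def c_def numeral_fps_const)
  have ode: "fps_deriv B * D = - (c * B)"
  proof (rule fps_ext)
    fix j
    have "(fps_deriv B * D) $ j = (fps_deriv B + fps_const (4 * x) * (fps_X * fps_deriv B)) $ j"
      by (simp add: D algebra_simps)
    also have "\<dots> = real (Suc j) * B $ Suc j + 4 * x * (real j * B $ j)"
      by (cases j) auto
    also have "real (Suc j) * B $ Suc j = (real (Suc j) * real ((2 * Suc j) choose Suc j)) * (- x) ^ Suc j"
      by (simp add: B_def central_fps_def)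
    also have "\<dots> = ((4 * real j + 2) * real ((2 * j) choose j)) * (- x) ^ Suc j"
      by (simp only: central_binomial_Suc)
    also have "\<dots> + 4 * x * (real j * B $ j) = - (2 * x * B $ j)"
      by (simp add: B_def central_fps_def algebra_simps)
    finally show "(fps_deriv B * D) $ j = (- (c * B)) $ j"
      by (simp add: c_def)
  qed
  have "fps_deriv D = 2 * c"
    by (simp add: D c_def numeral_fps_const)
  then have "fps_deriv (B\<^sup>2 * D) = 2 * B * (fps_deriv B * D) + B\<^sup>2 * (2 * c)"
    by (simp add: power2_eq_square algebra_simps)
  also have "\<dots> = 0"
    unfolding ode by (simp add: power2_eq_square algebra_simps)
  finally have "B\<^sup>2 * D = fps_const ((B\<^sup>2 * D) $ 0)"
    by (simp only: fps_deriv_eq_0_iff)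
  also have "(B\<^sup>2 * D) $ 0 = 1"
    by (simp add: B_def D_def central_fps_def power2_eq_square)
  finally show ?thesis by (simp add: B_def D)
qed

text \<open>Dividing \<open>log_fps_square\<close> by (1 - z)^2 gives T^2 (1 + 4 x W) = 1 for the
  Koebe function W = z / (1 - z)^2, which is the equation of \<open>central_fps\<close> at t =
  W.\<close>

lemma log_fps_composition:
  "1 - 2 * (fps_X * fps_deriv (log_fps x)) = fps_compose (central_fps x) (fps_X * inverse ((1 - fps_X)\<^sup>2))"
    (is "?T = fps_compose ?B ?W")
proof -
  define S where "S = fps_compose ?B ?W"
  have W0: "?W $ 0 = 0" by simp
  have "fps_compose (?B\<^sup>2 * (1 + fps_const (4 * x) * fps_X)) ?W = fps_compose 1 ?W"
    by (simp only: central_fps_square)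
  then have "S\<^sup>2 * (1 + fps_const (4 * x) * ?W) = 1"
    using W0 by (simp add: S_def fps_compose_mult_distrib fps_compose_add_distrib power2_eq_square)
  then have "S\<^sup>2 * (1 + fps_const (4 * x) * ?W) * (1 - fps_X)\<^sup>2 = (1 - fps_X)\<^sup>2" by simp
  moreover have "?W * (1 - fps_X)\<^sup>2 = fps_X"
    by (simp add: mult.assoc inverse_mult_eq_1)
  ultimately have S: "S\<^sup>2 * ((1 - fps_X)\<^sup>2 + fps_const (4 * x) * fps_X) = (1 - fps_X)\<^sup>2"
    by (metis (no_types, lifting) distrib_right mult.assoc mult_1)
  have diff_squares: "(a - b) * (a + b) * d = a\<^sup>2 * d - b\<^sup>2 * d" for a b d :: "real fps"
    by (simp add: power2_eq_square algebra_simps)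
  let ?D = "(1 - fps_X)\<^sup>2 + fps_const (4 * x) * fps_X :: real fps"
  have "?D $ 0 = 1" by (simp add: power2_eq_square)
  then have "?D \<noteq> 0" by (metis fps_zero_nth zero_neq_one)
  moreover have "(S - ?T) * (S + ?T) * ?D = 0"
    by (simp only: diff_squares S log_fps_square) simp
  \<comment> \<open>The common constant term 1 selects the same square root: \<open>S = - ?T\<close>
    is excluded.\<close>
  moreover have "(S + ?T) $ 0 = 2"
    by (simp add: S_def central_fps_def)
  then have "S + ?T \<noteq> 0" by (metis fps_zero_nth zero_neq_numeral)
  ultimately show ?thesis unfolding S_def by simp
qed

text \<open>W^j = z^j (1 - z)^(-2j) is a shifted negative binomial series. The lower index
  \<open>2 * j - 1\<close> makes the value vanish for k < j without a case distinction.\<close>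

lemma koebe_power_nth:
  assumes "j \<ge> 1" "k \<ge> 1"
  shows "((fps_X * inverse ((1 - fps_X)\<^sup>2)) ^ j :: real fps) $ k = real ((k + j - 1) choose (2 * j - 1))"
proof -
  have "(fps_X * inverse ((1 - fps_X)\<^sup>2)) ^ j = fps_X ^ j * inverse ((1 - fps_const 1 * fps_X) ^ (2 * j) :: real fps)"
    by (simp add: power_mult_distrib fps_inverse_power power_mult)
  also have "\<dots> = fps_X ^ j * Abs_fps (\<lambda>k. of_nat ((2 * j + k - 1) choose k) * 1 ^ k)"
    using assms by (subst one_minus_const_fps_X_neg_power') auto
  finally have "((fps_X * inverse ((1 - fps_X)\<^sup>2)) ^ j :: real fps) $ k =
      (if k < j then 0 else real ((j + k - 1) choose (k - j)))"
    by (simp add: fps_X_power_mult_nth)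
  also have "\<dots> = real ((k + j - 1) choose (2 * j - 1))"
  proof (cases "k < j")
    case False
    then have "(k + j - 1) choose (2 * j - 1) = (k + j - 1) choose ((k + j - 1) - (2 * j - 1))"
      using assms by (intro binomial_symmetric) auto
    also have "(k + j - 1) - (2 * j - 1) = k - j" using assms False by auto
    finally show ?thesis using False by (simp add: add.commute)
  qed (use assms in auto)
  finally show ?thesis .
qed

text \<open>Coefficient k of the composition is - 2 k times the wanted value. The sum runs to m
  instead of k, which adds only zeros, so that all k share one range and sums can be
  interchanged.\<close>

lemma poly_log_symbol:
  assumes "k \<ge> 1" "k \<le> m"
  shows "poly (log_symbol k) x =
    - (\<Sum>j\<in>{1..m}. real ((2 * j) choose j) * (- x) ^ j * real ((k + j - 1) choose (2 * j - 1))) / (2 * real k)"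
proof -
  have "- 2 * (real k * poly (log_symbol k) x) = (1 - 2 * (fps_X * fps_deriv (log_fps x))) $ k"
    using assms by (cases k) (auto simp: log_fps_def numeral_fps_const)
  also have "\<dots> = (\<Sum>j\<in>{0..k}. central_fps x $ j * ((fps_X * inverse ((1 - fps_X)\<^sup>2)) ^ j) $ k)"
    by (simp only: log_fps_composition fps_compose_nth)
  also have "\<dots> = (\<Sum>j\<in>{1..k}. central_fps x $ j * ((fps_X * inverse ((1 - fps_X)\<^sup>2)) ^ j) $ k)"
    using assms by (intro sum.mono_neutral_right) (auto simp: not_le)
  also have "\<dots> = (\<Sum>j\<in>{1..k}. real ((2 * j) choose j) * (- x) ^ j * real ((k + j - 1) choose (2 * j - 1)))"
    using assms by (intro sum.cong) (auto simp: koebe_power_nth central_fps_def)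
  also have "\<dots> = (\<Sum>j\<in>{1..m}. real ((2 * j) choose j) * (- x) ^ j * real ((k + j - 1) choose (2 * j - 1)))"
    using assms by (intro sum.mono_neutral_left) auto
  finally show ?thesis using assms by (simp add: field_simps)
qed

section \<open>Alternating binomial sums\<close>

text \<open>The even polynomial in k with roots \<plusminus>1, ..., \<plusminus>(j - 1); times k /
  (2j - 1)! it is the binomial coefficient of the Koebe powers.\<close>

definition square_prod :: "nat \<Rightarrow> nat \<Rightarrow> real" where
  "square_prod j k = (\<Prod>i\<in>{1..<j}. (real k)\<^sup>2 - (real i)\<^sup>2)"

text \<open>The factors (k + j) (k + j - 1) ... (k - j) of the numerator are k and the pairs (k - i)
  (k + i). Each induction step adds the pair with i = j + 1.\<close>

lemma binomial_square_prod:
  assumes "k \<ge> 1"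
  shows "real ((k + Suc j - 1) choose (2 * Suc j - 1)) * fact (2 * Suc j - 1) = real k * square_prod (Suc j) k"
proof (induction j)
  case 0
  show ?case by (simp add: square_prod_def)
next
  case (Suc j)
  define n r where "n = k + j" and "r = 2 * j + 1"
  have 1: "real (r + 2) * real (Suc n choose (r + 2)) = real (Suc n) * real (n choose (r + 1))"
    using arg_cong[OF Suc_times_binomial[of "r + 1" n], of real] by (simp only: of_nat_mult) simp
  \<comment> \<open>Stated with a real difference, since r may exceed n; both binomials are 0
    then.\<close>
  have 2: "real (r + 1) * real (n choose (r + 1)) = (real n - real r) * real (n choose r)"
  proof (cases "r \<le> n")
    case True
    have "Suc r * (n choose Suc r) = (n - r) * (n choose r)"
      using binomial_absorption[of r n] binomial_absorb_comp[of n r] by simp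
    from arg_cong[OF this, of real] show ?thesis using True by (simp only: of_nat_mult of_nat_diff) simp
  qed (auto simp: binomial_eq_0)
  have "real ((k + Suc (Suc j) - 1) choose (2 * Suc (Suc j) - 1)) * fact (2 * Suc (Suc j) - 1)
     = real (Suc n choose (r + 2)) * fact (r + 2)"
    by (simp add: n_def r_def)
  also have "\<dots> = (real (r + 2) * real (Suc n choose (r + 2))) * real (r + 1) * fact r"
    by (simp add: algebra_simps)
  also have "\<dots> = real (Suc n) * (real (r + 1) * real (n choose (r + 1))) * fact r"
    unfolding 1 by simp
  also have "\<dots> = (real (Suc n) * (real n - real r)) * (real (n choose r) * fact r)"
    unfolding 2 by simp
  also have "real (Suc n) * (real n - real r) = (real k)\<^sup>2 - (real (Suc j))\<^sup>2"
    by (simp add: n_def r_def power2_eq_square algebra_simps)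
  also have "real (n choose r) * fact r = real k * square_prod (Suc j) k"
    using Suc.IH by (simp add: n_def r_def)
  finally show ?case by (simp add: square_prod_def)
qed

text \<open>The alternating sum of the whole row \<open>2 * m\<close> is 0 and symmetric about its
  middle term, so each half is minus half of that term. The computation uses the closed form of the
  partial alternating sums.\<close>

lemma alternating_binomial_half:
  assumes "m \<ge> 1"
  shows "(\<Sum>k\<in>{1..m}. (-1) ^ k * real ((2 * m) choose (m - k))) = - real ((2 * m) choose m) / 2"
proof -
  obtain p where p: "m = Suc p" using assms by (cases m) auto
  have "(\<Sum>k\<in>{1..m}. (-1) ^ k * real ((2 * m) choose (m - k)))
     = (\<Sum>i\<in>{..p}. (-1) ^ (m - i) * real ((2 * m) choose i))"
    by (rule sum.reindex_bij_witness[of _ "\<lambda>i. m - i" "\<lambda>k. m - k"]) (auto simp: p)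
  also have "\<dots> = (-1) ^ m * (\<Sum>i\<le>p. (real (2 * m) gchoose i) * (-1) ^ i)"
    unfolding sum_distrib_left
  proof (intro sum.cong refl)
    fix i assume "i \<in> {..p}"
    then have "(-1 :: real) ^ m = (-1) ^ (m - i) * (-1) ^ i" by (simp add: p flip: power_add)
    then show "(-1) ^ (m - i) * real ((2 * m) choose i) = (-1) ^ m * ((real (2 * m) gchoose i) * (-1) ^ i)"
      by (simp add: binomial_gbinomial flip: power_mult_distrib)
  qed
  also have "\<dots> = (-1) ^ m * ((-1) ^ p * (real (2 * m) - 1 gchoose p))"
    by (simp only: gbinomial_sum_lower_neg)
  also have "real (2 * m) - 1 = real (2 * p + 1)" by (simp add: p)
  also have "(real (2 * p + 1) gchoose p) = real ((2 * p + 1) choose p)"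
    by (simp only: binomial_gbinomial)
  also have "(-1) ^ m * ((-1) ^ p * real ((2 * p + 1) choose p)) = - real ((2 * p + 1) choose p)"
    by (simp add: p flip: power_mult_distrib)
  also have "real ((2 * p + 1) choose p) = real ((2 * m) choose m) / 2"
  proof -
    have "(2 * p + 1) choose Suc p = (2 * p + 1) choose p"
      using binomial_symmetric[of p "2 * p + 1"] by simp
    then show ?thesis by (simp add: p)
  qed
  finally show ?thesis by simp
qed

text \<open>Induction on j with varying m: k^2 - (j+1)^2 = (m^2 - (j+1)^2) - (m^2 - k^2), and the
  factor m^2 - k^2 lowers the row \<open>2 * m\<close> to the row \<open>2 * p\<close> with p = m -
  1.\<close>

lemma alternating_square_prod_sum:
  assumes "j < m"
  shows "(\<Sum>k\<in>{1..m}. (-1) ^ k * real ((2 * m) choose (m - k)) * square_prod (Suc j) k)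
     = (-1) ^ Suc j * real ((2 * m) choose m) * (fact j)\<^sup>2 / 2"
  using assms
proof (induction j arbitrary: m)
  case 0
  then show ?case using alternating_binomial_half[of m] by (simp add: square_prod_def)
next
  case (Suc j)
  obtain p where p: "m = Suc p" "j < p" using Suc.prems by (cases m) auto
  have step: "((real m)\<^sup>2 - (real k)\<^sup>2) * real ((2 * m) choose (m - k))
      = real (2 * m) * real (2 * m - 1) * real ((2 * p) choose (p - k))" if "k \<in> {1..p}" for k
  proof -
    define a where "a = p - k"
    have a: "k + a = p" using that by (simp add: a_def)
    have 1: "Suc a * (Suc (2 * p + 1) choose Suc a) = Suc (2 * p + 1) * ((2 * p + 1) choose a)"
      by (rule Suc_times_binomial)
    have 2: "(2 * p + 1) * ((2 * p) choose a) = (2 * p + 1 - a) * ((2 * p + 1) choose a)"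
      using binomial_absorb_comp[of "2 * p + 1" a] by simp
    have 3: "real (2 * p + 1 - a) = real m + real k" using a by (simp add: p)
    have "((real m)\<^sup>2 - (real k)\<^sup>2) * real ((2 * m) choose (m - k))
       = (real m + real k) * (real (Suc a) * real (Suc (2 * p + 1) choose Suc a))"
      using a by (auto simp: p Suc_diff_le power2_eq_square algebra_simps)
    also have "\<dots> = real (2 * m) * (real (2 * p + 1 - a) * real ((2 * p + 1) choose a))"
      unfolding of_nat_mult[symmetric, of "Suc a"] 1 3 by (simp add: p algebra_simps)
    also have "\<dots> = real (2 * m) * real (2 * m - 1) * real ((2 * p) choose (p - k))"
      unfolding of_nat_mult[symmetric, of "2 * p + 1 - a"] 2[symmetric] by (simp add: a_def p algebra_simps)
    finally show ?thesis .
  qed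
  define T where "T k = (-1) ^ k * square_prod (Suc j) k" for k :: nat
  have sp: "square_prod (Suc (Suc j)) k = square_prod (Suc j) k * (((real m)\<^sup>2 - (real (Suc j))\<^sup>2) - ((real m)\<^sup>2 - (real k)\<^sup>2))" for k
    by (simp add: square_prod_def)
  have "(\<Sum>k\<in>{1..m}. (-1) ^ k * real ((2 * m) choose (m - k)) * square_prod (Suc (Suc j)) k)
      = ((real m)\<^sup>2 - (real (Suc j))\<^sup>2) * (\<Sum>k\<in>{1..m}. (-1) ^ k * real ((2 * m) choose (m - k)) * square_prod (Suc j) k)
        - (\<Sum>k\<in>{1..m}. T k * (((real m)\<^sup>2 - (real k)\<^sup>2) * real ((2 * m) choose (m - k))))"
    unfolding sp T_def sum_distrib_left sum_subtractf[symmetric]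
    by (intro sum.cong refl) (simp only: algebra_simps)
  \<comment> \<open>The factor m^2 - k^2 kills the term k = m, which the smaller row does not
    have.\<close>
  also have "(\<Sum>k\<in>{1..m}. T k * (((real m)\<^sup>2 - (real k)\<^sup>2) * real ((2 * m) choose (m - k))))
      = (\<Sum>k\<in>{1..p}. T k * (((real m)\<^sup>2 - (real k)\<^sup>2) * real ((2 * m) choose (m - k))))"
    by (rule sum.mono_neutral_right) (auto simp: p le_Suc_eq)
  also have "\<dots> = (\<Sum>k\<in>{1..p}. T k * (real (2 * m) * real (2 * m - 1) * real ((2 * p) choose (p - k))))"
    by (intro sum.cong refl) (simp only: step)
  also have "\<dots> = real (2 * m) * real (2 * m - 1) *
      (\<Sum>k\<in>{1..p}. (-1) ^ k * real ((2 * p) choose (p - k)) * square_prod (Suc j) k)"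
    by (simp add: T_def sum_distrib_left algebra_simps)
  also have "(\<Sum>k\<in>{1..p}. (-1) ^ k * real ((2 * p) choose (p - k)) * square_prod (Suc j) k)
      = (-1) ^ Suc j * real ((2 * p) choose p) * (fact j)\<^sup>2 / 2"
    by (rule Suc.IH) (rule p)
  also have "(\<Sum>k\<in>{1..m}. (-1) ^ k * real ((2 * m) choose (m - k)) * square_prod (Suc j) k)
      = (-1) ^ Suc j * real ((2 * m) choose m) * (fact j)\<^sup>2 / 2"
    using Suc.prems by (intro Suc.IH) simp
  also have "((real m)\<^sup>2 - (real (Suc j))\<^sup>2) * ((-1) ^ Suc j * real ((2 * m) choose m) * (fact j)\<^sup>2 / 2)
      - real (2 * m) * real (2 * m - 1) * ((-1) ^ Suc j * real ((2 * p) choose p) * (fact j)\<^sup>2 / 2)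
     = (-1) ^ Suc j * (fact j)\<^sup>2 / 2 * ((real m)\<^sup>2 * real ((2 * m) choose m)
         - real (2 * m) * real (2 * m - 1) * real ((2 * p) choose p) - (real (Suc j))\<^sup>2 * real ((2 * m) choose m))"
    by (simp add: field_simps)
  \<comment> \<open>The two contributions with m^2 cancel; the remaining factor - (j+1)^2 produces
    the next squared factorial.\<close>
  also have "real (2 * m) * real (2 * m - 1) * real ((2 * p) choose p) = (real m)\<^sup>2 * real ((2 * m) choose m)"
  proof -
    have "real m * real ((2 * m) choose m) = (4 * real p + 2) * real ((2 * p) choose p)"
      using central_binomial_Suc[of p] by (simp only: p(1))
    then have "(real m)\<^sup>2 * real ((2 * m) choose m) = real m * ((4 * real p + 2) * real ((2 * p) choose p))"
      by (simp only: power2_eq_square mult.assoc)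
    moreover have "real (2 * m - 1) = 2 * real p + 1" by (simp add: p)
    ultimately show ?thesis by (simp add: algebra_simps)
  qed
  finally show ?case
    by (simp add: power_mult_distrib)
qed

text \<open>By \<open>binomial_square_prod\<close> a factor k cancels the division by k. The result
  contains the reciprocal of the central binomial that occurs in
  \<open>poly_log_symbol\<close>.\<close>

lemma alternating_binomial_product:
  assumes "j \<ge> 1" "j \<le> m"
  shows "(\<Sum>k\<in>{1..m}. (-1) ^ k * real ((2 * m) choose (m - k)) * real ((k + j - 1) choose (2 * j - 1)) / real k)
     = (-1) ^ j * real ((2 * m) choose m) / (real j * real ((2 * j) choose j))"
proof -
  obtain i where i: "j = Suc i" using assms by (cases j) auto
  have "(\<Sum>k\<in>{1..m}. (-1) ^ k * real ((2 * m) choose (m - k)) * real ((k + j - 1) choose (2 * j - 1)) / real k)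
     = (\<Sum>k\<in>{1..m}. (-1) ^ k * real ((2 * m) choose (m - k)) * square_prod (Suc i) k) / fact (2 * j - 1)"
    unfolding sum_divide_distrib
  proof (intro sum.cong refl)
    fix k assume "k \<in> {1..m}"
    then have k: "k \<ge> 1" by simp
    have "real ((k + j - 1) choose (2 * j - 1)) = real k * square_prod (Suc i) k / fact (2 * j - 1)"
      using binomial_square_prod[OF k, of i] unfolding i[symmetric] by (simp add: field_simps)
    then show "(-1) ^ k * real ((2 * m) choose (m - k)) * real ((k + j - 1) choose (2 * j - 1)) / real k
       = (-1) ^ k * real ((2 * m) choose (m - k)) * square_prod (Suc i) k / fact (2 * j - 1)"
      using k by simp
  qed
  also have "\<dots> = (-1) ^ j * real ((2 * m) choose m) * (fact i)\<^sup>2 / 2 / fact (2 * j - 1)"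
    using assms by (subst alternating_square_prod_sum) (auto simp: i)
  also have "\<dots> = (-1) ^ j * real ((2 * m) choose m) / (real j * real ((2 * j) choose j))"
  proof -
    have "real ((2 * j) choose j) * (fact j * fact j) = fact (2 * j)"
      using binomial_fact_lemma[of j "2 * j"] by (metis (no_types, lifting) add_diff_cancel_left' le_add1 mult.commute mult_2 of_nat_fact of_nat_mult)
    also have "(fact (2 * j) :: real) = 2 * real j * fact (2 * j - 1)"
      using assms fact_reduce[of "2 * j", where 'a = real] by simp
    finally have "real ((2 * j) choose j) * (real j * fact i * (real j * fact i)) = 2 * real j * fact (2 * j - 1)"
      by (simp add: i)
    then have "(fact i)\<^sup>2 / 2 / fact (2 * j - 1) = 1 / (real j * real ((2 * j) choose j))"
      using assms by (simp add: field_simps power2_eq_square)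
    then show ?thesis by (simp add: field_simps)
  qed
  finally show ?thesis .
qed

lemma one_minus_fps_X_power_nth:
  "((1 - fps_X) ^ n :: 'a::field_char_0 fps) $ i = (-1) ^ i * of_nat (n choose i)"
proof -
  have "(1 - fps_X) ^ n = (\<Sum>k\<le>n. of_nat (n choose k) * (- fps_X) ^ k :: 'a fps)"
    using binomial_ring[of "- fps_X :: 'a fps" 1 n] by simp
  also have "\<dots> $ i = (\<Sum>k\<le>n. if k = i then (-1) ^ i * of_nat (n choose i) else 0)"
    unfolding fps_sum_nth
    by (intro sum.cong refl) (auto simp: power_minus[of fps_X] fps_mult_of_nat_nth mult.assoc fps_of_nat[symmetric] minus_one_power_iff)
  finally show ?thesis by (auto simp: not_le)
qed

text \<open>The central binomials in j cancel and a Taylor polynomial of - log (1 - x) remains. The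
  coefficients on the left are those of (1 - z)^(2m), which the weight contributes; added to log (1
  - x) in the sum rule, this leaves a remainder of order x^(m+1).\<close>

lemma log_symbol_moment:
  "(\<Sum>k\<in>{1..m}. (-1) ^ (m - k) * real ((2 * m) choose (m - k)) * poly (log_symbol k) x)
     = - ((-1) ^ m) * real ((2 * m) choose m) / 2 * (\<Sum>j\<in>{1..m}. x ^ j / real j)"
proof -
  have "(\<Sum>k\<in>{1..m}. (-1) ^ (m - k) * real ((2 * m) choose (m - k)) * poly (log_symbol k) x)
    = (\<Sum>k\<in>{1..m}. \<Sum>j\<in>{1..m}. - ((-1) ^ m) / 2 * (real ((2 * j) choose j) * (- x) ^ j) *
        ((-1) ^ k * real ((2 * m) choose (m - k)) * real ((k + j - 1) choose (2 * j - 1)) / real k))"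
  proof (intro sum.cong refl)
    fix k assume "k \<in> {1..m}"
    then have k: "1 \<le> k" "k \<le> m" by auto
    have sgn: "(-1 :: real) ^ (m - k) = (-1) ^ m * (-1) ^ k"
      using k by (simp add: minus_one_power_iff)
    show "(-1) ^ (m - k) * real ((2 * m) choose (m - k)) * poly (log_symbol k) x
      = (\<Sum>j\<in>{1..m}. - ((-1) ^ m) / 2 * (real ((2 * j) choose j) * (- x) ^ j) *
        ((-1) ^ k * real ((2 * m) choose (m - k)) * real ((k + j - 1) choose (2 * j - 1)) / real k))"
      unfolding poly_log_symbol[OF k] sgn
      by (simp add: sum_distrib_left sum_divide_distrib sum_negf mult_ac)
  qed
  also have "\<dots> = (\<Sum>j\<in>{1..m}. - ((-1) ^ m) / 2 * (real ((2 * j) choose j) * (- x) ^ j) *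
      (\<Sum>k\<in>{1..m}. (-1) ^ k * real ((2 * m) choose (m - k)) * real ((k + j - 1) choose (2 * j - 1)) / real k))"
    by (subst sum.swap) (simp only: sum_distrib_left)
  also have "\<dots> = (\<Sum>j\<in>{1..m}. - ((-1) ^ m) * real ((2 * m) choose m) / 2 * (x ^ j / real j))"
  proof (intro sum.cong refl)
    fix j assume "j \<in> {1..m}"
    then have j: "1 \<le> j" "j \<le> m" by auto
    have "real ((2 * j) choose j) \<noteq> 0" by simp
    moreover have "(-1) ^ j * (- x) ^ j = x ^ j" by (simp flip: power_mult_distrib)
    ultimately show "- ((-1) ^ m) / 2 * (real ((2 * j) choose j) * (- x) ^ j) *
      (\<Sum>k\<in>{1..m}. (-1) ^ k * real ((2 * m) choose (m - k)) * real ((k + j - 1) choose (2 * j - 1)) / real k)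
      = - ((-1) ^ m) * real ((2 * m) choose m) / 2 * (x ^ j / real j)"
      unfolding alternating_binomial_product[OF j] using j by (simp add: field_simps)
  qed
  finally show ?thesis by (simp only: sum_distrib_left)
qed

subsection \<open>The step-by-step sum rule\<close>

context verblunsky_sequence
begin

definition u :: "nat \<Rightarrow> complex \<Rightarrow> complex" where "u n z = z * phi n z / phis n z"

definition u_fps :: "nat \<Rightarrow> complex fps" where
  "u_fps n = fps_X * fps_of_poly (phi_poly n) / fps_of_poly (phis_poly n)"

lemma phis_poly_nth_0: "fps_of_poly (phis_poly n) $ 0 \<noteq> 0"
  using phis_disc[of 0 n] by (simp add: poly_0_coeff_0)

lemma u_has_fps_expansion: "u n has_fps_expansion u_fps n"
proof -
  have poly: "poly p has_fps_expansion fps_of_poly p" for p :: "complex poly"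
    by (simp add: has_fps_expansion_def)
  show ?thesis
    unfolding u_def u_fps_def
    by (intro fps_expansion_intros poly phis_poly_nth_0)
qed

lemma u_fps_mult: "u_fps n * fps_of_poly (phis_poly n) = fps_X * fps_of_poly (phi_poly n)"
  using phis_poly_nth_0[of n] by (simp add: u_fps_def fps_divide_unit mult.assoc inverse_mult_eq_1)

lemma u_fps_0: "u_fps n $ 0 = 0"
  using phis_poly_nth_0[of n] by (simp add: u_fps_def fps_divide_unit mult.assoc)

text \<open>Quotient of the two Szego recursions, in which the normalisation 1 /
  \<open>rho n\<close> cancels. It is kept free of division so that coefficients can be
  compared.\<close>

lemma u_fps_Suc: "u_fps (Suc n) * (1 - fps_const (\<alpha> n) * u_fps n) = fps_X * (u_fps n - fps_const (cnj (\<alpha> n)))"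
proof -
  define P S r where "P = fps_of_poly (phi_poly n)" and "S = fps_of_poly (phis_poly n)"
    and "r = fps_const (complex_of_real (1 / rho n))"
  have U: "u_fps n * S = fps_X * P" by (simp add: S_def P_def u_fps_mult)
  have "u_fps (Suc n) * (r * (S - fps_const (\<alpha> n) * (fps_X * P))) = fps_X * (r * (fps_X * P - fps_const (cnj (\<alpha> n)) * S))"
    using u_fps_mult[of "Suc n"]
    unfolding phi_poly_Suc phis_poly_Suc fps_of_poly_smult fps_of_poly_diff fps_of_poly_pCons r_def P_def S_def
    by (simp add: mult.commute)
  then have "(r * S) * (u_fps (Suc n) * (1 - fps_const (\<alpha> n) * u_fps n)) = (r * S) * (fps_X * (u_fps n - fps_const (cnj (\<alpha> n))))"
    unfolding U[symmetric] by (simp add: algebra_simps)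
  moreover have "r * S \<noteq> 0"
  proof -
    have "(r * S) $ 0 \<noteq> 0"
      using phis_poly_nth_0[of n] rho_pos[of n] by (simp add: r_def S_def)
    then show ?thesis by auto
  qed
  ultimately show ?thesis by simp
qed

lemma cmod_u_le: "cmod z \<le> 1 \<Longrightarrow> cmod (u n z) \<le> 1"
  using phis_disc[of z n] by (simp add: u_def norm_divide divide_le_eq_1)

text \<open>|\<alpha>_n u_n| < 1 on the closed disc puts 1 - \<alpha>_n u_n into the right half
  plane, where the principal logarithm is holomorphic.\<close>

lemma one_minus_u_slit:
  assumes "cmod z \<le> 1"
  shows "1 - \<alpha> n * u n z \<notin> \<real>\<^sub>\<le>\<^sub>0" "1 - \<alpha> n * u n z \<noteq> 0"
proof -
  have "cmod (\<alpha> n * u n z) \<le> cmod (\<alpha> n) * 1"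
    unfolding norm_mult by (rule mult_left_mono) (use cmod_u_le[OF assms] in auto)
  then have "Re (\<alpha> n * u n z) < 1"
    using cmod_less_1[of n] complex_Re_le_cmod[of "\<alpha> n * u n z"] by linarith
  then have "Re (1 - \<alpha> n * u n z) > 0" by simp
  then show "1 - \<alpha> n * u n z \<notin> \<real>\<^sub>\<le>\<^sub>0" "1 - \<alpha> n * u n z \<noteq> 0"
    by (auto simp: complex_nonpos_Reals_iff simp del: minus_complex.sel times_complex.sel)
qed

definition log_step :: "nat \<Rightarrow> complex \<Rightarrow> complex" where
  "log_step n z = Ln (1 - \<alpha> n * u n z)"

definition log_step_fps :: "nat \<Rightarrow> complex fps" where
  "log_step_fps n = fps_expansion (log_step n) 0"

lemma holomorphic_u: "u n holomorphic_on ball 0 1"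
  unfolding u_def using phis_disc by (intro holomorphic_intros) auto

lemma holomorphic_log_step: "log_step n holomorphic_on ball 0 1"
  unfolding log_step_def
  by (intro holomorphic_intros holomorphic_u) (use one_minus_u_slit in auto)

lemma continuous_log_step: "continuous_on (cball 0 1) (log_step n)"
proof -
  have "continuous_on (cball 0 1) (u n)"
    unfolding u_def using phis_disc by (intro continuous_intros) auto
  then show ?thesis
    unfolding log_step_def
    by (intro continuous_intros) (use one_minus_u_slit in auto)
qed

lemma log_step_has_fps_expansion: "log_step n has_fps_expansion log_step_fps n"
  unfolding log_step_fps_def
  by (rule has_fps_expansion_fps_expansion[of "ball 0 1"]) (auto intro: holomorphic_log_step)

lemma log_step_fps_0: "log_step_fps n $ 0 = 0"
  using fps_nth_fps_expansion[OF log_step_has_fps_expansion, of n 0]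
  by (simp add: log_step_def u_def)

text \<open>The logarithm enters the power series side only through its logarithmic derivative, an
  identity of functions near 0 that is carried over to their expansions.\<close>

lemma log_step_fps_deriv:
  "fps_deriv (log_step_fps n) * (1 - fps_const (\<alpha> n) * u_fps n) = - fps_deriv (fps_const (\<alpha> n) * u_fps n)"
proof -
  define y where "y z = \<alpha> n * u n z" for z
  have y: "y has_fps_expansion fps_const (\<alpha> n) * u_fps n"
    unfolding y_def by (intro fps_expansion_intros u_has_fps_expansion)
  have 1: "(\<lambda>z. deriv (log_step n) z * (1 - y z)) has_fps_expansion
      fps_deriv (log_step_fps n) * (1 - fps_const (\<alpha> n) * u_fps n)"
    by (intro fps_expansion_intros log_step_has_fps_expansion y)
  have 2: "(\<lambda>z. - deriv y z) has_fps_expansion - fps_deriv (fps_const (\<alpha> n) * u_fps n)"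
    by (intro has_fps_expansion_minus has_fps_expansion_deriv y)
  have "eventually (\<lambda>z. z \<in> ball 0 1) (nhds (0::complex))"
    by (intro eventually_nhds_in_open) auto
  then have "eventually (\<lambda>z. deriv (log_step n) z * (1 - y z) = - deriv y z) (nhds 0)"
  proof eventually_elim
    case (elim z)
    have "(u n has_field_derivative deriv (u n) z) (at z)"
      using holomorphic_u elim by (intro holomorphic_derivI[of _ "ball 0 1"]) auto
    then have yd: "(y has_field_derivative \<alpha> n * deriv (u n) z) (at z)"
      unfolding y_def by (rule DERIV_cmult)
    have slit: "1 - y z \<notin> \<real>\<^sub>\<le>\<^sub>0" "1 - y z \<noteq> 0"
      unfolding y_def using one_minus_u_slit[of z n] elim by auto
    have "(log_step n has_field_derivative (0 - \<alpha> n * deriv (u n) z) / (1 - y z)) (at z)"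
      unfolding log_step_def[abs_def] y_def[symmetric]
      by (rule derivative_eq_intros yd slit refl)+ (simp add: field_simps)
    then show ?case using DERIV_imp_deriv[OF yd] slit by (simp add: DERIV_imp_deriv)
  qed
  from has_fps_expansion_cong[OF this refl] 1 have "(\<lambda>z. - deriv y z) has_fps_expansion fps_deriv (log_step_fps n) * (1 - fps_const (\<alpha> n) * u_fps n)"
    by (rule iffD1)
  then show ?thesis using 2 by (rule fps_expansion_unique_complex)
qed

section \<open>The weight and the increment of the Szego integral\<close>

text \<open>On the circle 1 - cos \<theta> = - (1 - z)^2 / (2 z). The factor z^(-m) is what selects
  coefficient m in \<open>integral_weight_coeff\<close>.\<close>

lemma one_minus_cos_power:
  "complex_of_real ((1 - cos \<theta>) ^ m) = (-1/2) ^ m * ((1 - cis \<theta>) ^ (2 * m) / cis \<theta> ^ m)"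
proof -
  define z where "z = cis \<theta>"
  have z: "z \<noteq> 0" by (simp add: z_def)
  have c: "complex_of_real (cos \<theta>) = (z + 1 / z) / 2"
  proof -
    have "1 / z = cis (- \<theta>)" by (simp add: z_def inverse_eq_divide[symmetric])
    then have "z + 1 / z = 2 * complex_of_real (cos \<theta>)"
      by (simp add: z_def cis.code complex_eq_iff)
    then show ?thesis by simp
  qed
  have "complex_of_real (1 - cos \<theta>) = (-1/2) * ((1 - z)\<^sup>2 / z)"
    using z by (simp add: c field_simps power2_eq_square)
  then have "complex_of_real ((1 - cos \<theta>) ^ m) = ((-1/2) * ((1 - z)\<^sup>2 / z)) ^ m" by simp
  also have "\<dots> = (-1/2) ^ m * ((1 - z) ^ (2 * m) / z ^ m)"
    by (simp only: power_mult_distrib power_divide power_mult)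
  finally show ?thesis by (simp only: z_def)
qed

lemma integral_weight_coeff:
  assumes "continuous_on (cball 0 1) g" "g holomorphic_on ball 0 1" "g has_fps_expansion G"
  shows "(LINT \<theta>|angle_measure. complex_of_real ((1 - cos \<theta>) ^ m) * g (cis \<theta>))
     = (-1/2) ^ m * ((1 - fps_X) ^ (2 * m) * G) $ m"
proof -
  have "(LINT \<theta>|angle_measure. complex_of_real ((1 - cos \<theta>) ^ m) * g (cis \<theta>))
     = (LINT \<theta>|angle_measure. (-1/2) ^ m * (((1 - cis \<theta>) ^ (2 * m) * g (cis \<theta>)) / cis \<theta> ^ m))"
    unfolding one_minus_cos_power by (simp add: mult_ac)
  also have "\<dots> = (-1/2) ^ m * (LINT \<theta>|angle_measure. ((1 - cis \<theta>) ^ (2 * m) * g (cis \<theta>)) / cis \<theta> ^ m)"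
    by (rule integral_mult_right_zero)
  also have "(LINT \<theta>|angle_measure. ((1 - cis \<theta>) ^ (2 * m) * g (cis \<theta>)) / cis \<theta> ^ m) = ((1 - fps_X) ^ (2 * m) * G) $ m"
    by (rule integral_circle_coeff[where g = "\<lambda>z. (1 - z) ^ (2 * m) * g z"])
       (intro continuous_intros holomorphic_intros fps_expansion_intros assms)+
  finally show ?thesis .
qed

definition weight_mean :: "nat \<Rightarrow> real" where
  "weight_mean m = real ((2 * m) choose m) / 2 ^ m"

lemma integral_weight: "(LINT \<theta>|angle_measure. (1 - cos \<theta>) ^ m) = weight_mean m"
proof -
  have "complex_of_real (LINT \<theta>|angle_measure. (1 - cos \<theta>) ^ m) = (LINT \<theta>|angle_measure. complex_of_real ((1 - cos \<theta>) ^ m) * 1)"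
    by (simp add: integral_complex_of_real[symmetric])
  also have "\<dots> = (-1/2) ^ m * ((1 - fps_X) ^ (2 * m) * 1) $ m"
    by (rule integral_weight_coeff) auto
  also have "\<dots> = complex_of_real (weight_mean m)"
    by (simp add: one_minus_fps_X_power_nth weight_mean_def power_divide minus_one_power_iff)
  finally show ?thesis using of_real_eq_iff by blast
qed

text \<open>This is Z_N = - \<integral> h log |phi_N|^2; the sign sits in
  \<open>bs_density\<close>.\<close>

definition szego_integral :: "nat \<Rightarrow> nat \<Rightarrow> real" where
  "szego_integral m N = (LINT \<theta>|angle_measure. (1 - cos \<theta>) ^ m * ln (bs_density N \<theta>))"

lemma integrable_szego_integral: "integrable angle_measure (\<lambda>\<theta>. (1 - cos \<theta>) ^ m * ln (bs_density N \<theta>))"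
  using bs_density_pos by (intro integrable_angle_measure continuous_intros) (auto simp: less_imp_neq[symmetric])

lemma szego_integral_0: "szego_integral m 0 = 0"
  by (simp add: szego_integral_def bs_density_def)

text \<open>On the circle a polynomial and its reversal have equal modulus, and for the reversals
  the recursion is multiplicative: \<open>phis (Suc n)\<close> is \<open>phis n\<close> times (1 -
  \<alpha>_n u_n) / \<open>rho n\<close>.\<close>

lemma ln_bs_density_Suc:
  "ln (bs_density (Suc n) \<theta>) = ln (bs_density n \<theta>) + ln (1 - (cmod (\<alpha> n))\<^sup>2) - 2 * Re (log_step n (cis \<theta>))"
proof -
  define z where "z = cis \<theta>"
  have z: "cmod z = 1" by (simp add: z_def)
  have ne: "phis n z \<noteq> 0" using phis_disc z by auto
  have ne': "1 - \<alpha> n * u n z \<noteq> 0" using one_minus_u_slit z by auto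
  have "phis (Suc n) z = of_real (1 / rho n) * (phis n z * (1 - \<alpha> n * u n z))"
    using ne by (simp add: phis_Suc u_def right_diff_distrib)
  then have "cmod (phis (Suc n) z) = cmod (phis n z) * cmod (1 - \<alpha> n * u n z) / rho n"
    using rho_pos[of n] by (simp add: norm_mult norm_divide)
  then have "bs_density (Suc n) \<theta> = bs_density n \<theta> * (rho n)\<^sup>2 / (cmod (1 - \<alpha> n * u n z))\<^sup>2"
    by (simp add: bs_density_def z_def[symmetric] cmod_phis_circle[OF z, symmetric] power_divide power_mult_distrib)
  then have "ln (bs_density (Suc n) \<theta>) = ln (bs_density n \<theta>) + ln ((rho n)\<^sup>2) - ln ((cmod (1 - \<alpha> n * u n z))\<^sup>2)"
    using bs_density_pos[of n \<theta>] rho_pos[of n] ne' by (simp add: ln_mult ln_div)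
  also have "ln ((cmod (1 - \<alpha> n * u n z))\<^sup>2) = 2 * Re (log_step n z)"
    using ne' by (simp add: log_step_def ln_realpow)
  finally show ?thesis by (simp add: rho_square z_def)
qed

lemma szego_integral_Suc:
  "szego_integral m (Suc n) = szego_integral m n + weight_mean m * ln (1 - (cmod (\<alpha> n))\<^sup>2)
     - 2 * (-1/2) ^ m * Re (((1 - fps_X) ^ (2 * m) * log_step_fps n) $ m)"
proof -
  define h where "h \<theta> = (1 - cos \<theta>) ^ m" for \<theta> :: real
  have cont: "continuous_on UNIV (\<lambda>\<theta>. log_step n (cis \<theta>))"
    by (intro continuous_on_cis_compose continuous_on_subset[OF continuous_log_step]) auto
  have h: "integrable angle_measure h"
    unfolding h_def by (intro integrable_angle_measure continuous_intros)
  have hc: "integrable angle_measure (\<lambda>\<theta>. of_real (h \<theta>) * log_step n (cis \<theta>))"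
    unfolding h_def by (intro integrable_angle_measure continuous_intros cont)
  have hb: "integrable angle_measure (\<lambda>\<theta>. h \<theta> * ln (bs_density n \<theta>))"
    unfolding h_def by (rule integrable_szego_integral)
  have "szego_integral m (Suc n) = (LINT \<theta>|angle_measure. h \<theta> * ln (bs_density n \<theta>)
      + h \<theta> * ln (1 - (cmod (\<alpha> n))\<^sup>2) - 2 * Re (of_real (h \<theta>) * log_step n (cis \<theta>)))"
    unfolding szego_integral_def h_def[symmetric]
    by (intro Bochner_Integration.integral_cong refl) (simp add: ln_bs_density_Suc algebra_simps)
  also have "\<dots> = (LINT \<theta>|angle_measure. h \<theta> * ln (bs_density n \<theta>))
      + (LINT \<theta>|angle_measure. h \<theta>) * ln (1 - (cmod (\<alpha> n))\<^sup>2)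
      - 2 * Re (LINT \<theta>|angle_measure. of_real (h \<theta>) * log_step n (cis \<theta>))"
    using h hb hc by (simp del: Re_complex_of_real times_complex.sel add: integral_Re integrable_Re)
  also have "(LINT \<theta>|angle_measure. of_real (h \<theta>) * log_step n (cis \<theta>))
      = of_real ((-1/2) ^ m) * ((1 - fps_X) ^ (2 * m) * log_step_fps n) $ m"
    unfolding h_def
    by (subst integral_weight_coeff[OF continuous_log_step holomorphic_log_step log_step_has_fps_expansion]) simp
  finally show ?thesis
    unfolding h_def integral_weight szego_integral_def by simp
qed

end

subsection \<open>Moments of the Bernstein--Szego measures\<close>

locale verblunsky_measure = verblunsky_sequence +
  fixes M :: "complex measure"
  assumes sets_M: "sets M = sets circle_borel"
    and prob_M: "prob_space M"
    and coeffs: "verblunsky_coeffs M \<alpha>"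
begin

sublocale prob_space M by (rule prob_M)

lemma space_M: "space M = sphere 0 1"
  using sets_eq_imp_space_eq[OF sets_M] by (simp add: circle_borel_def space_restrict_space)

lemma measurable_M:
  fixes f :: "complex \<Rightarrow> 'b::topological_space"
  assumes "continuous_on (sphere 0 1) f"
  shows "f \<in> borel_measurable M"
  using borel_measurable_continuous_on_restrict[OF assms]
  unfolding measurable_cong_sets[OF sets_M refl] circle_borel_def .

lemma integrable_M:
  fixes f :: "complex \<Rightarrow> 'b::euclidean_space"
  assumes "continuous_on (sphere 0 1) f"
  shows "integrable M f"
proof -
  have "compact (f ` sphere 0 1)"
    by (intro compact_continuous_image assms) simp
  then obtain B where "\<forall>y\<in>f ` sphere 0 1. norm y \<le> B"
    by (meson bounded_iff compact_imp_bounded)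
  then show ?thesis
    by (intro integrable_const_bound[where B = B] measurable_M assms AE_I2) (auto simp: space_M)
qed

text \<open>The recursion in \<open>verblunsky_coeffs\<close> is imposed off 0 only; a difference of
  polynomials that vanishes there has infinitely many roots and is therefore 0.\<close>

lemma orthonormal_poly_eq: "orthonormal_poly M n = phi_poly n"
proof (induction n)
  case 0
  have "L2_norm M 1 = 1" by (simp add: L2_norm_def prob_space)
  then show ?case by (simp add: orthonormal_poly.simps[of M 0])
next
  case (Suc n)
  have eq: "poly (orthonormal_poly M (Suc n)) z = phi (Suc n) z" if "z \<noteq> 0" for z
    using coeffs that unfolding verblunsky_coeffs_def
    by (simp add: Suc phi_Suc phis_eq[OF that] rho_def mult.assoc)
  have "orthonormal_poly M (Suc n) - phi_poly (Suc n) = 0"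
  proof (rule ccontr)
    assume "orthonormal_poly M (Suc n) - phi_poly (Suc n) \<noteq> 0"
    then have "finite {z. poly (orthonormal_poly M (Suc n) - phi_poly (Suc n)) z = 0}"
      by (rule poly_roots_finite)
    moreover have "UNIV - {0} \<subseteq> {z. poly (orthonormal_poly M (Suc n) - phi_poly (Suc n)) z = 0}"
      using eq by auto
    ultimately have "finite (UNIV - {0} :: complex set)" by (rule finite_subset[rotated])
    then show False using infinite_UNIV_char_0[where 'a = complex] by simp
  qed
  then show ?case by simp
qed

lemma phi_poly_nonzero: "phi_poly n \<noteq> 0"
  using coeff_phi_nonzero[of n] by auto

lemma integral_phi_square: "(LINT z|M. (cmod (phi n z))\<^sup>2) = 1"
proof -
  define P where "P = monom 1 n
            - (\<Sum>k<n. smult (L2_inner M (orthonormal_poly M k) (monom 1 n)) (orthonormal_poly M k))"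
  have phi: "phi_poly n = smult (complex_of_real (1 / L2_norm M P)) P"
    using orthonormal_poly.simps[of M n] by (simp add: P_def orthonormal_poly_eq Let_def)
  \<comment> \<open>Were the norm 0, division by zero would make \<open>phi_poly n\<close> the zero
    polynomial.\<close>
  then have "(L2_norm M P)\<^sup>2 \<noteq> 0" using phi_poly_nonzero[of n] by auto
  moreover have "(L2_norm M P)\<^sup>2 = (LINT z|M. (cmod (poly P z))\<^sup>2)"
    unfolding L2_norm_def by (rule real_sqrt_pow2) (simp add: Bochner_Integration.integral_nonneg)
  moreover have "(LINT z|M. (cmod (phi n z))\<^sup>2) = (LINT z|M. (cmod (poly P z))\<^sup>2) / (L2_norm M P)\<^sup>2"
    unfolding phi by (simp add: norm_mult norm_divide power_mult_distrib power_divide)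
  ultimately show ?thesis by (metis divide_self)
qed

text \<open>In the Gram--Schmidt formula the means of the earlier polynomials vanish except for k =
  0, and that term subtracts exactly the mean of z^n. The comparison of moments rests on this
  orthogonality to constants.\<close>

lemma integral_phi:
  assumes "n \<ge> 1"
  shows "(LINT z|M. phi n z) = 0"
  using assms
proof (induction n rule: less_induct)
  case (less n)
  define c where "c k = L2_inner M (phi_poly k) (monom 1 n)" for k
  define P where "P = monom 1 n - (\<Sum>k<n. smult (c k) (phi_poly k))"
  have phi: "phi_poly n = smult (complex_of_real (1 / L2_norm M P)) P"
    using orthonormal_poly.simps[of M n] by (simp add: P_def c_def orthonormal_poly_eq Let_def)
  have int: "integrable M (\<lambda>z. poly p z)" for p
    by (intro integrable_M continuous_intros)
  have z0: "(LINT z|M. phi k z) = (if k = 0 then 1 else 0)" if "k < n" for k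
    using less.IH[of k] that by (auto simp: prob_space)
  have "(LINT z|M. poly P z) = (LINT z|M. poly (monom 1 n) z) - (\<Sum>k<n. c k * (LINT z|M. phi k z))"
    unfolding P_def by (simp add: poly_sum int)
  also have "(\<Sum>k<n. c k * (LINT z|M. phi k z)) = (\<Sum>k<n. if k = 0 then c 0 else 0)"
    by (intro sum.cong refl) (auto simp: z0)
  also have "\<dots> = c 0" using less.prems by simp
  also have "c 0 = (LINT z|M. poly (monom 1 n) z)"
    by (simp add: c_def L2_inner_def)
  finally show ?case unfolding phi by simp
qed

text \<open>The conditions for n = 1, ..., N form a triangular system with nonzero diagonal. They
  fix the moments up to the factor \<open>A 0\<close>, which for the Bernstein--Szego measure is not
  yet known to be 1.\<close>

lemma moments_determined:
  assumes A: "\<And>n. 1 \<le> n \<Longrightarrow> n \<le> N \<Longrightarrow> (\<Sum>i\<le>n. coeff (phi_poly n) i * A i) = 0"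
    and B: "\<And>n. 1 \<le> n \<Longrightarrow> n \<le> N \<Longrightarrow> (\<Sum>i\<le>n. coeff (phi_poly n) i * B i) = 0"
    and "B 0 = 1" and "k \<le> N"
  shows "A k = A 0 * B k"
  using \<open>k \<le> N\<close>
proof (induction k rule: less_induct)
  case (less k)
  show ?case
  proof (cases k)
    case 0 then show ?thesis using \<open>B 0 = 1\<close> by simp
  next
    case (Suc j)
    have eq: "(\<Sum>i\<le>j. coeff (phi_poly k) i * A i) = A 0 * (\<Sum>i\<le>j. coeff (phi_poly k) i * B i)"
      unfolding sum_distrib_left
    proof (intro sum.cong refl)
      fix i assume "i \<in> {..j}"
      then have "A i = A 0 * B i" using less.prems Suc by (intro less.IH) auto
      then show "coeff (phi_poly k) i * A i = A 0 * (coeff (phi_poly k) i * B i)" by simp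
    qed
    have "coeff (phi_poly k) k * A k = - (\<Sum>i\<le>j. coeff (phi_poly k) i * A i)"
      using A[of k] less.prems Suc by (simp add: eq_neg_iff_add_eq_0 add.commute)
    also have "\<dots> = A 0 * (- (\<Sum>i\<le>j. coeff (phi_poly k) i * B i))" by (simp add: eq)
    also have "- (\<Sum>i\<le>j. coeff (phi_poly k) i * B i) = coeff (phi_poly k) k * B k"
      using B[of k] less.prems Suc by (simp add: neg_eq_iff_add_eq_0)
    finally show ?thesis using coeff_phi_nonzero[of k] by simp
  qed
qed

lemma poly_phi_sum: "phi n z = (\<Sum>i\<le>n. coeff (phi_poly n) i * z ^ i)"
proof -
  have "phi n z = (\<Sum>i\<le>degree (phi_poly n). coeff (phi_poly n) i * z ^ i)" by (rule poly_altdef)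
  also have "\<dots> = (\<Sum>i\<le>n. coeff (phi_poly n) i * z ^ i)"
    by (rule sum.mono_neutral_left) (auto simp: degree_phi not_le coeff_eq_0)
  finally show ?thesis .
qed

definition bs_mass :: "nat \<Rightarrow> real" where
  "bs_mass N = (LINT \<theta>|angle_measure. bs_density N \<theta>)"

lemma bs_moment:
  assumes "k \<le> N"
  shows "(LINT \<theta>|angle_measure. cis \<theta> ^ k * of_real (bs_density N \<theta>)) = of_real (bs_mass N) * (LINT z|M. z ^ k)"
proof -
  define A where "A k = (LINT \<theta>|angle_measure. cis \<theta> ^ k * of_real (bs_density N \<theta>))" for k
  define B where "B k = (LINT z|M. z ^ k)" for k
  have intA: "integrable angle_measure (\<lambda>\<theta>. cis \<theta> ^ k * of_real (bs_density N \<theta>))" for k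
    by (intro integrable_angle_measure continuous_intros)
  have intB: "integrable M (\<lambda>z. z ^ k)" for k
    by (intro integrable_M continuous_intros)
  have "A k = A 0 * B k"
  proof (rule moments_determined)
    show "B 0 = 1" by (simp add: B_def prob_space)
    show "k \<le> N" by (rule assms)
    fix n :: nat assume n: "1 \<le> n" "n \<le> N"
    have "(\<Sum>i\<le>n. coeff (phi_poly n) i * A i) = (LINT \<theta>|angle_measure. phi n (cis \<theta>) * of_real (bs_density N \<theta>))"
      unfolding A_def poly_phi_sum sum_distrib_right mult.assoc using intA
      by (subst Bochner_Integration.integral_sum) auto
    also have "\<dots> = 0" using bs_orthogonal[of n N 0] n by simp
    finally show "(\<Sum>i\<le>n. coeff (phi_poly n) i * A i) = 0" .
    have "(\<Sum>i\<le>n. coeff (phi_poly n) i * B i) = (LINT z|M. phi n z)"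
      unfolding B_def poly_phi_sum using intB by (subst Bochner_Integration.integral_sum) auto
    also have "\<dots> = 0" using integral_phi n by simp
    finally show "(\<Sum>i\<le>n. coeff (phi_poly n) i * B i) = 0" .
  qed
  moreover have "A 0 = of_real (bs_mass N)"
    unfolding A_def bs_mass_def by (simp add: integral_complex_of_real)
  ultimately show ?thesis by (simp add: A_def B_def)
qed

text \<open>On the circle the integrand is z^(i - d) or the conjugate of z^(d - i); the assumptions
  keep the exponent at most N.\<close>

lemma bs_moment_cnj:
  assumes "d \<le> N" "i \<le> d + N"
  shows "(LINT \<theta>|angle_measure. cnj (cis \<theta>) ^ d * cis \<theta> ^ i * of_real (bs_density N \<theta>))
     = of_real (bs_mass N) * (LINT z|M. cnj z ^ d * z ^ i)"
proof (cases "d \<le> i")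
  case True
  have eq: "cnj z ^ d * z ^ i = z ^ (i - d)" if "cmod z = 1" for z
  proof -
    have "cnj z ^ d * z ^ i = (z * cnj z) ^ d * z ^ (i - d)"
      using True by (simp add: power_mult_distrib flip: power_add)
    then show ?thesis using mult_cnj_circle[OF that] by simp
  qed
  have "(LINT z|M. cnj z ^ d * z ^ i) = (LINT z|M. z ^ (i - d))"
    by (intro Bochner_Integration.integral_cong refl) (simp add: space_M eq)
  then show ?thesis using bs_moment[of "i - d" N] assms by (simp add: eq)
next
  case False
  have eq: "cnj z ^ d * z ^ i = cnj (z ^ (d - i))" if "cmod z = 1" for z
  proof -
    have "cnj z ^ d * z ^ i = (z * cnj z) ^ i * cnj z ^ (d - i)"
      using False by (simp add: power_mult_distrib flip: power_add)
    then show ?thesis using mult_cnj_circle[OF that] by simp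
  qed
  have 1: "(LINT z|M. cnj z ^ d * z ^ i) = (LINT z|M. cnj (z ^ (d - i)))"
    by (intro Bochner_Integration.integral_cong refl) (simp add: space_M eq)
  have 2: "(LINT \<theta>|angle_measure. cnj (cis \<theta>) ^ d * cis \<theta> ^ i * of_real (bs_density N \<theta>))
      = (LINT \<theta>|angle_measure. cnj (cis \<theta> ^ (d - i) * of_real (bs_density N \<theta>)))"
    by (intro Bochner_Integration.integral_cong refl) (simp add: eq)
  have "d - i \<le> N" using assms by simp
  then show ?thesis unfolding 1 2 Bochner_Integration.integral_cnj by (simp only: bs_moment) simp
qed

section \<open>Trigonometric polynomials as test functions\<close>

text \<open>On the circle F is the Laurent polynomial z^(-d) q(z); the shift by d encodes negative
  frequencies by an ordinary polynomial.\<close>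

definition trig_rep :: "(complex \<Rightarrow> real) \<Rightarrow> nat \<Rightarrow> complex poly \<Rightarrow> bool" where
  "trig_rep F d q \<longleftrightarrow> (\<forall>z. cmod z = 1 \<longrightarrow> of_real (F z) * z ^ d = poly q z)"

lemma trig_repD:
  assumes "trig_rep F d q" "cmod z = 1"
  shows "of_real (F z) = cnj z ^ d * poly q z"
proof -
  have "cnj z ^ d * poly q z = cnj z ^ d * (of_real (F z) * z ^ d)"
    using assms by (simp add: trig_rep_def)
  also have "\<dots> = of_real (F z) * (z * cnj z) ^ d" by (simp add: power_mult_distrib mult_ac)
  finally have "cnj z ^ d * poly q z = of_real (F z) * (z * cnj z) ^ d" .
  then show ?thesis using mult_cnj_circle[OF assms(2)] by simp
qed

lemma bs_trig:
  assumes F: "trig_rep F d q" and d: "d \<le> N" "degree q \<le> d + N"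
  shows "(LINT \<theta>|angle_measure. F (cis \<theta>) * bs_density N \<theta>) = bs_mass N * (LINT z|M. F z)"
proof -
  have intA: "integrable angle_measure (\<lambda>\<theta>. coeff q i * (cnj (cis \<theta>) ^ d * cis \<theta> ^ i * of_real (bs_density N \<theta>)))" for i
    by (intro integrable_angle_measure continuous_intros)
  have intB: "integrable M (\<lambda>z. coeff q i * (cnj z ^ d * z ^ i))" for i
    by (intro integrable_M continuous_intros)
  have "complex_of_real (LINT \<theta>|angle_measure. F (cis \<theta>) * bs_density N \<theta>)
      = (LINT \<theta>|angle_measure. (\<Sum>i\<le>degree q. coeff q i * (cnj (cis \<theta>) ^ d * cis \<theta> ^ i * of_real (bs_density N \<theta>))))"
    unfolding integral_complex_of_real[symmetric]
    by (intro Bochner_Integration.integral_cong refl)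
       (simp add: trig_repD[OF F] poly_altdef sum_distrib_left sum_distrib_right mult_ac)
  also have "\<dots> = (\<Sum>i\<le>degree q. coeff q i * (of_real (bs_mass N) * (LINT z|M. cnj z ^ d * z ^ i)))"
    using d by (subst Bochner_Integration.integral_sum[OF intA]) (auto intro!: sum.cong simp: bs_moment_cnj)
  also have "\<dots> = of_real (bs_mass N) * (\<Sum>i\<le>degree q. (LINT z|M. coeff q i * (cnj z ^ d * z ^ i)))"
    by (simp add: sum_distrib_left mult_ac)
  also have "(\<Sum>i\<le>degree q. (LINT z|M. coeff q i * (cnj z ^ d * z ^ i))) = (LINT z|M. (\<Sum>i\<le>degree q. coeff q i * (cnj z ^ d * z ^ i)))"
    by (rule Bochner_Integration.integral_sum[OF intB, symmetric])
  also have "\<dots> = (LINT z|M. of_real (F z))"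
    by (intro Bochner_Integration.integral_cong refl)
       (simp add: space_M trig_repD[OF F] poly_altdef sum_distrib_left mult_ac)
  also have "\<dots> = of_real (LINT z|M. F z)" by (rule integral_complex_of_real)
  finally show ?thesis
    by (simp only: of_real_mult[symmetric] of_real_eq_iff)
qed

text \<open>Take |phi_N|^2 in \<open>bs_trig\<close>: the left side is 1 because the density is its
  reciprocal, and the right side is the mass because phi_N is normalised in L^2(M).\<close>

lemma bs_mass_1: "bs_mass N = 1"
proof -
  have rep: "trig_rep (\<lambda>z. (cmod (phi N z))\<^sup>2) N (phi_poly N * phis_poly N)"
    unfolding trig_rep_def complex_norm_square by (auto simp: phis_circle)
  have "(LINT \<theta>|angle_measure. (cmod (phi N (cis \<theta>)))\<^sup>2 * bs_density N \<theta>) = bs_mass N * (LINT z|M. (cmod (phi N z))\<^sup>2)"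
    by (rule bs_trig[OF rep])
       (use degree_mult_le[of "phi_poly N" "phis_poly N"] degree_phi[of N] degree_phis[of N] in auto)
  moreover have "(cmod (phi N (cis \<theta>)))\<^sup>2 * bs_density N \<theta> = 1" for \<theta>
    using phi_circle_nonzero[of "cis \<theta>" N] by (simp add: bs_density_def)
  ultimately show ?thesis
    using prob_space.prob_space[OF prob_space_angle_measure] by (simp add: integral_phi_square)
qed

lemma trig_rep_mono:
  assumes "trig_rep F d q" "d \<le> e"
  shows "trig_rep F e (monom 1 (e - d) * q)"
  unfolding trig_rep_def
proof (intro allI impI)
  fix z :: complex assume "cmod z = 1"
  with assms(1) have "of_real (F z) * z ^ d = poly q z" by (simp add: trig_rep_def)
  moreover have "z ^ e = z ^ (e - d) * z ^ d" using assms(2) by (simp flip: power_add)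
  ultimately show "of_real (F z) * z ^ e = poly (monom 1 (e - d) * q) z"
    by (simp add: poly_monom mult_ac)
qed

text \<open>Links the Stone--Weierstrass theorem with \<open>bs_trig\<close>: on the circle Re z and
  Im z are combinations of z and 1 / z, and the shifts add under products.\<close>

lemma real_polynomial_trig_rep:
  assumes "real_polynomial_function F"
  shows "\<exists>d q. trig_rep F d q"
  using assms
proof induction
  case (linear f)
  interpret f: bounded_linear f by (rule linear)
  define a b where "a = complex_of_real (f 1)" and "b = complex_of_real (f \<i>)"
  have "trig_rep f 1 [:(a + b * \<i>) / 2, 0, (a - b * \<i>) / 2:]"
    unfolding trig_rep_def
  proof (intro allI impI)
    fix z :: complex assume z: "cmod z = 1"
    have "z = Re z *\<^sub>R 1 + Im z *\<^sub>R \<i>" by (simp add: complex_eq_iff)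
    then have "f z = Re z * f 1 + Im z * f \<i>" by (metis f.add f.scaleR real_scaleR_def)
    then have fz: "of_real (f z) = of_real (Re z) * a + of_real (Im z) * b" by (simp add: a_def b_def)
    have re: "complex_of_real (Re z) = (z + cnj z) / 2" by (simp add: complex_eq_iff)
    have im: "complex_of_real (Im z) = (z - cnj z) * (- \<i>) / 2" by (simp add: complex_eq_iff)
    have "of_real (f z) * z = (a - b * \<i>) / 2 * (z * z) + (a + b * \<i>) / 2 * (z * cnj z)"
      unfolding fz re im by (simp add: field_simps)
    then show "of_real (f z) * z ^ 1 = poly [:(a + b * \<i>) / 2, 0, (a - b * \<i>) / 2:] z"
      by (simp add: mult_cnj_circle[OF z] algebra_simps)
  qed
  then show ?case by blast
next
  case (const c)
  have "trig_rep (\<lambda>_. c) 0 [:of_real c:]" by (simp add: trig_rep_def)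
  then show ?case by blast
next
  case (add f g)
  then obtain d q e r where "trig_rep f d q" "trig_rep g e r" by blast
  then have "trig_rep f (max d e) (monom 1 (max d e - d) * q)" "trig_rep g (max d e) (monom 1 (max d e - e) * r)"
    by (auto intro: trig_rep_mono)
  then have "trig_rep (\<lambda>z. f z + g z) (max d e) (monom 1 (max d e - d) * q + monom 1 (max d e - e) * r)"
    unfolding trig_rep_def by (auto simp: distrib_right)
  then show ?case by blast
next
  case (mult f g)
  then obtain d q e r where "trig_rep f d q" "trig_rep g e r" by blast
  then have "trig_rep (\<lambda>z. f z * g z) (d + e) (q * r)"
    unfolding trig_rep_def by (auto simp: power_add mult_ac)
  then show ?case by blast
qed

lemma trig_approximation:
  assumes "continuous_on (sphere 0 1) f" "e > 0"
  obtains F d q where "trig_rep F d q" "continuous_on (sphere 0 1) F" "\<And>z. cmod z = 1 \<Longrightarrow> \<bar>f z - F z\<bar> < e"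
proof -
  obtain F where F: "real_polynomial_function F" "\<And>z. z \<in> sphere 0 1 \<Longrightarrow> \<bar>f z - F z\<bar> < e"
    using Stone_Weierstrass_real_polynomial_function[of "sphere (0::complex) 1" f e] assms by auto
  moreover have "continuous_on (sphere 0 1) F"
    using F(1) continuous_on_polymonial_function real_polynomial_function_eq by blast
  ultimately show ?thesis using that real_polynomial_trig_rep[OF F(1)] by auto
qed

lemma bs_trig_eventually:
  assumes "trig_rep F d q"
  shows "\<exists>N. (LINT \<theta>|angle_measure. F (cis \<theta>) * bs_density N \<theta>) = (LINT z|M. F z)"
  using bs_trig[OF assms, of "max d (degree q)"] bs_mass_1 by force

end

subsection \<open>Approximation by continuous functions\<close>

text \<open>Inner and outer regularity enclose A between a compact K and an open U of nearly equal
  measure; a Urysohn function for them differs from the indicator only on U - K.\<close>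

lemma continuous_approx_indicator:
  fixes \<nu> :: "'a::euclidean_space measure"
  assumes sets: "sets \<nu> = sets borel" and "finite_measure \<nu>" and A: "A \<in> sets \<nu>" and "e > 0"
  shows "\<exists>g::'a \<Rightarrow> real. continuous_on UNIV g \<and> integrable \<nu> g \<and> (LINT x|\<nu>. \<bar>indicator A x - g x\<bar>) < e"
proof -
  interpret finite_measure \<nu> by fact
  have A': "A \<in> sets borel" using A sets by simp
  have fin: "emeasure \<nu> (space \<nu>) \<noteq> \<infinity>" "emeasure \<nu> A \<noteq> \<infinity>" by simp_all
  have e: "0 < e / 3" using \<open>e > 0\<close> by simp
  have "{K. K \<subseteq> A \<and> compact K} \<noteq> {}" by auto
  then obtain K where K: "K \<subseteq> A" "compact K" "emeasure \<nu> A < emeasure \<nu> K + ennreal (e / 3)"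
    using SUP_approx_ennreal[OF e _ inner_regular[OF sets fin(1) A'] fin(2)] by blast
  obtain U where U: "A \<subseteq> U" "open U" "emeasure \<nu> U < emeasure \<nu> A + ennreal (e / 3)"
    using INF_approx_ennreal[OF e outer_regular[OF sets fin(1) A'] fin(2)] by blast
  have mK: "measure \<nu> A < measure \<nu> K + e / 3"
    using K(3) \<open>e > 0\<close> by (simp add: emeasure_eq_measure ennreal_less_iff flip: ennreal_plus)
  have mU: "measure \<nu> U < measure \<nu> A + e / 3"
    using U(3) \<open>e > 0\<close> by (simp add: emeasure_eq_measure ennreal_less_iff flip: ennreal_plus)
  have KU: "K \<in> sets \<nu>" "U \<in> sets \<nu>"
    using K(2) U(2) sets by (auto simp: compact_imp_closed)
  obtain g :: "'a \<Rightarrow> real" where g: "continuous_on UNIV g" "\<And>x. g x \<in> closed_segment 1 0"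
      "\<And>x. x \<in> K \<Longrightarrow> g x = 1" "\<And>x. x \<in> - U \<Longrightarrow> g x = 0"
    using Urysohn[of K "- U" "1::real" 0] K U by (auto simp: compact_imp_closed open_closed)
  have g01: "0 \<le> g x" "g x \<le> 1" for x
    using g(2)[of x] by (auto simp: closed_segment_eq_real_ivl)
  have gm: "g \<in> borel_measurable \<nu>"
    using borel_measurable_continuous_onI[OF g(1)] by (simp add: measurable_cong_sets[OF sets refl])
  have gi: "integrable \<nu> g"
    by (rule integrable_const_bound[where B = 1]) (use g01 gm in auto)
  have "(LINT x|\<nu>. \<bar>indicator A x - g x\<bar>) \<le> (LINT x|\<nu>. indicator (U - K) x)"
  proof (rule integral_mono)
    show "integrable \<nu> (\<lambda>x. \<bar>indicator A x - g x\<bar>)"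
      using gi A by (auto intro!: integrable_abs Bochner_Integration.integrable_diff simp: emeasure_eq_measure)
    show "integrable \<nu> (indicator (U - K) :: 'a \<Rightarrow> real)"
      using KU by (auto simp: emeasure_eq_measure)
    fix x
    consider "x \<in> K" | "x \<notin> U" | "x \<in> U - K" by blast
    then show "\<bar>indicator A x - g x\<bar> \<le> (indicator (U - K) x :: real)"
    proof cases
      case 1 then show ?thesis using K(1) U(1) g(3)[of x] by (auto simp: indicator_def)
    next
      case 2 then show ?thesis using K(1) U(1) g(4)[of x] by (auto simp: indicator_def)
    next
      case 3 then show ?thesis using g01[of x] by (auto simp: indicator_def)
    qed
  qed
  also have "\<dots> = measure \<nu> U - measure \<nu> K"
    using K(1) U(1) KU by (subst Bochner_Integration.integral_indicator) (auto intro!: finite_measure_Diff simp: sets_eq_imp_space_eq[OF sets])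
  also have "\<dots> < e" using mK mU \<open>e > 0\<close> by simp
  finally show ?thesis using g(1) gi by blast
qed

lemma continuous_dense_L1:
  fixes \<nu> :: "'a::euclidean_space measure" and f :: "'a \<Rightarrow> real"
  assumes sets: "sets \<nu> = sets borel" and fin: "finite_measure \<nu>" and "integrable \<nu> f" and "e > 0"
  shows "\<exists>g::'a \<Rightarrow> real. continuous_on UNIV g \<and> integrable \<nu> g \<and> (LINT x|\<nu>. \<bar>f x - g x\<bar>) < e"
  using assms(3,4)
proof (induction arbitrary: e rule: integrable_induct)
  case (base A c)
  \<comment> \<open>The summand 1 covers c = 0.\<close>
  have "e / (\<bar>c\<bar> + 1) > 0" using base by simp
  then obtain g :: "'a \<Rightarrow> real" where g: "continuous_on UNIV g" "integrable \<nu> g"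
      "(LINT x|\<nu>. \<bar>indicator A x - g x\<bar>) < e / (\<bar>c\<bar> + 1)"
    using continuous_approx_indicator[OF sets fin base(1)] by blast
  have "(LINT x|\<nu>. \<bar>indicator A x *\<^sub>R c - c * g x\<bar>) = (LINT x|\<nu>. \<bar>c\<bar> * \<bar>indicator A x - g x\<bar>)"
    by (intro Bochner_Integration.integral_cong refl) (simp add: abs_mult[symmetric] algebra_simps)
  also have "\<dots> = \<bar>c\<bar> * (LINT x|\<nu>. \<bar>indicator A x - g x\<bar>)" by simp
  also have "\<dots> \<le> \<bar>c\<bar> * (e / (\<bar>c\<bar> + 1))"
    by (rule mult_left_mono) (use g(3) in auto)
  also have "\<dots> < e" using base(3) by (simp add: field_simps)
  finally show ?case
    using g by (intro exI[of _ "\<lambda>x. c * g x"]) (auto intro: continuous_intros)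
next
  case (add f1 f2)
  from add.prems have "e / 2 > 0" by simp
  with add.IH obtain g1 g2 :: "'a \<Rightarrow> real" where g: "continuous_on UNIV g1" "integrable \<nu> g1" "(LINT x|\<nu>. \<bar>f1 x - g1 x\<bar>) < e / 2"
      "continuous_on UNIV g2" "integrable \<nu> g2" "(LINT x|\<nu>. \<bar>f2 x - g2 x\<bar>) < e / 2"
    by meson
  have "(LINT x|\<nu>. \<bar>f1 x + f2 x - (g1 x + g2 x)\<bar>) \<le> (LINT x|\<nu>. \<bar>f1 x - g1 x\<bar> + \<bar>f2 x - g2 x\<bar>)"
    using g add.hyps by (intro integral_mono) auto
  also have "\<dots> = (LINT x|\<nu>. \<bar>f1 x - g1 x\<bar>) + (LINT x|\<nu>. \<bar>f2 x - g2 x\<bar>)"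
    using g add.hyps by simp
  also have "\<dots> < e" using g by simp
  finally show ?case
    using g by (intro exI[of _ "\<lambda>x. g1 x + g2 x"]) (auto intro: continuous_intros)
next
  case (lim f s)
  have "(\<lambda>i. LINT x|\<nu>. \<bar>f x - s i x\<bar>) \<longlonglongrightarrow> (LINT x|\<nu>. 0)"
  \<comment> \<open>The approximants satisfy |s_i| \<le> 2 |f|, hence the dominating function 3
    |f|.\<close>
  proof (rule integral_dominated_convergence[where w = "\<lambda>x. 3 * \<bar>f x\<bar>"])
    show "AE x in \<nu>. (\<lambda>i. \<bar>f x - s i x\<bar>) \<longlonglongrightarrow> 0"
      using lim.hyps(2) by (intro AE_I2 tendsto_rabs_zero) (auto intro!: tendsto_eq_intros)
    show "AE x in \<nu>. norm \<bar>f x - s i x\<bar> \<le> 3 * \<bar>f x\<bar>" for i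
    proof (rule AE_I2)
      fix x assume "x \<in> space \<nu>"
      then show "norm \<bar>f x - s i x\<bar> \<le> 3 * \<bar>f x\<bar>"
        using lim.hyps(3)[of x i] by (auto simp: abs_if split: if_splits)
    qed
  qed (use lim.hyps in auto)
  then have "eventually (\<lambda>i. (LINT x|\<nu>. \<bar>f x - s i x\<bar>) < e / 2) sequentially"
    using lim.prems by (intro order_tendstoD) auto
  then obtain i where i: "(LINT x|\<nu>. \<bar>f x - s i x\<bar>) < e / 2"
    by (auto simp: eventually_sequentially)
  obtain g :: "'a \<Rightarrow> real" where g: "continuous_on UNIV g" "integrable \<nu> g" "(LINT x|\<nu>. \<bar>s i x - g x\<bar>) < e / 2"
    using lim.IH[of "e / 2" i] lim.prems by auto
  have "(LINT x|\<nu>. \<bar>f x - g x\<bar>) \<le> (LINT x|\<nu>. \<bar>f x - s i x\<bar> + \<bar>s i x - g x\<bar>)"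
    using g lim.hyps by (intro integral_mono) auto
  also have "\<dots> = (LINT x|\<nu>. \<bar>f x - s i x\<bar>) + (LINT x|\<nu>. \<bar>s i x - g x\<bar>)"
    using g lim.hyps by simp
  also have "\<dots> < e" using g i by simp
  finally show ?case using g by blast
qed

lemma finite_measure_sup_measure':
  assumes "sets B = sets A" "finite_measure A" "finite_measure B"
  shows "finite_measure (sup_measure' A B)"
proof
  have sp: "space B = space A" by (rule sets_eq_imp_space_eq[OF assms(1)])
  have "emeasure (sup_measure' A B) (space A) \<le> emeasure A (space A) + emeasure B (space B)"
    by (subst emeasure_sup_measure'[OF assms(1)]) (auto intro!: SUP_least add_mono emeasure_space)
  also have "\<dots> < \<infinity>"
    using assms(2,3) by (simp add: finite_measure.emeasure_finite less_top[symmetric])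
  finally show "emeasure (sup_measure' A B) (space (sup_measure' A B)) \<noteq> \<infinity>"
    using assms(1) by simp
qed

lemma measurable_cis [measurable]: "cis \<in> borel_measurable borel"
  by (intro borel_measurable_continuous_onI continuous_intros)

context verblunsky_measure
begin

lemma measurable_id_M: "(\<lambda>x. x) \<in> M \<rightarrow>\<^sub>M borel"
  by (rule measurable_M) (rule continuous_on_id)

text \<open>One and the same F has to be close to f for M and for arc length, which may be mutually
  singular. The approximation is therefore made for a finite measure that lies above both.\<close>

lemma trig_L1_approximation:
  fixes f :: "complex \<Rightarrow> real"
  assumes f: "f \<in> borel_measurable borel" "\<And>z. 1 \<le> f z" "\<And>z. f z \<le> K" and "e > 0"
  obtains F d q where "trig_rep F d q" "continuous_on (sphere 0 1) F" "\<And>z. cmod z = 1 \<Longrightarrow> 1/2 \<le> F z"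
    "(LINT z|M. \<bar>f z - F z\<bar>) \<le> e" "(LINT \<theta>|angle_measure. \<bar>f (cis \<theta>) - F (cis \<theta>)\<bar>) \<le> e"
proof -
  interpret A: prob_space angle_measure by (rule prob_space_angle_measure)
  define M' \<Lambda> where "M' = distr M borel (\<lambda>x. x)" and "\<Lambda> = distr angle_measure borel cis"
  define \<nu> where "\<nu> = sup_measure' M' \<Lambda>"
  have cisA: "cis \<in> angle_measure \<rightarrow>\<^sub>M borel" by simp
  have fins: "finite_measure M'" "finite_measure \<Lambda>"
    unfolding M'_def \<Lambda>_def
    by (auto intro!: finite_measure_distr A.finite_measure_distr measurable_id_M cisA)
  have ss: "sets \<Lambda> = sets M'" by (simp add: M'_def \<Lambda>_def)
  have sets: "sets \<nu> = sets borel" by (simp add: \<nu>_def sets_sup_measure'[OF ss]) (simp add: M'_def)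
  have fin: "finite_measure \<nu>"
    unfolding \<nu>_def by (rule finite_measure_sup_measure'[OF ss fins])
  have M'_le: "M' \<le> \<nu>"
    unfolding \<nu>_def by (subst le_measure) (simp_all add: le_emeasure_sup_measure'1[OF ss] sets_sup_measure'[OF ss])
  have \<Lambda>_le: "\<Lambda> \<le> \<nu>"
    unfolding \<nu>_def by (subst le_measure) (simp_all add: le_emeasure_sup_measure'2[OF ss] sets_sup_measure'[OF ss] ss)
  have fb: "\<bar>f z\<bar> \<le> K" for z using f(2,3)[of z] by auto
  have "integrable \<nu> f"
    by (rule finite_measure.integrable_const_bound[OF fin, where B = K])
       (use fb f(1) in \<open>auto simp: measurable_cong_sets[OF sets refl]\<close>)
  then obtain g :: "complex \<Rightarrow> real" where g: "continuous_on UNIV g" "integrable \<nu> g" "(LINT x|\<nu>. \<bar>f x - g x\<bar>) < e / 2"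
    using continuous_dense_L1[OF sets fin, of f "e / 2"] \<open>e > 0\<close> by auto
  \<comment> \<open>Clamping to [1, K], the range of f, takes g no farther from f and prepares the
    lower bound for F.\<close>
  define g' where "g' z = max 1 (min K (g z))" for z
  have g': "continuous_on (sphere 0 1) g'" "\<And>z. 1 \<le> g' z"
    unfolding g'_def by (auto intro!: continuous_intros continuous_on_subset[OF g(1)])
  have fg': "\<bar>f z - g' z\<bar> \<le> \<bar>f z - g z\<bar>" for z
    unfolding g'_def using f(2)[of z] f(3)[of z] by (auto simp: max_def min_def)
  \<comment> \<open>The bound 1/2 turns 1 \<le> g' into 1/2 \<le> F; e / 2 is the share of the
    uniform error in the total error.\<close>
  define e' where "e' = min (1/2) (e / 2)"
  have e': "e' > 0" using \<open>e > 0\<close> by (simp add: e'_def)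
  obtain F d q where F: "trig_rep F d q" "continuous_on (sphere 0 1) F" "\<And>z. cmod z = 1 \<Longrightarrow> \<bar>g' z - F z\<bar> < e'"
    using trig_approximation[OF g'(1) e'] by blast
  have F12: "1/2 \<le> F z" if "cmod z = 1" for z
    using F(3)[OF that] g'(2)[of z] by (auto simp: e'_def abs_if split: if_splits)
  have bound: "\<bar>f z - F z\<bar> \<le> \<bar>f z - g z\<bar> + e / 2" if "cmod z = 1" for z
  proof -
    have "\<bar>g' z - F z\<bar> < e / 2" using F(3)[OF that] by (simp add: e'_def)
    then show ?thesis using fg'[of z] by linarith
  qed
  have fg: "(\<lambda>z. \<bar>f z - g z\<bar>) \<in> borel_measurable borel"
    using f(1) borel_measurable_continuous_onI[OF g(1)] by measurable
  have int\<nu>: "integrable \<nu> (\<lambda>z. \<bar>f z - g z\<bar>)"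
    using \<open>integrable \<nu> f\<close> g(2) by auto
  have part: "integrable N (\<lambda>z. \<bar>f z - g z\<bar>) \<and> (LINT z|N. \<bar>f z - g z\<bar>) \<le> e / 2"
    if N: "sets N = sets borel" "N \<le> \<nu>" for N
  proof -
    have "(\<integral>\<^sup>+z. ennreal \<bar>f z - g z\<bar> \<partial>N) \<le> (\<integral>\<^sup>+z. ennreal \<bar>f z - g z\<bar> \<partial>\<nu>)"
      by (rule nn_integral_mono_measure) (use N sets in auto)
    also have "\<dots> = ennreal (LINT z|\<nu>. \<bar>f z - g z\<bar>)"
      by (rule nn_integral_eq_integral[OF int\<nu>]) simp
    also have "\<dots> \<le> ennreal (e / 2)"
      using g(3) by (intro ennreal_leI) simp
    finally have le: "(\<integral>\<^sup>+z. ennreal \<bar>f z - g z\<bar> \<partial>N) \<le> ennreal (e / 2)" .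
    have int: "integrable N (\<lambda>z. \<bar>f z - g z\<bar>)"
      by (rule integrableI_bounded)
         (use le fg in \<open>auto simp: measurable_cong_sets[OF N(1) refl] intro: le_less_trans\<close>)
    then show ?thesis
      using le \<open>e > 0\<close> nn_integral_eq_integral[OF int] by (simp add: ennreal_le_iff)
  qed
  have 1: "integrable M (\<lambda>z. \<bar>f z - g z\<bar>) \<and> (LINT z|M. \<bar>f z - g z\<bar>) \<le> e / 2"
    using part[of M'] M'_le fg unfolding M'_def
    by (simp add: integrable_distr_eq[OF measurable_id_M] integral_distr[OF measurable_id_M])
  have 2: "integrable angle_measure (\<lambda>\<theta>. \<bar>f (cis \<theta>) - g (cis \<theta>)\<bar>) \<and> (LINT \<theta>|angle_measure. \<bar>f (cis \<theta>) - g (cis \<theta>)\<bar>) \<le> e / 2"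
    using part[of \<Lambda>] \<Lambda>_le fg unfolding \<Lambda>_def
    by (simp add: integrable_distr_eq[OF cisA] integral_distr[OF cisA])
  have "(LINT z|M. \<bar>f z - F z\<bar>) \<le> (LINT z|M. \<bar>f z - g z\<bar> + e / 2)"
  proof (rule integral_mono)
    have "f \<in> borel_measurable M"
      using measurable_compose[OF measurable_id_M f(1)] .
    then have "integrable M f"
      by (intro integrable_const_bound[where B = K]) (use fb in auto)
    then show "integrable M (\<lambda>z. \<bar>f z - F z\<bar>)" using integrable_M[OF F(2)] by auto
  qed (use 1 bound in \<open>auto simp: space_M\<close>)
  also have "\<dots> \<le> e" using 1 by (simp add: prob_space)
  finally have M: "(LINT z|M. \<bar>f z - F z\<bar>) \<le> e" .
  have "(LINT \<theta>|angle_measure. \<bar>f (cis \<theta>) - F (cis \<theta>)\<bar>) \<le> (LINT \<theta>|angle_measure. \<bar>f (cis \<theta>) - g (cis \<theta>)\<bar> + e / 2)"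
  proof (rule integral_mono)
    have "(\<lambda>\<theta>. f (cis \<theta>)) \<in> borel_measurable angle_measure"
      using measurable_compose[OF cisA f(1)] .
    then have "integrable angle_measure (\<lambda>\<theta>. f (cis \<theta>))"
      by (intro A.integrable_const_bound[where B = K]) (use fb in auto)
    then show "integrable angle_measure (\<lambda>\<theta>. \<bar>f (cis \<theta>) - F (cis \<theta>)\<bar>)"
      using integrable_angle_measure[OF continuous_on_cis_compose[OF F(2)]] by auto
  qed (use 2 bound in auto)
  also have "\<dots> \<le> e" using 2 A.prob_space by simp
  finally show ?thesis using that F(1,2) F12 M by blast
qed

end

subsection \<open>Test functions and the weight\<close>

lemma one_minus_cos_power_bounds: "0 \<le> (1 - cos \<theta>) ^ m" "(1 - cos \<theta>) ^ m \<le> 2 ^ m" for \<theta> :: real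
  by (auto intro!: power_mono)

context verblunsky_measure
begin

text \<open>The logarithm of f is bounded through a nearby trigonometric polynomial F, whose
  integral against the Bernstein--Szego density equals its integral against M for a suitable
  N.\<close>

lemma szego_integral_test_function:
  fixes f :: "complex \<Rightarrow> real"
  assumes f: "f \<in> borel_measurable borel" "\<And>z. 1 \<le> f z" "\<And>z. f z \<le> K"
    and B: "\<And>N. - B \<le> szego_integral m N"
  shows "(LINT \<theta>|angle_measure. (1 - cos \<theta>) ^ m * ln (f (cis \<theta>))) \<le> 2 ^ m * (LINT z|M. f z) + B"
proof (rule field_le_epsilon)
  fix e :: real assume "e > 0"
  interpret A: prob_space angle_measure by (rule prob_space_angle_measure)
  \<comment> \<open>One third pays for replacing F by f in the integral against M, two thirds for
    the logarithmic error with its factor 2.\<close>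
  define e' where "e' = e / (3 * 2 ^ m)"
  have "e' > 0" using \<open>e > 0\<close> by (simp add: e'_def)
  obtain F d q where F: "trig_rep F d q" "continuous_on (sphere 0 1) F" "\<And>z. cmod z = 1 \<Longrightarrow> 1/2 \<le> F z"
    "(LINT z|M. \<bar>f z - F z\<bar>) \<le> e'" "(LINT \<theta>|angle_measure. \<bar>f (cis \<theta>) - F (cis \<theta>)\<bar>) \<le> e'"
    using trig_L1_approximation[OF f \<open>e' > 0\<close>] by blast
  obtain N where N: "(LINT \<theta>|angle_measure. F (cis \<theta>) * bs_density N \<theta>) = (LINT z|M. F z)"
    using bs_trig_eventually[OF F(1)] by blast
  define h where "h \<theta> = (1 - cos \<theta>) ^ m" for \<theta> :: real
  have h: "0 \<le> h \<theta>" "h \<theta> \<le> 2 ^ m" for \<theta>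
    unfolding h_def by (rule one_minus_cos_power_bounds)+
  have le: "h \<theta> * ln (f (cis \<theta>)) \<le> 2 ^ m * (F (cis \<theta>) * bs_density N \<theta>) - h \<theta> * ln (bs_density N \<theta>)
      + 2 * 2 ^ m * \<bar>f (cis \<theta>) - F (cis \<theta>)\<bar>" for \<theta>
  proof -
    define a b c where "a = f (cis \<theta>)" and "b = F (cis \<theta>)" and "c = bs_density N \<theta>"
    have a: "1 \<le> a" using f(2) by (simp add: a_def)
    have b: "1/2 \<le> b" using F(3)[of "cis \<theta>"] by (simp add: b_def)
    have c: "0 < c" using bs_density_pos by (simp add: c_def)
    \<comment> \<open>log (a / b) \<le> (a - b) / b, and b \<ge> 1/2 gives the factor 2.\<close>
    have 1: "ln a \<le> ln b + 2 * \<bar>a - b\<bar>"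
    proof -
      have "ln a - ln b = ln (a / b)" using a b by (simp add: ln_div)
      also have "\<dots> \<le> a / b - 1" using a b by (intro ln_le_minus_one) simp
      also have "\<dots> = (a - b) / b" using b by (simp add: field_simps)
      also have "\<dots> \<le> \<bar>a - b\<bar> / b" using b by (intro divide_right_mono) auto
      also have "\<dots> \<le> \<bar>a - b\<bar> / (1/2)" using b by (intro divide_left_mono) auto
      finally show ?thesis by simp
    qed
    have 2: "ln b \<le> b * c - ln c"
    proof -
      have "ln b + ln c = ln (b * c)" using b c by (simp add: ln_mult)
      also have "\<dots> \<le> b * c - 1" using b c by (intro ln_le_minus_one) simp
      finally show ?thesis by simp
    qed
    have "h \<theta> * ln a \<le> h \<theta> * (b * c - ln c + 2 * \<bar>a - b\<bar>)"
      by (rule mult_left_mono) (use 1 2 h in auto)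
    also have "\<dots> = h \<theta> * (b * c) - h \<theta> * ln c + h \<theta> * (2 * \<bar>a - b\<bar>)" by (simp add: algebra_simps)
    also have "\<dots> \<le> 2 ^ m * (b * c) - h \<theta> * ln c + 2 ^ m * (2 * \<bar>a - b\<bar>)"
    proof -
      have "h \<theta> * (b * c) \<le> 2 ^ m * (b * c)" by (rule mult_right_mono) (use b c h in auto)
      moreover have "h \<theta> * (2 * \<bar>a - b\<bar>) \<le> 2 ^ m * (2 * \<bar>a - b\<bar>)" by (rule mult_right_mono) (use h in auto)
      ultimately show ?thesis by linarith
    qed
    finally show ?thesis by (simp add: a_def b_def c_def mult_ac)
  qed
  have fc: "(\<lambda>\<theta>. f (cis \<theta>)) \<in> borel_measurable angle_measure"
    by (rule measurable_compose[OF _ f(1)]) simp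
  have fb: "\<bar>f z\<bar> \<le> K" for z using f(2,3)[of z] by auto
  have fi: "integrable angle_measure (\<lambda>\<theta>. f (cis \<theta>))"
    by (rule A.integrable_const_bound[where B = K]) (use fb fc in auto)
  have Fi: "integrable angle_measure (\<lambda>\<theta>. F (cis \<theta>))"
    by (intro integrable_angle_measure continuous_on_cis_compose F)
  have Fbi: "integrable angle_measure (\<lambda>\<theta>. F (cis \<theta>) * bs_density N \<theta>)"
    by (intro integrable_angle_measure continuous_intros continuous_on_cis_compose F)
  have bi: "integrable angle_measure (\<lambda>\<theta>. h \<theta> * ln (bs_density N \<theta>))"
    unfolding h_def by (rule integrable_szego_integral)
  have li: "integrable angle_measure (\<lambda>\<theta>. h \<theta> * ln (f (cis \<theta>)))"
  proof (rule A.integrable_const_bound[where B = "2 ^ m * ln K"])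
    show "AE \<theta> in angle_measure. norm (h \<theta> * ln (f (cis \<theta>))) \<le> 2 ^ m * ln K"
    proof (rule AE_I2)
      fix \<theta>
      have "0 \<le> ln (f (cis \<theta>))" "ln (f (cis \<theta>)) \<le> ln K"
        using f(2)[of "cis \<theta>"] f(3)[of "cis \<theta>"] by auto
      then show "norm (h \<theta> * ln (f (cis \<theta>))) \<le> 2 ^ m * ln K"
        using h[of \<theta>] by (auto simp: abs_mult intro!: mult_mono)
    qed
    have "h \<in> borel_measurable angle_measure"
      unfolding h_def by measurable
    then show "(\<lambda>\<theta>. h \<theta> * ln (f (cis \<theta>))) \<in> borel_measurable angle_measure"
      using fc by measurable
  qed
  have "(LINT \<theta>|angle_measure. h \<theta> * ln (f (cis \<theta>))) \<le> (LINT \<theta>|angle_measure. 2 ^ m * (F (cis \<theta>) * bs_density N \<theta>) - h \<theta> * ln (bs_density N \<theta>)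
      + 2 * 2 ^ m * \<bar>f (cis \<theta>) - F (cis \<theta>)\<bar>)"
    using fi Fi Fbi bi li le by (intro integral_mono) auto
  also have "\<dots> = 2 ^ m * (LINT z|M. F z) - szego_integral m N + 2 * 2 ^ m * (LINT \<theta>|angle_measure. \<bar>f (cis \<theta>) - F (cis \<theta>)\<bar>)"
    using fi Fi Fbi bi by (simp add: N szego_integral_def h_def)
  also have "\<dots> \<le> 2 ^ m * ((LINT z|M. f z) + e') + B + 2 * 2 ^ m * e'"
  proof -
    have "f \<in> borel_measurable M" using measurable_compose[OF measurable_id_M f(1)] .
    then have fM: "integrable M f" by (intro integrable_const_bound[where B = K]) (use fb in auto)
    have FM: "integrable M F" by (rule integrable_M[OF F(2)])
    have "(LINT z|M. F z) \<le> (LINT z|M. f z + \<bar>f z - F z\<bar>)"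
      using fM FM by (intro integral_mono) auto
    also have "\<dots> = (LINT z|M. f z) + (LINT z|M. \<bar>f z - F z\<bar>)" using fM FM by simp
    finally have "(LINT z|M. F z) \<le> (LINT z|M. f z) + e'" using F(4) by simp
    then have "2 ^ m * (LINT z|M. F z) \<le> 2 ^ m * ((LINT z|M. f z) + e')" by simp
    moreover have "2 * 2 ^ m * (LINT \<theta>|angle_measure. \<bar>f (cis \<theta>) - F (cis \<theta>)\<bar>) \<le> 2 * 2 ^ m * e'"
      using F(5) by simp
    ultimately show ?thesis using B[of N] by linarith
  qed
  also have "\<dots> = 2 ^ m * (LINT z|M. f z) + B + e"
    by (simp add: e'_def field_simps)
  finally show "(LINT \<theta>|angle_measure. (1 - cos \<theta>) ^ m * ln (f (cis \<theta>))) \<le> 2 ^ m * (LINT z|M. f z) + B + e"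
    by (simp add: h_def)
qed

end

section \<open>The density as a function on the circle\<close>

lemma measurable_Arg2pi [measurable]: "Arg2pi \<in> borel_measurable borel"
  unfolding borel_measurable_iff_le using closed_Arg2pi2pi_le by auto

text \<open>Lets the density, a function of the angle on the period of \<open>angle_measure\<close>,
  act as a function on the circle.\<close>

lemma Arg2pi_cis: "\<theta> \<in> {0..<2 * pi} \<Longrightarrow> Arg2pi (cis \<theta>) = \<theta>"
  by (rule Arg2pi_unique[of 1]) (auto simp: cis_conv_exp)

lemma measurable_cis_circle_borel: "cis \<in> angle_measure \<rightarrow>\<^sub>M circle_borel"
  unfolding circle_borel_def by (rule measurable_restrict_space2) auto

lemma space_circle_borel: "space circle_borel = sphere 0 1"
  by (simp add: circle_borel_def space_restrict_space)

locale verblunsky_decomposition = verblunsky_measure +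
  fixes w :: "real \<Rightarrow> real" and S :: "complex measure"
  assumes decomposition: "circle_lebesgue_decomposition M w S"
begin

lemma measurable_w [measurable]: "w \<in> borel_measurable borel"
  and w_nonneg: "\<theta> \<in> {0..<2 * pi} \<Longrightarrow> 0 \<le> w \<theta>"
  and singular: "singular_wrt S circle_lebesgue"
  using decomposition by (auto simp: circle_lebesgue_decomposition_def)

definition ac_part :: "complex measure" where
  "ac_part = distr (density angle_measure (\<lambda>\<theta>. ennreal (w \<theta>))) circle_borel cis"

lemma sets_ac_part: "sets ac_part = sets circle_borel"
  by (simp add: ac_part_def)

lemma M_eq: "A \<in> sets circle_borel \<Longrightarrow> emeasure M A = emeasure ac_part A + emeasure S A"
  using decomposition by (simp add: circle_lebesgue_decomposition_def ac_part_def)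

lemma measurable_cis_density: "cis \<in> density angle_measure (\<lambda>\<theta>. ennreal (w \<theta>)) \<rightarrow>\<^sub>M circle_borel"
  using measurable_cis_circle_borel by simp

lemma ac_part_le: "ac_part \<le> M"
  by (subst le_measure) (auto simp: sets_M M_eq sets_ac_part)

lemma nn_integral_ac_part:
  assumes "g \<in> borel_measurable borel"
  shows "(\<integral>\<^sup>+z. g z \<partial>ac_part) = (\<integral>\<^sup>+\<theta>. ennreal (w \<theta>) * g (cis \<theta>) \<partial>angle_measure)"
proof -
  have g: "g \<in> borel_measurable circle_borel"
    unfolding circle_borel_def by (rule measurable_restrict_space1[OF assms])
  have gc: "(\<lambda>\<theta>. g (cis \<theta>)) \<in> borel_measurable angle_measure"
    by (rule measurable_compose[OF _ assms]) simp
  show ?thesis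
    unfolding ac_part_def
    by (subst nn_integral_distr[OF measurable_cis_density])
       (use g gc in \<open>auto intro!: nn_integral_density\<close>)
qed

lemma nn_integral_ac_part_le:
  assumes "g \<in> borel_measurable borel"
  shows "(\<integral>\<^sup>+\<theta>. ennreal (w \<theta>) * g (cis \<theta>) \<partial>angle_measure) \<le> (\<integral>\<^sup>+z. g z \<partial>M)"
  unfolding nn_integral_ac_part[OF assms, symmetric]
  by (rule nn_integral_mono_measure[OF _ ac_part_le]) (simp add: sets_M ac_part_def)

lemma nn_integral_w_le: "(\<integral>\<^sup>+\<theta>. ennreal (w \<theta>) \<partial>angle_measure) \<le> 1"
  using nn_integral_ac_part_le[of "\<lambda>_. 1"] emeasure_space_1 by simp

definition neg_part :: "nat \<Rightarrow> real \<Rightarrow> ennreal" where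
  "neg_part m \<theta> = e2ennreal (- (ereal ((1 - cos \<theta>) ^ m) * ext_log (w \<theta>)))"

lemma szego_integral_bounded_below:
  assumes "(\<integral>\<^sup>+\<theta>. neg_part m \<theta> \<partial>angle_measure) < \<infinity>"
  shows "\<exists>B. \<forall>N. - B \<le> szego_integral m N"
proof (intro exI allI)
  fix N
  define h where "h \<theta> = (1 - cos \<theta>) ^ m" for \<theta> :: real
  have h: "0 \<le> h \<theta>" "h \<theta> \<le> 2 ^ m" for \<theta>
    unfolding h_def by (rule one_minus_cos_power_bounds)+
  define k where "k \<theta> = - (h \<theta> * ln (bs_density N \<theta>))" for \<theta>
  define p where "p z = (cmod (phi N z))\<^sup>2" for z
  have pm: "(\<lambda>z. ennreal (2 ^ m * p z)) \<in> borel_measurable borel"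
    unfolding p_def by (intro measurable_compose[OF _ measurable_ennreal] borel_measurable_continuous_onI continuous_intros)
  have pint: "integrable M (\<lambda>z. 2 ^ m * p z)"
    unfolding p_def by (intro integrable_M continuous_intros)
  have ki: "integrable angle_measure k"
    unfolding k_def h_def using integrable_szego_integral[of m N] by simp
  \<comment> \<open>The pointwise form of log (w p) \<le> w p - 1. Where the weight vanishes the
    left side is 0, and where w \<le> 0 with positive weight the negative part is infinite.\<close>
  have le: "ennreal (k \<theta>) \<le> neg_part m \<theta> + ennreal (w \<theta>) * ennreal (2 ^ m * p (cis \<theta>))" for \<theta>
  proof (cases "h \<theta> = 0")
    case True then show ?thesis by (simp add: k_def)
  next
    case False
    then have hp: "h \<theta> > 0" using h(1)[of \<theta>] by simp
    show ?thesis
    proof (cases "w \<theta> \<le> 0")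
      case True
      then have "neg_part m \<theta> = e2ennreal (- (ereal (h \<theta>) * - \<infinity>))"
        by (simp only: neg_part_def ext_log_def h_def if_True)
      also have "\<dots> = \<infinity>" using hp by simp
      finally show ?thesis by simp
    next
      case False
      then have wp: "w \<theta> > 0" by simp
      have bs: "bs_density N \<theta> = 1 / p (cis \<theta>)" "p (cis \<theta>) > 0"
        using phi_circle_nonzero[of "cis \<theta>" N] by (auto simp: bs_density_def p_def)
      have "ln (w \<theta>) + ln (p (cis \<theta>)) \<le> w \<theta> * p (cis \<theta>) - 1"
        using ln_le_minus_one[of "w \<theta> * p (cis \<theta>)"] wp bs by (simp add: ln_mult)
      then have "ln (p (cis \<theta>)) \<le> - ln (w \<theta>) + w \<theta> * p (cis \<theta>)" by simp
      then have "h \<theta> * ln (p (cis \<theta>)) \<le> h \<theta> * (- ln (w \<theta>) + w \<theta> * p (cis \<theta>))"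
        using h(1) by (rule mult_left_mono)
      also have "\<dots> = - (h \<theta> * ln (w \<theta>)) + h \<theta> * (w \<theta> * p (cis \<theta>))" by (simp add: algebra_simps)
      also have "\<dots> \<le> - (h \<theta> * ln (w \<theta>)) + 2 ^ m * (w \<theta> * p (cis \<theta>))"
        using h wp bs by (intro add_left_mono mult_right_mono) auto
      finally have "k \<theta> \<le> - (h \<theta> * ln (w \<theta>)) + w \<theta> * (2 ^ m * p (cis \<theta>))"
        using bs by (simp add: k_def ln_div mult_ac)
      \<comment> \<open>The maximum with 0 allows the sum to be split, as \<open>ennreal\<close> is
        additive on nonnegative arguments.\<close>
      then have "ennreal (k \<theta>) \<le> ennreal (max 0 (- (h \<theta> * ln (w \<theta>))) + w \<theta> * (2 ^ m * p (cis \<theta>)))"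
        by (intro ennreal_leI) auto
      also have "\<dots> = ennreal (- (h \<theta> * ln (w \<theta>))) + ennreal (w \<theta>) * ennreal (2 ^ m * p (cis \<theta>))"
        using wp bs by (simp add: ennreal_plus ennreal_mult'' ennreal_max_0 del: ennreal_plus[symmetric])
      also have "ennreal (- (h \<theta> * ln (w \<theta>))) = neg_part m \<theta>"
        using wp by (simp add: neg_part_def ext_log_def h_def)
      finally show ?thesis .
    qed
  qed
  have "(\<integral>\<^sup>+\<theta>. ennreal (k \<theta>) \<partial>angle_measure) \<le> (\<integral>\<^sup>+\<theta>. neg_part m \<theta> + ennreal (w \<theta>) * ennreal (2 ^ m * p (cis \<theta>)) \<partial>angle_measure)"
    by (rule nn_integral_mono) (rule le)
  also have "\<dots> = (\<integral>\<^sup>+\<theta>. neg_part m \<theta> \<partial>angle_measure) + (\<integral>\<^sup>+\<theta>. ennreal (w \<theta>) * ennreal (2 ^ m * p (cis \<theta>)) \<partial>angle_measure)"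
  proof (rule nn_integral_add)
    show "neg_part m \<in> borel_measurable angle_measure"
      unfolding neg_part_def ext_log_def by measurable
    show "(\<lambda>\<theta>. ennreal (w \<theta>) * ennreal (2 ^ m * p (cis \<theta>))) \<in> borel_measurable angle_measure"
      using measurable_compose[OF _ pm, of cis angle_measure] by measurable
  qed
  also have "(\<integral>\<^sup>+\<theta>. ennreal (w \<theta>) * ennreal (2 ^ m * p (cis \<theta>)) \<partial>angle_measure) \<le> (\<integral>\<^sup>+z. ennreal (2 ^ m * p z) \<partial>M)"
    by (rule nn_integral_ac_part_le[OF pm])
  \<comment> \<open>The normalisation of phi_N makes the bound independent of N.\<close>
  also have "(\<integral>\<^sup>+z. ennreal (2 ^ m * p z) \<partial>M) = ennreal (2 ^ m)"
    using integral_phi_square[of N] by (subst nn_integral_eq_integral[OF pint]) (auto simp: p_def)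
  finally have fin: "(\<integral>\<^sup>+\<theta>. ennreal (k \<theta>) \<partial>angle_measure) \<le> (\<integral>\<^sup>+\<theta>. neg_part m \<theta> \<partial>angle_measure) + ennreal (2 ^ m)"
    by (simp add: add_left_mono)
  have "- szego_integral m N = (LINT \<theta>|angle_measure. k \<theta>)"
    by (simp add: szego_integral_def k_def h_def)
  also have "\<dots> \<le> (LINT \<theta>|angle_measure. max 0 (k \<theta>))"
    using ki by (intro integral_mono) auto
  also have "\<dots> = enn2real (\<integral>\<^sup>+\<theta>. ennreal (k \<theta>) \<partial>angle_measure)"
    using ki by (subst integral_eq_nn_integral) (auto simp: ennreal_max_0)
  also have "\<dots> \<le> enn2real ((\<integral>\<^sup>+\<theta>. neg_part m \<theta> \<partial>angle_measure) + ennreal (2 ^ m))"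
    using assms by (intro enn2real_mono fin) (auto simp: less_top[symmetric])
  finally show "- enn2real ((\<integral>\<^sup>+\<theta>. neg_part m \<theta> \<partial>angle_measure) + ennreal (2 ^ m)) \<le> szego_integral m N"
    by simp
qed

end

section \<open>Truncations of 1 / w\<close>

text \<open>1 / t cut off to [1, K]: the upper bound makes it admissible as a test function, and
  \<open>min 1 t\<close> discards t > 1, where the negative part of the logarithm is 0.\<close>

definition truncated_inverse :: "real \<Rightarrow> real \<Rightarrow> real" where
  "truncated_inverse K t = 1 / max (1 / K) (min 1 t)"

lemma truncated_inverse_bounds:
  assumes "K \<ge> 1"
  shows "1 \<le> truncated_inverse K t" "truncated_inverse K t \<le> K"
proof -
  have p: "0 < max (1 / K) (min 1 t)" using assms by (simp add: less_max_iff_disj)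
  have "max (1 / K) (min 1 t) \<le> 1" using assms by simp
  then show "1 \<le> truncated_inverse K t"
    using p by (simp add: truncated_inverse_def)
  have "1 / max (1 / K) (min 1 t) \<le> 1 / (1 / K)"
    by (rule divide_left_mono) (use assms p in auto)
  then show "truncated_inverse K t \<le> K"
    by (simp add: truncated_inverse_def)
qed

text \<open>For t \<le> 1 the product is at most 1, otherwise the truncated inverse is 1. The bound
  is free of K, so the integrals against M stay bounded as K grows.\<close>

lemma truncated_inverse_mult_le:
  assumes "K \<ge> 1" "t \<ge> 0"
  shows "t * truncated_inverse K t \<le> 1 + t"
proof (cases "t \<le> 1")
  case True
  have p: "0 < max (1 / K) (min 1 t)" using assms by (simp add: less_max_iff_disj)
  have "t * truncated_inverse K t = t / max (1 / K) (min 1 t)" by (simp add: truncated_inverse_def)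
  also have "\<dots> \<le> 1" using p True by (simp add: divide_le_eq_1)
  finally show ?thesis using assms by simp
next
  case False
  then have "truncated_inverse K t = 1" using assms by (simp add: truncated_inverse_def)
  then show ?thesis by simp
qed

lemma truncated_inverse_mono:
  assumes "1 \<le> K" "K \<le> L"
  shows "truncated_inverse K t \<le> truncated_inverse L t"
  unfolding truncated_inverse_def
proof (rule divide_left_mono)
  have "1 / L \<le> 1 / K" using assms by (simp add: frac_le)
  then show "max (1 / L) (min 1 t) \<le> max (1 / K) (min 1 t)" by auto
  have "0 < max (1 / K) (min 1 t)" "0 < max (1 / L) (min 1 t)"
    using assms by (simp_all add: less_max_iff_disj)
  then show "0 < max (1 / K) (min 1 t) * max (1 / L) (min 1 t)" by simp
qed simp

text \<open>For h > 0 and t \<le> 0 the values h ln (n + 1) are unbounded; for 0 < t < 1 the value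
  is attained once n + 1 \<ge> 1 / t; otherwise the left side is 0, where h = 0 relies on 0 times
  \<infinity> being 0. The index \<open>Suc n\<close> keeps the truncation level at least 1.\<close>

lemma neg_log_le_SUP:
  assumes "0 \<le> h"
  shows "e2ennreal (- (ereal h * ext_log t)) \<le> (SUP n. ennreal (h * ln (truncated_inverse (real (Suc n)) t)))"
proof -
  let ?u = "\<lambda>n. ennreal (h * ln (truncated_inverse (real (Suc n)) t))"
  consider "h = 0" | "h > 0" "t \<le> 0" | "h > 0" "0 < t" "t < 1" | "t \<ge> 1" using assms by linarith
  then show ?thesis
  proof cases
    case 1
    then show ?thesis by (simp add: zero_ereal_def[symmetric])
  next
    case 2
    have u: "?u n = ennreal (h * ln (real (Suc n)))" for n
    proof -
      have "min 1 t \<le> 1 / real (Suc n)"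
        using 2(2) by (meson divide_nonneg_nonneg min.coboundedI2 of_nat_0_le_iff order_trans zero_le_one)
      then have "truncated_inverse (real (Suc n)) t = real (Suc n)"
        unfolding truncated_inverse_def by (subst max.absorb1) auto
      then show ?thesis by simp
    qed
    have "(SUP n. ?u n) = top"
    proof (rule ennreal_SUP_eq_top)
      fix k
      obtain n where n: "exp (real k / h) \<le> real n" using real_arch_simple by blast
      have "real k / h \<le> ln (real (Suc n))"
        using n by (subst ln_ge_iff) auto
      then have "real k \<le> h * ln (real (Suc n))" using 2(1) by (simp add: field_simps)
      then have "ennreal (real k) \<le> ?u n" unfolding u by (rule ennreal_leI)
      then show "\<exists>n\<in>UNIV. of_nat k \<le> ?u n"
        by (intro bexI[of _ n]) (auto simp: ennreal_of_nat_eq_real_of_nat)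
    qed
    then show ?thesis by (simp only: top_greatest)
  next
    case 3
    obtain n where n: "1 / t \<le> real n" using real_arch_simple by blast
    then have "1 / t \<le> real (Suc n)" by simp
    then have "1 / real (Suc n) \<le> t" using 3 by (simp add: field_simps)
    then have "truncated_inverse (real (Suc n)) t = 1 / t"
      using 3 by (simp add: truncated_inverse_def max_def)
    then have "e2ennreal (- (ereal h * ext_log t)) = ?u n"
      using 3 by (simp add: ext_log_def ln_div)
    also have "\<dots> \<le> (SUP n. ?u n)" by (rule SUP_upper) simp
    finally show ?thesis .
  next
    case 4
    then have "e2ennreal (- (ereal h * ext_log t)) = 0"
      using assms by (simp add: ext_log_def ennreal_neg)
    then show ?thesis by simp
  qed
qed

context verblunsky_decomposition
begin

text \<open>The set N carries S, so the restriction of M to its complement is setwise below the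
  absolutely continuous part.\<close>

lemma nn_integral_off_null_le:
  assumes N: "N \<in> sets circle_borel" "emeasure S (sphere 0 1 - N) = 0"
    and g: "g \<in> borel_measurable borel"
  shows "(\<integral>\<^sup>+z. g z * indicator (sphere 0 1 - N) z \<partial>M) \<le> (\<integral>\<^sup>+z. g z \<partial>ac_part)"
proof -
  let ?I = "indicator (sphere 0 1 - N) :: complex \<Rightarrow> ennreal"
  have NM: "sphere 0 1 - N \<in> sets M"
    using sets.Diff[OF sets.top N(1)] by (simp add: sets_M space_circle_borel)
  have sS: "sets S = sets circle_borel"
    using singular by (simp add: singular_wrt_def circle_lebesgue_def)
  have gM: "g \<in> borel_measurable M"
    using measurable_compose[OF measurable_id_M g] .
  have "(\<integral>\<^sup>+z. g z * ?I z \<partial>M) = (\<integral>\<^sup>+z. g z \<partial>density M ?I)"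
    using NM gM by (subst nn_integral_density) (auto simp: mult.commute)
  also have "\<dots> \<le> (\<integral>\<^sup>+z. g z \<partial>ac_part)"
  proof (rule nn_integral_mono_measure)
    show s: "sets (density M ?I) = sets ac_part" by (simp add: sets_M sets_ac_part)
    show "density M ?I \<le> ac_part"
      unfolding le_measure[OF s]
    proof
      fix A assume "A \<in> sets (density M ?I)"
      then have A: "A \<in> sets M" "A \<in> sets circle_borel" by (simp_all add: sets_M)
      have "emeasure (density M ?I) A = emeasure M ((sphere 0 1 - N) \<inter> A)"
        using A NM by (simp add: emeasure_density nn_integral_set_ennreal[symmetric] indicator_inter_arith[symmetric])
      also have "\<dots> = emeasure ac_part ((sphere 0 1 - N) \<inter> A) + emeasure S ((sphere 0 1 - N) \<inter> A)"
        using A NM by (intro M_eq) (auto simp: sets_M)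
      also have "emeasure S ((sphere 0 1 - N) \<inter> A) = 0"
        using N(2) NM by (intro emeasure_eq_0[OF _ N(2)]) (auto simp: sS sets_M)
      also have "emeasure ac_part ((sphere 0 1 - N) \<inter> A) + 0 \<le> emeasure ac_part A"
        using A by (simp add: emeasure_mono sets_ac_part)
      finally show "emeasure (density M ?I) A \<le> emeasure ac_part A" .
    qed
  qed
  finally show ?thesis .
qed

text \<open>The constant 3 bounds \<integral> f dM for the test function f: at most 1 from N, where
  f = 1, and \<integral> (1 + w) \<le> 2 from the complement. It does not depend on K.\<close>

lemma truncated_log_integral_le:
  assumes B: "\<And>N. - B \<le> szego_integral m N" and K: "K \<ge> 1"
  shows "(\<integral>\<^sup>+\<theta>. ennreal ((1 - cos \<theta>) ^ m * ln (truncated_inverse K (w \<theta>))) \<partial>angle_measure) \<le> ennreal (3 * 2 ^ m + B)"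
proof -
  interpret A: prob_space angle_measure by (rule prob_space_angle_measure)
  obtain N where N: "N \<in> sets circle_borel" "emeasure circle_lebesgue N = 0" "emeasure S (sphere 0 1 - N) = 0"
    using singular by (auto simp: singular_wrt_def circle_lebesgue_def space_circle_borel)
  have Nb: "N \<in> sets borel" "N \<subseteq> sphere 0 1"
    using N(1) by (auto simp: circle_borel_def sets_restrict_space_iff)
  text \<open>The value \<open>1\<close> on \<open>N\<close> keeps the contribution of the singular part to \<open>\<integral> f dM\<close> bounded.\<close>
  define f where "f z = (if z \<in> sphere 0 1 - N then truncated_inverse K (w (Arg2pi z)) else 1)" for z
  have f1: "1 \<le> f z" and fK: "f z \<le> K" for z
    using truncated_inverse_bounds[OF K] K by (auto simp: f_def)
  have tm: "truncated_inverse K \<in> borel_measurable borel"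
    unfolding truncated_inverse_def by measurable
  have [measurable]: "sphere 0 1 - N \<in> sets borel" using Nb(1) by auto
  have fm [measurable]: "f \<in> borel_measurable borel"
    unfolding f_def using tm by (intro measurable_If_set) (auto intro: measurable_compose)
  \<comment> \<open>N is null for arc length, so the values of f on N do not affect integrals over
    the angle.\<close>
  have "emeasure angle_measure (cis -` N \<inter> space angle_measure) = 0"
    using N(1,2) by (simp add: circle_lebesgue_def emeasure_distr[OF measurable_cis_circle_borel])
  then have "AE \<theta> in angle_measure. cis \<theta> \<notin> N"
    using measurable_sets[OF measurable_cis_circle_borel N(1)]
    by (intro AE_I[of _ _ "cis -` N \<inter> space angle_measure"]) auto
  then have fcis: "AE \<theta> in angle_measure. f (cis \<theta>) = truncated_inverse K (w \<theta>) \<and> 0 \<le> w \<theta>"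
    using AE_angle_measure
  proof eventually_elim
    case (elim \<theta>)
    then show ?case using w_nonneg[of \<theta>] by (simp add: f_def Arg2pi_cis)
  qed
  have "(\<integral>\<^sup>+z. ennreal (f z) \<partial>M) \<le> (\<integral>\<^sup>+z. 1 + ennreal (f z) * indicator (sphere 0 1 - N) z \<partial>M)"
    by (rule nn_integral_mono) (auto simp: f_def indicator_def)
  also have "\<dots> = 1 + (\<integral>\<^sup>+z. ennreal (f z) * indicator (sphere 0 1 - N) z \<partial>M)"
  proof -
    have "(\<lambda>z. ennreal (f z) * indicator (sphere 0 1 - N) z) \<in> borel_measurable M"
      by (rule measurable_compose[OF measurable_id_M]) measurable
    then show ?thesis by (subst nn_integral_add) (auto simp: emeasure_space_1)
  qed
  also have "(\<integral>\<^sup>+z. ennreal (f z) * indicator (sphere 0 1 - N) z \<partial>M) \<le> (\<integral>\<^sup>+z. ennreal (f z) \<partial>ac_part)"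
    using fm by (intro nn_integral_off_null_le N) measurable
  also have "(\<integral>\<^sup>+z. ennreal (f z) \<partial>ac_part) = (\<integral>\<^sup>+\<theta>. ennreal (w \<theta>) * ennreal (f (cis \<theta>)) \<partial>angle_measure)"
    using fm by (intro nn_integral_ac_part) measurable
  also have "\<dots> \<le> (\<integral>\<^sup>+\<theta>. 1 + ennreal (w \<theta>) \<partial>angle_measure)"
  proof (rule nn_integral_mono_AE)
    show "AE \<theta> in angle_measure. ennreal (w \<theta>) * ennreal (f (cis \<theta>)) \<le> 1 + ennreal (w \<theta>)"
      using fcis
    proof eventually_elim
      case (elim \<theta>)
      have "w \<theta> * truncated_inverse K (w \<theta>) \<le> 1 + w \<theta>"
        using elim by (intro truncated_inverse_mult_le K) auto
      then have "ennreal (w \<theta> * truncated_inverse K (w \<theta>)) \<le> ennreal (1 + w \<theta>)" by (rule ennreal_leI)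
      then show ?case using elim by (simp add: ennreal_mult')
    qed
  qed
  also have "\<dots> = 1 + (\<integral>\<^sup>+\<theta>. ennreal (w \<theta>) \<partial>angle_measure)"
    using A.emeasure_space_1 by (subst nn_integral_add) auto
  also have "\<dots> \<le> 1 + 1" by (intro add_left_mono nn_integral_w_le)
  finally have "(\<integral>\<^sup>+z. ennreal (f z) \<partial>M) \<le> 1 + (1 + 1)" by (simp add: add_left_mono)
  moreover have "(\<integral>\<^sup>+z. ennreal (f z) \<partial>M) = ennreal (LINT z|M. f z)"
  proof (rule nn_integral_eq_integral)
    have "f \<in> borel_measurable M" using measurable_compose[OF measurable_id_M fm] .
    then show "integrable M f"
      by (intro integrable_const_bound[where B = K]) (use f1 fK in \<open>auto simp: abs_of_nonneg order_trans[OF zero_le_one]\<close>)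
    show "AE z in M. 0 \<le> f z" using f1 by (auto intro: order_trans[OF zero_le_one])
  qed
  moreover have "1 + (1 + 1) = ennreal 3" by (simp add: ennreal_numeral)
  ultimately have "ennreal (LINT z|M. f z) \<le> ennreal 3" by simp
  then have f3: "(LINT z|M. f z) \<le> 3" by (subst (asm) ennreal_le_iff) auto
  define k where "k \<theta> = (1 - cos \<theta>) ^ m * ln (f (cis \<theta>))" for \<theta>
  have k: "0 \<le> k \<theta>" "k \<theta> \<le> 2 ^ m * ln K" for \<theta>
    unfolding k_def using one_minus_cos_power_bounds[of \<theta> m] f1[of "cis \<theta>"] fK[of "cis \<theta>"]
    by (auto intro!: mult_mono)
  have ki: "integrable angle_measure k"
  proof (rule A.integrable_const_bound[where B = "2 ^ m * ln K"])
    have "(\<lambda>\<theta>. f (cis \<theta>)) \<in> borel_measurable angle_measure"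
      by (rule measurable_compose[OF _ fm]) simp
    then show "k \<in> borel_measurable angle_measure" unfolding k_def by measurable
  qed (use k in auto)
  have "(\<integral>\<^sup>+\<theta>. ennreal ((1 - cos \<theta>) ^ m * ln (truncated_inverse K (w \<theta>))) \<partial>angle_measure) = (\<integral>\<^sup>+\<theta>. ennreal (k \<theta>) \<partial>angle_measure)"
    by (rule nn_integral_cong_AE) (use fcis in eventually_elim, simp add: k_def)
  also have "\<dots> = ennreal (LINT \<theta>|angle_measure. k \<theta>)"
    by (rule nn_integral_eq_integral[OF ki]) (use k in auto)
  also have "\<dots> \<le> ennreal (3 * 2 ^ m + B)"
  proof (rule ennreal_leI)
    have "(LINT \<theta>|angle_measure. k \<theta>) \<le> 2 ^ m * (LINT z|M. f z) + B"
      unfolding k_def by (rule szego_integral_test_function[OF fm f1 fK B])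
    also have "\<dots> \<le> 2 ^ m * 3 + B" using f3 by simp
    finally show "(LINT \<theta>|angle_measure. k \<theta>) \<le> 3 * 2 ^ m + B" by simp
  qed
  finally show ?thesis .
qed

text \<open>Monotone convergence in the truncation level, with the bound of
  \<open>truncated_log_integral_le\<close> uniform in it.\<close>

lemma neg_part_finite:
  assumes B: "\<And>N. - B \<le> szego_integral m N"
  shows "(\<integral>\<^sup>+\<theta>. neg_part m \<theta> \<partial>angle_measure) < \<infinity>"
proof -
  define u where "u n \<theta> = ennreal ((1 - cos \<theta>) ^ m * ln (truncated_inverse (real (Suc n)) (w \<theta>)))" for n \<theta>
  have "truncated_inverse c \<in> borel_measurable borel" for c
    unfolding truncated_inverse_def by measurable
  then have um: "u n \<in> borel_measurable angle_measure" for n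
    unfolding u_def by measurable
  have "incseq u"
  proof (intro incseq_SucI le_funI)
    fix n \<theta>
    have "truncated_inverse (real (Suc n)) (w \<theta>) \<le> truncated_inverse (real (Suc (Suc n))) (w \<theta>)"
      by (rule truncated_inverse_mono) auto
    moreover have "1 \<le> truncated_inverse (real (Suc n)) (w \<theta>)"
      by (rule truncated_inverse_bounds) simp
    ultimately show "u n \<theta> \<le> u (Suc n) \<theta>"
      unfolding u_def by (intro ennreal_leI mult_left_mono one_minus_cos_power_bounds) auto
  qed
  have "(\<integral>\<^sup>+\<theta>. neg_part m \<theta> \<partial>angle_measure) \<le> (\<integral>\<^sup>+\<theta>. (SUP n. u n \<theta>) \<partial>angle_measure)"
    unfolding u_def neg_part_def
    by (intro nn_integral_mono neg_log_le_SUP one_minus_cos_power_bounds)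
  also have "\<dots> = (SUP n. \<integral>\<^sup>+\<theta>. u n \<theta> \<partial>angle_measure)"
    by (rule nn_integral_monotone_convergence_SUP[OF \<open>incseq u\<close> um])
  also have "\<dots> \<le> ennreal (3 * 2 ^ m + B)"
    unfolding u_def by (intro SUP_least truncated_log_integral_le B) simp
  also have "\<dots> < \<infinity>" by simp
  finally show ?thesis .
qed

text \<open>log w \<le> w and \<integral> w \<le> 1. This rules out \<infinity> - \<infinity> in
  \<open>ext_integral\<close>.\<close>

lemma pos_part_finite:
  "(\<integral>\<^sup>+\<theta>. e2ennreal (ereal ((1 - cos \<theta>) ^ m) * ext_log (w \<theta>)) \<partial>angle_measure) < \<infinity>"
proof -
  have "e2ennreal (ereal ((1 - cos \<theta>) ^ m) * ext_log (w \<theta>)) \<le> ennreal (2 ^ m) * ennreal (w \<theta>)" for \<theta>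
  proof (cases "w \<theta> \<le> 0")
    case True
    then have "ereal ((1 - cos \<theta>) ^ m) * ext_log (w \<theta>) \<le> 0"
      using one_minus_cos_power_bounds[of \<theta> m] unfolding ext_log_def
      by (simp only: if_True ereal_mult_le_0_iff) auto
    then show ?thesis by (simp add: e2ennreal_neg)
  next
    case False
    have "(1 - cos \<theta>) ^ m * ln (w \<theta>) \<le> (1 - cos \<theta>) ^ m * w \<theta>"
      using False ln_le_minus_one[of "w \<theta>"] by (intro mult_left_mono one_minus_cos_power_bounds) auto
    also have "\<dots> \<le> 2 ^ m * w \<theta>"
      using False by (intro mult_right_mono one_minus_cos_power_bounds) auto
    finally have "ennreal ((1 - cos \<theta>) ^ m * ln (w \<theta>)) \<le> ennreal (2 ^ m * w \<theta>)" by (rule ennreal_leI)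
    then show ?thesis using False by (simp add: ext_log_def ennreal_mult')
  qed
  then have "(\<integral>\<^sup>+\<theta>. e2ennreal (ereal ((1 - cos \<theta>) ^ m) * ext_log (w \<theta>)) \<partial>angle_measure)
      \<le> (\<integral>\<^sup>+\<theta>. ennreal (2 ^ m) * ennreal (w \<theta>) \<partial>angle_measure)"
    by (intro nn_integral_mono)
  also have "\<dots> = ennreal (2 ^ m) * (\<integral>\<^sup>+\<theta>. ennreal (w \<theta>) \<partial>angle_measure)"
    by (rule nn_integral_cmult) simp
  also have "\<dots> \<le> ennreal (2 ^ m) * 1" by (intro mult_left_mono nn_integral_w_le) simp
  also have "\<dots> < \<infinity>" by simp
  finally show ?thesis .
qed

lemma ext_integral_iff_bounded_below:
  "ext_integral angle_measure (\<lambda>\<theta>. ereal ((1 - cos \<theta>) ^ m) * ext_log (w \<theta>)) > - \<infinity>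
     \<longleftrightarrow> (\<exists>B. \<forall>N. - B \<le> szego_integral m N)"
proof -
  define P where "P = (\<integral>\<^sup>+\<theta>. e2ennreal (ereal ((1 - cos \<theta>) ^ m) * ext_log (w \<theta>)) \<partial>angle_measure)"
  define Q where "Q = (\<integral>\<^sup>+\<theta>. neg_part m \<theta> \<partial>angle_measure)"
  have "P < top" using pos_part_finite by (simp add: P_def)
  have "ext_integral angle_measure (\<lambda>\<theta>. ereal ((1 - cos \<theta>) ^ m) * ext_log (w \<theta>)) = enn2ereal P - enn2ereal Q"
    by (simp add: ext_integral_def P_def Q_def neg_part_def)
  also have "\<dots> > - \<infinity> \<longleftrightarrow> Q < top"
    using \<open>P < top\<close> by (cases P; cases Q) (auto simp: enn2ereal_ennreal)
  also have "\<dots> \<longleftrightarrow> (\<exists>B. \<forall>N. - B \<le> szego_integral m N)"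
    using szego_integral_bounded_below[of m] neg_part_finite[of _ m] by (auto simp: Q_def)
  finally show ?thesis .
qed

end

subsection \<open>Sequences with square-summable differences\<close>

definition sq_summable :: "(nat \<Rightarrow> real) \<Rightarrow> bool" where
  "sq_summable e \<longleftrightarrow> summable (\<lambda>n. (e n)\<^sup>2)"

lemma sq_summable_bound:
  assumes "sq_summable b" "\<And>n. \<bar>a n\<bar> \<le> K * \<bar>b n\<bar>"
  shows "sq_summable a"
  unfolding sq_summable_def
proof (rule summable_comparison_test')
  show "summable (\<lambda>n. K\<^sup>2 * (b n)\<^sup>2)"
    using assms(1) by (simp add: sq_summable_def summable_mult)
  fix n :: nat assume "n \<ge> 0"
  have "\<bar>a n\<bar>\<^sup>2 \<le> (K * \<bar>b n\<bar>)\<^sup>2" by (rule power_mono) (use assms(2) in auto)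
  then show "norm ((a n)\<^sup>2) \<le> K\<^sup>2 * (b n)\<^sup>2" by (simp add: power_mult_distrib)
qed

lemma sq_summable_mult:
  assumes "sq_summable a" "sq_summable b"
  shows "summable (\<lambda>n. \<bar>a n * b n\<bar>)"
proof (rule summable_comparison_test')
  show "summable (\<lambda>n. (a n)\<^sup>2 + (b n)\<^sup>2)"
    using assms by (simp add: sq_summable_def summable_add)
  fix n :: nat assume "n \<ge> 0"
  have "2 * (\<bar>a n\<bar> * \<bar>b n\<bar>) \<le> \<bar>a n\<bar>\<^sup>2 + \<bar>b n\<bar>\<^sup>2"
    using sum_squares_bound[of "\<bar>a n\<bar>" "\<bar>b n\<bar>"] by simp
  moreover have "0 \<le> \<bar>a n\<bar> * \<bar>b n\<bar>" by simp
  ultimately show "norm \<bar>a n * b n\<bar> \<le> (a n)\<^sup>2 + (b n)\<^sup>2"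
    by (simp only: power2_abs real_norm_def abs_abs abs_mult)
qed

lemma sq_summable_add:
  assumes "sq_summable a" "sq_summable b"
  shows "sq_summable (\<lambda>n. a n + b n)"
proof -
  have "summable (\<lambda>n. a n * b n)"
    by (rule summable_rabs_cancel[OF sq_summable_mult[OF assms]])
  then have "summable (\<lambda>n. (a n)\<^sup>2 + (b n)\<^sup>2 + 2 * (a n * b n))"
    using assms unfolding sq_summable_def by (intro summable_add summable_mult)
  then show ?thesis by (simp add: sq_summable_def power2_sum mult.assoc)
qed

lemma sq_summable_Suc_iff: "sq_summable (\<lambda>n. a (Suc n)) \<longleftrightarrow> sq_summable a"
  unfolding sq_summable_def by (rule summable_Suc_iff[of "\<lambda>n. (a n)\<^sup>2"])

lemma summable_abs_imp_sq_summable: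
  assumes "summable (\<lambda>n. \<bar>a n\<bar>)"
  shows "sq_summable a"
  unfolding sq_summable_def
proof (rule summable_comparison_test_ev)
  have "(\<lambda>n. \<bar>a n\<bar>) \<longlonglongrightarrow> 0" by (rule summable_LIMSEQ_zero[OF assms])
  then have "eventually (\<lambda>n. \<bar>a n\<bar> < 1) sequentially" by (rule order_tendstoD) simp
  then show "eventually (\<lambda>n. norm ((a n)\<^sup>2) \<le> \<bar>a n\<bar>) sequentially"
  proof eventually_elim
    case (elim n)
    have "\<bar>a n\<bar> * \<bar>a n\<bar> \<le> \<bar>a n\<bar> * 1" by (rule mult_left_mono) (use elim in auto)
    then show ?case by (simp add: power2_eq_square abs_mult)
  qed
qed (rule assms)

lemma summable_imp_Bseq_partial_sums:
  fixes a :: "nat \<Rightarrow> real"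
  assumes "summable a"
  shows "Bseq (\<lambda>N. \<Sum>n<N. a n)"
  by (rule convergent_imp_Bseq[OF convergentI[OF summable_LIMSEQ[OF assms]]])

lemma Bseq_add_Bseq:
  fixes f g :: "nat \<Rightarrow> real"
  assumes "Bseq f" "Bseq g"
  shows "Bseq (\<lambda>n. f n + g n)"
proof -
  obtain K L where "\<And>n. norm (f n) \<le> K" "\<And>n. norm (g n) \<le> L"
    using assms by (meson BseqE)
  then have "norm (f n + g n) \<le> K + L" for n
    by (meson add_mono norm_triangle_le order_trans)
  then show ?thesis by (rule BseqI')
qed

section \<open>Uniform estimates for polynomials on the unit interval\<close>

lemma poly_unit_interval_bound:
  "\<exists>K\<ge>0. \<forall>x\<in>{0..1::real}. \<bar>poly p x\<bar> \<le> K"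
proof -
  have "compact (poly p ` {0..1})"
    by (intro compact_continuous_image continuous_intros) auto
  then show ?thesis
    by (metis atLeastAtMost_iff bounded_pos compact_imp_bounded image_eqI less_eq_real_def real_norm_def)
qed

lemma poly_unit_interval_lipschitz:
  "\<exists>K\<ge>0. \<forall>x\<in>{0..1::real}. \<forall>y\<in>{0..1}. \<bar>poly p y - poly p x\<bar> \<le> K * \<bar>y - x\<bar>"
proof (induction p)
  case 0 show ?case by (rule exI[of _ 0]) simp
next
  case (pCons a p)
  obtain K where K: "K \<ge> 0" "\<forall>x\<in>{0..1::real}. \<forall>y\<in>{0..1}. \<bar>poly p y - poly p x\<bar> \<le> K * \<bar>y - x\<bar>"
    using pCons.IH by blast
  obtain M where M: "M \<ge> 0" "\<forall>x\<in>{0..1::real}. \<bar>poly p x\<bar> \<le> M"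
    using poly_unit_interval_bound by blast
  show ?case
  proof (intro exI conjI ballI)
    fix x y :: real assume xy: "x \<in> {0..1}" "y \<in> {0..1}"
    have "\<bar>poly (pCons a p) y - poly (pCons a p) x\<bar> = \<bar>x * (poly p y - poly p x) + poly p y * (y - x)\<bar>"
      by (simp add: algebra_simps)
    also have "\<dots> \<le> \<bar>x * (poly p y - poly p x)\<bar> + \<bar>poly p y * (y - x)\<bar>" by (rule abs_triangle_ineq)
    also have "\<dots> \<le> 1 * (K * \<bar>y - x\<bar>) + M * \<bar>y - x\<bar>"
      unfolding abs_mult by (intro add_mono mult_mono) (use xy K M in auto)
    finally show "\<bar>poly (pCons a p) y - poly (pCons a p) x\<bar> \<le> (K + M) * \<bar>y - x\<bar>"
      by (simp add: algebra_simps)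
  qed (use K M in auto)
qed

text \<open>Horner's scheme: a step multiplies the error by x and adds (y - x) (p(y) - p(x)), which
  the Lipschitz bound controls. Along \<open>alpha_sq\<close> the quadratic error is
  summable.\<close>

lemma poly_unit_interval_taylor:
  "\<exists>K\<ge>0. \<forall>x\<in>{0..1::real}. \<forall>y\<in>{0..1}.
     \<bar>poly p y - poly p x - poly (pderiv p) x * (y - x)\<bar> \<le> K * (y - x)\<^sup>2"
proof (induction p)
  case 0 show ?case by (rule exI[of _ 0]) simp
next
  case (pCons a p)
  obtain K where K: "K \<ge> 0" "\<forall>x\<in>{0..1::real}. \<forall>y\<in>{0..1}.
     \<bar>poly p y - poly p x - poly (pderiv p) x * (y - x)\<bar> \<le> K * (y - x)\<^sup>2"
    using pCons.IH by blast
  obtain M where M: "M \<ge> 0" "\<forall>x\<in>{0..1::real}. \<forall>y\<in>{0..1}. \<bar>poly p y - poly p x\<bar> \<le> M * \<bar>y - x\<bar>"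
    using poly_unit_interval_lipschitz by blast
  show ?case
  proof (intro exI conjI ballI)
    fix x y :: real assume xy: "x \<in> {0..1}" "y \<in> {0..1}"
    have "\<bar>poly (pCons a p) y - poly (pCons a p) x - poly (pderiv (pCons a p)) x * (y - x)\<bar>
       = \<bar>x * (poly p y - poly p x - poly (pderiv p) x * (y - x)) + (y - x) * (poly p y - poly p x)\<bar>"
      by (simp add: algebra_simps pderiv_pCons)
    also have "\<dots> \<le> \<bar>x * (poly p y - poly p x - poly (pderiv p) x * (y - x))\<bar> + \<bar>(y - x) * (poly p y - poly p x)\<bar>"
      by (rule abs_triangle_ineq)
    also have "\<dots> \<le> 1 * (K * (y - x)\<^sup>2) + \<bar>y - x\<bar> * (M * \<bar>y - x\<bar>)"
      unfolding abs_mult by (intro add_mono mult_mono) (use xy K M in auto)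
    also have "\<dots> = (K + M) * (y - x)\<^sup>2"
      by (simp add: power2_eq_square algebra_simps flip: abs_mult)
    finally show "\<bar>poly (pCons a p) y - poly (pCons a p) x - poly (pderiv (pCons a p)) x * (y - x)\<bar> \<le> (K + M) * (y - x)\<^sup>2" .
  qed (use K M in auto)
qed

lemma poly_antiderivative: "\<exists>q. pderiv q = (p :: real poly)"
proof -
  have "pderiv (\<Sum>i\<le>degree p. monom (coeff p i / real (Suc i)) (Suc i)) = p"
    by (simp add: higher_pderiv_sum[of 1, simplified] pderiv_monom poly_as_sum_of_monoms del: of_nat_Suc)
  then show ?thesis by blast
qed

section \<open>Error terms with bounded weighted partial sums\<close>

locale square_summable_variation = verblunsky_sequence +
  assumes sq_summable_diff: "sq_summable (\<lambda>n. cmod (\<alpha> (Suc n) - \<alpha> n))"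
begin

definition alpha_sq :: "nat \<Rightarrow> real" where "alpha_sq n = (cmod (\<alpha> n))\<^sup>2"

lemma alpha_sq_in: "alpha_sq n \<in> {0..1}"
  using cmod_less_1[of n] by (simp add: alpha_sq_def power_le_one_iff)

lemma sq_summable_diff_alpha_sq: "sq_summable (\<lambda>n. alpha_sq (Suc n) - alpha_sq n)"
proof (rule sq_summable_bound[OF sq_summable_diff, where K = 2])
  fix n
  have "\<bar>alpha_sq (Suc n) - alpha_sq n\<bar> = \<bar>cmod (\<alpha> (Suc n)) - cmod (\<alpha> n)\<bar> * (cmod (\<alpha> (Suc n)) + cmod (\<alpha> n))"
    by (simp add: alpha_sq_def power2_eq_square square_diff_square_factored abs_mult)
  also have "\<dots> \<le> cmod (\<alpha> (Suc n) - \<alpha> n) * 2"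
    by (intro mult_mono norm_triangle_ineq3) (use cmod_less_1[of n] cmod_less_1[of "Suc n"] in auto)
  finally show "\<bar>alpha_sq (Suc n) - alpha_sq n\<bar> \<le> 2 * \<bar>cmod (\<alpha> (Suc n) - \<alpha> n)\<bar>" by simp
qed

lemma sq_summable_poly_mult:
  assumes "sq_summable e"
  shows "sq_summable (\<lambda>n. poly c (alpha_sq n) * e n)"
proof -
  obtain K where "\<forall>x\<in>{0..1::real}. \<bar>poly c x\<bar> \<le> K"
    using poly_unit_interval_bound by blast
  then show ?thesis
    using alpha_sq_in by (intro sq_summable_bound[OF assms, where K = K]) (auto simp: abs_mult intro!: mult_right_mono)
qed

lemma sq_summable_poly_diff: "sq_summable (\<lambda>n. poly f (alpha_sq (Suc n)) - poly f (alpha_sq n))"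
proof -
  obtain K where "\<forall>x\<in>{0..1::real}. \<forall>y\<in>{0..1}. \<bar>poly f y - poly f x\<bar> \<le> K * \<bar>y - x\<bar>"
    using poly_unit_interval_lipschitz by blast
  then show ?thesis
    using alpha_sq_in by (intro sq_summable_bound[OF sq_summable_diff_alpha_sq, where K = K]) auto
qed

lemma summable_poly_mult:
  assumes "summable (\<lambda>n. \<bar>e n\<bar>)"
  shows "summable (\<lambda>n. \<bar>poly c (alpha_sq n) * e n\<bar>)"
proof -
  obtain K where "\<forall>x\<in>{0..1::real}. \<bar>poly c x\<bar> \<le> K"
    using poly_unit_interval_bound by blast
  then have "norm \<bar>poly c (alpha_sq n) * e n\<bar> \<le> K * \<bar>e n\<bar>" for n
    using alpha_sq_in by (auto simp: abs_mult intro!: mult_right_mono)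
  then show ?thesis
    by (intro summable_comparison_test'[OF summable_mult[OF assms, of K], where N = 0]) auto
qed

text \<open>Allowing polynomial factors makes the errors in \<open>has_symbol\<close> below stable under products.\<close>

definition negligible :: "(nat \<Rightarrow> real) \<Rightarrow> bool" where
  "negligible e \<longleftrightarrow> sq_summable e \<and> (\<forall>c. Bseq (\<lambda>N. \<Sum>n<N. poly c (alpha_sq n) * e n))"

lemma negligible_Bseq: "negligible e \<Longrightarrow> Bseq (\<lambda>N. \<Sum>n<N. e n)"
  unfolding negligible_def by (drule conjunct2, drule spec[of _ 1]) simp

lemma negligible_summable:
  assumes "summable (\<lambda>n. \<bar>e n\<bar>)"
  shows "negligible e"
  unfolding negligible_def
  by (intro conjI allI summable_abs_imp_sq_summable[OF assms] summable_imp_Bseq_partial_sums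
      summable_rabs_cancel[OF summable_poly_mult[OF assms]])

lemma negligible_add:
  assumes "negligible e" "negligible e'"
  shows "negligible (\<lambda>n. e n + e' n)"
  unfolding negligible_def
proof (intro conjI allI)
  fix c
  have "Bseq (\<lambda>N. (\<Sum>n<N. poly c (alpha_sq n) * e n) + (\<Sum>n<N. poly c (alpha_sq n) * e' n))"
    using assms unfolding negligible_def by (intro Bseq_add_Bseq) auto
  then show "Bseq (\<lambda>N. \<Sum>n<N. poly c (alpha_sq n) * (e n + e' n))"
    by (simp add: sum.distrib distrib_left)
qed (use assms in \<open>auto simp: negligible_def intro: sq_summable_add\<close>)

lemma negligible_poly_mult:
  assumes "negligible e"
  shows "negligible (\<lambda>n. poly d (alpha_sq n) * e n)"
  unfolding negligible_def
proof (intro conjI allI)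
  fix c
  show "Bseq (\<lambda>N. \<Sum>n<N. poly c (alpha_sq n) * (poly d (alpha_sq n) * e n))"
    using conjunct2[OF assms[unfolded negligible_def], rule_format, of "c * d"] by (simp add: mult.assoc)
qed (use assms in \<open>auto simp: negligible_def intro: sq_summable_poly_mult\<close>)

lemma negligible_uminus: "negligible e \<Longrightarrow> negligible (\<lambda>n. - e n)"
  using negligible_poly_mult[of e "[:-1:]"] by simp

lemma negligible_diff: "negligible e \<Longrightarrow> negligible e' \<Longrightarrow> negligible (\<lambda>n. e n - e' n)"
  using negligible_add[of e "\<lambda>n. - e' n"] negligible_uminus[of e'] by simp

lemma summable_taylor:
  "summable (\<lambda>n. \<bar>poly f (alpha_sq (Suc n)) - poly f (alpha_sq n) - poly (pderiv f) (alpha_sq n) * (alpha_sq (Suc n) - alpha_sq n)\<bar>)"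
proof -
  obtain K where "\<forall>x\<in>{0..1::real}. \<forall>y\<in>{0..1}.
     \<bar>poly f y - poly f x - poly (pderiv f) x * (y - x)\<bar> \<le> K * (y - x)\<^sup>2"
    using poly_unit_interval_taylor by blast
  then have le: "norm \<bar>poly f (alpha_sq (Suc n)) - poly f (alpha_sq n) - poly (pderiv f) (alpha_sq n) * (alpha_sq (Suc n) - alpha_sq n)\<bar>
      \<le> K * (alpha_sq (Suc n) - alpha_sq n)\<^sup>2" for n
    using alpha_sq_in by auto
  have "summable (\<lambda>n. K * (alpha_sq (Suc n) - alpha_sq n)\<^sup>2)"
    using sq_summable_diff_alpha_sq unfolding sq_summable_def by (rule summable_mult)
  then show ?thesis
    by (rule summable_comparison_test'[where N = 0]) (rule le)
qed

text \<open>The differences of x_n = |\<alpha>_n|^2 are only known to be square summable. With Q' =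
  c, however, c(x_n) (x_(n+1) - x_n) is Q(x_(n+1)) - Q(x_n) up to a summable Taylor error, and the
  main part telescopes to a bounded quantity.\<close>

lemma negligible_diff_alpha_sq: "negligible (\<lambda>n. alpha_sq (Suc n) - alpha_sq n)"
  unfolding negligible_def
proof (intro conjI allI)
  fix c :: "real poly"
  obtain q where q: "pderiv q = c" using poly_antiderivative by blast
  define r where "r n = poly q (alpha_sq (Suc n)) - poly q (alpha_sq n) - poly c (alpha_sq n) * (alpha_sq (Suc n) - alpha_sq n)" for n
  have "summable r"
    using summable_taylor[of q] summable_rabs_cancel[of r] by (simp add: r_def q)
  then have "Bseq (\<lambda>N. - (\<Sum>n<N. r n))"
    by (simp add: Bseq_minus_iff summable_imp_Bseq_partial_sums)
  moreover have "Bseq (\<lambda>N. poly q (alpha_sq N) - poly q (alpha_sq 0))"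
  proof -
    obtain K where "\<forall>x\<in>{0..1::real}. \<bar>poly q x\<bar> \<le> K"
      using poly_unit_interval_bound by blast
    then have "\<bar>poly q (alpha_sq n)\<bar> \<le> K" for n using alpha_sq_in by auto
    then have "norm (poly q (alpha_sq N) - poly q (alpha_sq 0)) \<le> K + K" for N
      unfolding real_norm_def by (meson abs_triangle_ineq4 add_mono order_trans)
    then show ?thesis by (rule BseqI')
  qed
  ultimately have "Bseq (\<lambda>N. (poly q (alpha_sq N) - poly q (alpha_sq 0)) + - (\<Sum>n<N. r n))"
    by (intro Bseq_add_Bseq)
  moreover have "(poly q (alpha_sq N) - poly q (alpha_sq 0)) + - (\<Sum>n<N. r n) = (\<Sum>n<N. poly c (alpha_sq n) * (alpha_sq (Suc n) - alpha_sq n))" for N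
  proof -
    have "poly q (alpha_sq N) - poly q (alpha_sq 0) = (\<Sum>n<N. poly q (alpha_sq (Suc n)) - poly q (alpha_sq n))"
      by (rule sum_lessThan_telescope[symmetric])
    then show ?thesis by (simp add: r_def flip: sum_subtractf)
  qed
  ultimately show "Bseq (\<lambda>N. \<Sum>n<N. poly c (alpha_sq n) * (alpha_sq (Suc n) - alpha_sq n))" by simp
qed (rule sq_summable_diff_alpha_sq)

lemma negligible_poly_diff: "negligible (\<lambda>n. poly f (alpha_sq (Suc n)) - poly f (alpha_sq n))"
proof -
  have "negligible (\<lambda>n. (poly f (alpha_sq (Suc n)) - poly f (alpha_sq n) - poly (pderiv f) (alpha_sq n) * (alpha_sq (Suc n) - alpha_sq n))
      + poly (pderiv f) (alpha_sq n) * (alpha_sq (Suc n) - alpha_sq n))"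
    by (rule negligible_add[OF negligible_summable[OF summable_taylor]
          negligible_poly_mult[OF negligible_diff_alpha_sq]])
  then show ?thesis by simp
qed

text \<open>Moving the shift from e to the weight costs (c(x_(n+1)) - c(x_n)) e_(n+1), a product of
  two square-summable sequences and hence summable.\<close>

lemma negligible_Suc_iff: "negligible (\<lambda>n. e (Suc n)) \<longleftrightarrow> negligible e"
proof -
  have "Bseq (\<lambda>N. \<Sum>n<N. poly c (alpha_sq n) * e (Suc n)) \<longleftrightarrow> Bseq (\<lambda>N. \<Sum>n<N. poly c (alpha_sq n) * e n)"
    if e: "sq_summable e" for c
  proof -
    define r where "r n = (poly c (alpha_sq (Suc n)) - poly c (alpha_sq n)) * e (Suc n)" for n
    have "summable (\<lambda>n. \<bar>r n\<bar>)"
      unfolding r_def using e by (intro sq_summable_mult sq_summable_poly_diff) (simp add: sq_summable_Suc_iff)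
    then have r: "Bseq (\<lambda>N. \<Sum>n<N. r n)"
      by (rule summable_imp_Bseq_partial_sums[OF summable_rabs_cancel])
    define A where "A N = (\<Sum>n<N. poly c (alpha_sq n) * e n)" for N
    define B where "B N = (\<Sum>n<N. poly c (alpha_sq n) * e (Suc n))" for N
    have AB: "A (Suc N) = poly c (alpha_sq 0) * e 0 + (B N + (\<Sum>n<N. r n))" for N
      unfolding A_def B_def r_def by (subst sum.lessThan_Suc_shift) (simp add: algebra_simps flip: sum.distrib)
    have "Bseq A \<longleftrightarrow> Bseq (\<lambda>N. A (Suc N))" by (simp add: Bseq_Suc_iff)
    also have "\<dots> \<longleftrightarrow> Bseq B"
    proof
      assume "Bseq (\<lambda>N. A (Suc N))"
      then have "Bseq (\<lambda>N. A (Suc N) + (- (poly c (alpha_sq 0) * e 0) + - (\<Sum>n<N. r n)))"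
        by (intro Bseq_add_Bseq) (auto simp: r Bseq_minus_iff)
      then show "Bseq B" unfolding AB by (simp add: algebra_simps)
    next
      assume "Bseq B"
      then show "Bseq (\<lambda>N. A (Suc N))" unfolding AB
        by (intro Bseq_add_Bseq) (auto simp: r)
    qed
    finally show ?thesis unfolding A_def B_def by simp
  qed
  then show ?thesis unfolding negligible_def sq_summable_Suc_iff by auto
qed

text \<open>Imaginary parts need not telescope; it suffices that products of two of them are summable.\<close>

definition has_symbol :: "(nat \<Rightarrow> complex) \<Rightarrow> real poly \<Rightarrow> bool" where
  "has_symbol F f \<longleftrightarrow> negligible (\<lambda>n. Re (F n) - poly f (alpha_sq n)) \<and> sq_summable (\<lambda>n. Im (F n))"

lemma has_symbol_const: "has_symbol (\<lambda>n. of_real c) [:c:]"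
  unfolding has_symbol_def using negligible_summable[of "\<lambda>_. 0"] by (simp add: sq_summable_def)

lemma has_symbol_add:
  assumes "has_symbol F f" "has_symbol G g"
  shows "has_symbol (\<lambda>n. F n + G n) (f + g)"
  unfolding has_symbol_def
proof
  have "negligible (\<lambda>n. (Re (F n) - poly f (alpha_sq n)) + (Re (G n) - poly g (alpha_sq n)))"
    using assms unfolding has_symbol_def by (intro negligible_add) auto
  then show "negligible (\<lambda>n. Re (F n + G n) - poly (f + g) (alpha_sq n))"
    by (simp add: algebra_simps)
qed (use assms in \<open>auto simp: has_symbol_def intro: sq_summable_add\<close>)

text \<open>A symbol times an error is negligible by the closure under polynomial weights. Error
  times error, and imaginary part times imaginary part, are summable as products of square-summable
  sequences.\<close>

lemma has_symbol_mult:
  assumes "has_symbol F f" "has_symbol G g"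
  shows "has_symbol (\<lambda>n. F n * G n) (f * g)"
proof -
  define a where "a n = Re (F n) - poly f (alpha_sq n)" for n
  define b where "b n = Re (G n) - poly g (alpha_sq n)" for n
  have F: "Re (F n) = poly f (alpha_sq n) + a n" and G: "Re (G n) = poly g (alpha_sq n) + b n" for n
    by (auto simp: a_def b_def)
  have a: "negligible a" "sq_summable a" and b: "negligible b" "sq_summable b"
    and i: "sq_summable (\<lambda>n. Im (F n))" "sq_summable (\<lambda>n. Im (G n))"
    using assms unfolding has_symbol_def a_def b_def negligible_def by auto
  have ab: "negligible (\<lambda>n. u n * v n)" if "sq_summable u" "sq_summable v" for u v
    by (rule negligible_summable[OF sq_summable_mult[OF that]])
  have "negligible (\<lambda>n. poly f (alpha_sq n) * b n + poly g (alpha_sq n) * a n + a n * b n - Im (F n) * Im (G n))"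
    by (rule negligible_diff[OF negligible_add[OF negligible_add[OF negligible_poly_mult[OF b(1)]
          negligible_poly_mult[OF a(1)]] ab[OF a(2) b(2)]] ab[OF i]])
  then have "negligible (\<lambda>n. Re (F n * G n) - poly (f * g) (alpha_sq n))"
    by (simp add: F G algebra_simps)
  moreover have "sq_summable (\<lambda>n. (poly f (alpha_sq n) * Im (G n) + poly g (alpha_sq n) * Im (F n)) + (a n * Im (G n) + b n * Im (F n)))"
    by (rule sq_summable_add[OF sq_summable_add[OF sq_summable_poly_mult[OF i(2)] sq_summable_poly_mult[OF i(1)]]
          sq_summable_add[OF summable_abs_imp_sq_summable[OF sq_summable_mult[OF a(2) i(2)]]
            summable_abs_imp_sq_summable[OF sq_summable_mult[OF b(2) i(1)]]]])
  then have "sq_summable (\<lambda>n. Im (F n * G n))"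
    by (simp add: F G algebra_simps)
  ultimately show ?thesis by (simp add: has_symbol_def)
qed

lemma has_symbol_scale: "has_symbol F f \<Longrightarrow> has_symbol (\<lambda>n. of_real c * F n) (smult c f)"
  using has_symbol_mult[OF has_symbol_const[of c], of F f] by simp

lemma has_symbol_diff: "has_symbol F f \<Longrightarrow> has_symbol G g \<Longrightarrow> has_symbol (\<lambda>n. F n - G n) (f - g)"
  using has_symbol_add[of F f "\<lambda>n. of_real (-1) * G n" "smult (-1) g"] has_symbol_scale[of G g "-1"] by simp

lemma has_symbol_sum:
  assumes "\<And>i. i \<in> A \<Longrightarrow> has_symbol (F i) (f i)"
  shows "has_symbol (\<lambda>n. \<Sum>i\<in>A. F i n) (\<Sum>i\<in>A. f i)"
  using assms
proof (induction A rule: infinite_finite_induct)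
  case (insert i A)
  then show ?case by (simp add: has_symbol_add)
qed (use has_symbol_const[of 0] in auto)

text \<open>A shift changes the comparison value by f(x_(n+1)) - f(x_n), which is negligible by
  telescoping.\<close>

lemma has_symbol_Suc_iff: "has_symbol (\<lambda>n. F (Suc n)) f \<longleftrightarrow> has_symbol F f"
proof -
  define e where "e = (\<lambda>n. Re (F n) - poly f (alpha_sq n))"
  have "negligible (\<lambda>n. Re (F (Suc n)) - poly f (alpha_sq n)) \<longleftrightarrow> negligible (\<lambda>n. e (Suc n))"
  proof
    assume "negligible (\<lambda>n. Re (F (Suc n)) - poly f (alpha_sq n))"
    from negligible_diff[OF this negligible_poly_diff[of f]]
    show "negligible (\<lambda>n. e (Suc n))" by (simp add: e_def)
  next
    assume "negligible (\<lambda>n. e (Suc n))"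
    from negligible_add[OF this negligible_poly_diff[of f]]
    show "negligible (\<lambda>n. Re (F (Suc n)) - poly f (alpha_sq n))" by (simp add: e_def)
  qed
  then show ?thesis
    unfolding has_symbol_def sq_summable_Suc_iff[of "\<lambda>n. Im (F n)"] negligible_Suc_iff[of e]
    unfolding e_def by simp
qed

lemma sq_summable_cmod_shift: "sq_summable (\<lambda>n. cmod (\<alpha> (n + s) - \<alpha> n))"
proof (induction s)
  case 0
  then show ?case by (simp add: sq_summable_def)
next
  case (Suc s)
  have "sq_summable (\<lambda>n. cmod (\<alpha> (Suc n + s) - \<alpha> (Suc n)) + cmod (\<alpha> (Suc n) - \<alpha> n))"
    by (intro sq_summable_add sq_summable_diff) (use Suc sq_summable_Suc_iff[of "\<lambda>n. cmod (\<alpha> (n + s) - \<alpha> n)"] in simp)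
  then show ?case
  proof (rule sq_summable_bound[where K = 1])
    fix n
    show "\<bar>cmod (\<alpha> (n + Suc s) - \<alpha> n)\<bar> \<le> 1 * \<bar>cmod (\<alpha> (Suc n + s) - \<alpha> (Suc n)) + cmod (\<alpha> (Suc n) - \<alpha> n)\<bar>"
      using norm_triangle_ineq[of "\<alpha> (Suc n + s) - \<alpha> (Suc n)" "\<alpha> (Suc n) - \<alpha> n"] by simp
  qed
qed

lemma negligible_alpha_sq_shift: "negligible (\<lambda>n. alpha_sq (n + s) - alpha_sq n)"
proof (induction s)
  case 0
  then show ?case using negligible_summable[of "\<lambda>_. 0"] by simp
next
  case (Suc s)
  have "negligible (\<lambda>n. (alpha_sq (Suc n + s) - alpha_sq (Suc n)) + (alpha_sq (Suc n) - alpha_sq n))"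
    by (intro negligible_add negligible_diff_alpha_sq) (use Suc negligible_Suc_iff[of "\<lambda>n. alpha_sq (n + s) - alpha_sq n"] in simp)
  then show ?case by simp
qed

text \<open>Polarisation: Re (a cnj b) - |b|^2 is half of |a|^2 - |b|^2, which telescopes, minus
  half of |a - b|^2, which is summable. The imaginary part sees only (a - b) cnj b.\<close>

lemma has_symbol_shift_product: "has_symbol (\<lambda>n. \<alpha> (n + s) * cnj (\<alpha> n)) [:0, 1:]"
  unfolding has_symbol_def
proof
  have polar: "Re (a * cnj b) - (cmod b)\<^sup>2 = (1 / 2) * ((cmod a)\<^sup>2 - (cmod b)\<^sup>2) - (1 / 2) * (cmod (a - b))\<^sup>2" for a b :: complex
    by (simp add: cmod_power2) (simp add: power2_eq_square field_simps)
  have "summable (\<lambda>n. \<bar>(cmod (\<alpha> (n + s) - \<alpha> n))\<^sup>2\<bar>)"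
    using sq_summable_cmod_shift[of s] by (simp add: sq_summable_def)
  then have "negligible (\<lambda>n. poly [:1/2:] (alpha_sq n) * (alpha_sq (n + s) - alpha_sq n) - poly [:1/2:] (alpha_sq n) * (cmod (\<alpha> (n + s) - \<alpha> n))\<^sup>2)"
    by (rule negligible_diff[OF negligible_poly_mult[OF negligible_alpha_sq_shift]
          negligible_poly_mult[OF negligible_summable]])
  then show "negligible (\<lambda>n. Re (\<alpha> (n + s) * cnj (\<alpha> n)) - poly [:0, 1:] (alpha_sq n))"
    using polar by (simp add: alpha_sq_def)
  show "sq_summable (\<lambda>n. Im (\<alpha> (n + s) * cnj (\<alpha> n)))"
  proof (rule sq_summable_bound[OF sq_summable_cmod_shift, where K = 1])
    fix n
    have "\<alpha> (n + s) * cnj (\<alpha> n) = (\<alpha> (n + s) - \<alpha> n) * cnj (\<alpha> n) + of_real ((cmod (\<alpha> n))\<^sup>2)"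
      by (simp add: algebra_simps complex_norm_square del: of_real_power)
    then have "Im (\<alpha> (n + s) * cnj (\<alpha> n)) = Im ((\<alpha> (n + s) - \<alpha> n) * cnj (\<alpha> n))"
      by (metis Im_complex_of_real add.right_neutral plus_complex.sel(2))
    also have "\<bar>\<dots>\<bar> \<le> cmod (\<alpha> (n + s) - \<alpha> n) * cmod (\<alpha> n)"
      using abs_Im_le_cmod[of "(\<alpha> (n + s) - \<alpha> n) * cnj (\<alpha> n)"] by (simp add: norm_mult)
    also have "\<dots> \<le> cmod (\<alpha> (n + s) - \<alpha> n) * 1"
      by (intro mult_left_mono) (use cmod_less_1[of n] in auto)
    finally show "\<bar>Im (\<alpha> (n + s) * cnj (\<alpha> n))\<bar> \<le> 1 * \<bar>cmod (\<alpha> (n + s) - \<alpha> n)\<bar>" by simp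
  qed
qed

lemma has_symbol_Bseq:
  assumes "has_symbol F f"
  shows "Bseq (\<lambda>N. \<Sum>n<N. Re (F n) - poly f (alpha_sq n))"
  using assms unfolding has_symbol_def by (intro negligible_Bseq) auto

end

section \<open>Symbols of the Taylor coefficients\<close>

context square_summable_variation
begin

text \<open>Induction on the degree with arbitrary shift s: the recursion expresses \<alpha>_(n+1+s)
  U_(n+1) at degree j + 1 through \<alpha>_(n+s+1) U_n at degree j, trading a degree for a shift.
  Each factor U stays paired with some \<alpha>, so the phases cancel up to negligible
  errors.\<close>

lemma has_symbol_quad:
  assumes U0: "\<And>n. U n $ 0 = 0"
    and U_Suc: "\<And>n. U (Suc n) * (1 - fps_const (\<alpha> n) * U n) = fps_X * (U n - fps_const (cnj (\<alpha> n)))"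
  shows "has_symbol (\<lambda>n. \<alpha> (n + s) * U n $ k) (quad_symbol k)"
proof (induction k arbitrary: s rule: less_induct)
  case (less k)
  show ?case
  proof (cases k)
    case 0
    then show ?thesis using U0 has_symbol_const[of 0] by simp
  next
    case (Suc j)
    have coeff: "U (Suc n) $ Suc j = U n $ j - (if j = 0 then cnj (\<alpha> n) else 0)
        + (\<Sum>i\<in>{1..j}. U (Suc n) $ i * (\<alpha> n * U n $ (Suc j - i)))" for n
    proof -
      have "U (Suc n) = fps_X * (U n - fps_const (cnj (\<alpha> n))) + U (Suc n) * (fps_const (\<alpha> n) * U n)"
        using U_Suc[of n] by (simp add: algebra_simps)
      then have "U (Suc n) $ Suc j = (fps_X * (U n - fps_const (cnj (\<alpha> n))) + U (Suc n) * (fps_const (\<alpha> n) * U n)) $ Suc j"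
        by simp
      also have "\<dots> = (U n - fps_const (cnj (\<alpha> n))) $ j + (U (Suc n) * (fps_const (\<alpha> n) * U n)) $ Suc j"
        by simp
      also have "(U (Suc n) * (fps_const (\<alpha> n) * U n)) $ Suc j
          = (\<Sum>i\<in>{1..j}. U (Suc n) $ i * (\<alpha> n * U n $ (Suc j - i)))"
        using U0 by (subst fps_mult_nth_Suc_inner) auto
      finally show ?thesis by simp
    qed
    have "has_symbol (\<lambda>n. \<alpha> (n + Suc s) * U n $ j - (if j = 0 then \<alpha> (n + Suc s) * cnj (\<alpha> n) else 0)
        + (\<Sum>i\<in>{1..j}. (\<alpha> (Suc n + s) * U (Suc n) $ i) * (\<alpha> (n + 0) * U n $ (Suc j - i))))
       (quad_symbol j - (if j = 0 then [:0, 1:] else 0) + (\<Sum>i\<in>{1..j}. quad_symbol i * quad_symbol (Suc j - i)))"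
    proof (intro has_symbol_add has_symbol_diff has_symbol_sum has_symbol_mult)
      show "has_symbol (\<lambda>n. \<alpha> (n + Suc s) * U n $ j) (quad_symbol j)"
        by (rule less.IH) (simp add: Suc)
      show "has_symbol (\<lambda>n. if j = 0 then \<alpha> (n + Suc s) * cnj (\<alpha> n) else 0) (if j = 0 then [:0, 1:] else 0)"
        using has_symbol_shift_product[of "Suc s"] has_symbol_const[of 0] by simp
      fix i assume i: "i \<in> {1..j}"
      show "has_symbol (\<lambda>n. \<alpha> (n + 0) * U n $ (Suc j - i)) (quad_symbol (Suc j - i))"
        by (rule less.IH) (use i Suc in auto)
      show "has_symbol (\<lambda>n. \<alpha> (Suc n + s) * U (Suc n) $ i) (quad_symbol i)"
        using less.IH[of i s] i by (simp only: has_symbol_Suc_iff[of "\<lambda>n. \<alpha> (n + s) * U n $ i"]) (simp add: Suc)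
    qed
    then have "has_symbol (\<lambda>n. \<alpha> (Suc n + s) * U (Suc n) $ Suc j) (quad_symbol (Suc j))"
      unfolding coeff quad_symbol.simps(2)
      by (rule back_subst[of "\<lambda>F. has_symbol F _"])
         (auto simp: fun_eq_iff distrib_left right_diff_distrib sum_distrib_left mult_ac)
    then show ?thesis
      unfolding Suc by (simp only: has_symbol_Suc_iff[of "\<lambda>n. \<alpha> (n + s) * U n $ Suc j"])
  qed
qed

text \<open>The logarithmic derivative identity yields a coefficient recursion of the same form as
  \<open>log_symbol\<close>; the closure rules for symbols do the rest.\<close>

lemma has_symbol_log:
  assumes U0: "\<And>n. U n $ 0 = 0"
    and U_Suc: "\<And>n. U (Suc n) * (1 - fps_const (\<alpha> n) * U n) = fps_X * (U n - fps_const (cnj (\<alpha> n)))"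
    and L: "\<And>n. fps_deriv (L n) * (1 - fps_const (\<alpha> n) * U n) = - fps_deriv (fps_const (\<alpha> n) * U n)"
    and "k \<ge> 1"
  shows "has_symbol (\<lambda>n. L n $ k) (log_symbol k)"
  using \<open>k \<ge> 1\<close>
proof (induction k rule: less_induct)
  case (less k)
  obtain j where j: "k = Suc j" using less.prems by (cases k) auto
  have coeff: "of_nat k * L n $ k
      = (\<Sum>i\<in>{1..<k}. of_real (real i) * L n $ i * (\<alpha> (n + 0) * U n $ (k - i)))
        - of_real (real k) * (\<alpha> (n + 0) * U n $ k)" for n
  proof -
    define Y where "Y = fps_const (\<alpha> n) * U n"
    have "fps_deriv (L n) = fps_deriv (L n) * Y - fps_deriv Y"
      using L[of n] by (simp add: Y_def algebra_simps)
    then have "fps_X * fps_deriv (L n) = fps_X * fps_deriv (L n) * Y - fps_X * fps_deriv Y"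
      by (metis mult.assoc right_diff_distrib)
    then have "(fps_X * fps_deriv (L n)) $ Suc j = (fps_X * fps_deriv (L n) * Y) $ Suc j - (fps_X * fps_deriv Y) $ Suc j"
      by (metis fps_sub_nth)
    also have "(fps_X * fps_deriv (L n) * Y) $ Suc j
        = (\<Sum>i\<in>{1..j}. (fps_X * fps_deriv (L n)) $ i * Y $ (Suc j - i))"
      by (rule fps_mult_nth_Suc_inner) (simp_all add: Y_def U0)
    also have "\<dots> = (\<Sum>i\<in>{1..<k}. of_real (real i) * L n $ i * (\<alpha> (n + 0) * U n $ (k - i)))"
      by (rule sum.cong) (auto simp: j Y_def)
    finally show ?thesis by (simp add: j Y_def)
  qed
  have "has_symbol (\<lambda>n. of_real (1 / real k) *
        ((\<Sum>i\<in>{1..<k}. of_real (real i) * L n $ i * (\<alpha> (n + 0) * U n $ (k - i)))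
        - of_real (real k) * (\<alpha> (n + 0) * U n $ k)))
      (smult (1 / real k) ((\<Sum>i\<in>{1..<k}. smult (real i) (log_symbol i) * quad_symbol (k - i))
        - smult (real k) (quad_symbol k)))"
    by (intro has_symbol_scale has_symbol_diff has_symbol_sum has_symbol_mult
          has_symbol_quad[OF U0 U_Suc] less.IH) auto
  then show ?case
    unfolding coeff[symmetric] log_symbol.simps[of k] using j
    by (simp del: of_nat_Suc)
qed

lemma Bseq_log_moment:
  assumes U0: "\<And>n. U n $ 0 = 0"
    and U_Suc: "\<And>n. U (Suc n) * (1 - fps_const (\<alpha> n) * U n) = fps_X * (U n - fps_const (cnj (\<alpha> n)))"
    and L: "\<And>n. fps_deriv (L n) * (1 - fps_const (\<alpha> n) * U n) = - fps_deriv (fps_const (\<alpha> n) * U n)"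
    and L0: "\<And>n. L n $ 0 = 0"
  shows "Bseq (\<lambda>N. \<Sum>n<N. Re (((1 - fps_X) ^ (2 * m) * L n) $ m)
     + (-1) ^ m * real ((2 * m) choose m) / 2 * (\<Sum>j\<in>{1..m}. alpha_sq n ^ j / real j))"
proof -
  define c where "c k = (-1) ^ (m - k) * real ((2 * m) choose (m - k))" for k
  have eq: "((1 - fps_X) ^ (2 * m) * L n) $ m = (\<Sum>k\<in>{1..m}. of_real (c k) * L n $ k)" for n
  proof -
    have "((1 - fps_X) ^ (2 * m) * L n) $ m = (L n * (1 - fps_X) ^ (2 * m)) $ m"
      by (simp add: mult.commute)
    also have "\<dots> = (\<Sum>k\<in>{0..m}. L n $ k * ((1 - fps_X) ^ (2 * m)) $ (m - k))"
      by (simp add: fps_mult_nth)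
    also have "\<dots> = (\<Sum>k\<in>{1..m}. L n $ k * ((1 - fps_X) ^ (2 * m)) $ (m - k))"
      by (rule sum.mono_neutral_right) (auto simp: not_le L0)
    finally show ?thesis
      by (simp add: one_minus_fps_X_power_nth c_def mult.commute)
  qed
  have "has_symbol (\<lambda>n. \<Sum>k\<in>{1..m}. of_real (c k) * L n $ k) (\<Sum>k\<in>{1..m}. smult (c k) (log_symbol k))"
    by (intro has_symbol_sum has_symbol_scale has_symbol_log[OF U0 U_Suc L]) auto
  from has_symbol_Bseq[OF this, folded eq]
  have "Bseq (\<lambda>N. \<Sum>n<N. Re (((1 - fps_X) ^ (2 * m) * L n) $ m) - poly (\<Sum>k\<in>{1..m}. smult (c k) (log_symbol k)) (alpha_sq n))" .
  moreover have "poly (\<Sum>k\<in>{1..m}. smult (c k) (log_symbol k)) t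
      = - ((-1) ^ m * real ((2 * m) choose m) / 2 * (\<Sum>j\<in>{1..m}. t ^ j / real j))" for t
    using log_symbol_moment[of m t] by (simp add: poly_sum c_def)
  ultimately show ?thesis by simp
qed

end

subsection \<open>The sums over the Verblunsky coefficients\<close>

text \<open>For |t| < 1 this is the tail, over j > m, of the series of - log (1 - t) with terms t^j
  / j.\<close>

definition log_remainder :: "nat \<Rightarrow> real \<Rightarrow> real" where
  "log_remainder m t = - (ln (1 - t) + (\<Sum>j\<in>{1..m}. t ^ j / real j))"

lemma log_remainder_0: "log_remainder m 0 = 0"
  by (auto simp: log_remainder_def intro!: sum.neutral)

lemma log_remainder_Suc: "log_remainder m t = log_remainder (Suc m) t + t ^ Suc m / real (Suc m)"
  by (simp add: log_remainder_def)

lemma DERIV_power_Suc: "((\<lambda>t. t ^ Suc m) has_real_derivative real (Suc m) * t ^ m) (at t)"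
  using DERIV_pow[of "Suc m" t] by (simp del: of_nat_Suc power_Suc)

lemma log_remainder_deriv:
  assumes "t < 1"
  shows "(log_remainder m has_real_derivative t ^ m / (1 - t)) (at t)"
proof (induction m)
  case 0
  have "((\<lambda>t. - ln (1 - t)) has_real_derivative 1 / (1 - t)) (at t)"
    using assms by (auto intro!: derivative_eq_intros simp: field_simps)
  then show ?case by (simp add: log_remainder_def[abs_def])
next
  case (Suc m)
  have eq: "log_remainder (Suc m) = (\<lambda>t. log_remainder m t - t ^ Suc m / real (Suc m))"
    using log_remainder_Suc[of m] by (simp add: fun_eq_iff)
  have "((\<lambda>t. log_remainder m t - t ^ Suc m / real (Suc m)) has_real_derivative
      (t ^ m / (1 - t) - (real (Suc m) * t ^ m) / real (Suc m))) (at t)"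
    by (intro DERIV_diff Suc.IH DERIV_cdivide DERIV_power_Suc)
  also have "t ^ m / (1 - t) - (real (Suc m) * t ^ m) / real (Suc m) = t ^ Suc m / (1 - t)"
    using assms by (simp add: field_simps del: of_nat_Suc)
  finally show ?case unfolding eq .
qed

lemma log_remainder_nonneg:
  assumes "0 \<le> t" "t < 1"
  shows "0 \<le> log_remainder m t"
proof -
  have "log_remainder m 0 \<le> log_remainder m t"
  proof (rule DERIV_nonneg_imp_nondecreasing[OF assms(1)])
    fix s assume "0 \<le> s" "s \<le> t"
    then show "\<exists>y. (log_remainder m has_real_derivative y) (at s) \<and> 0 \<le> y"
      using assms by (intro exI[of _ "s ^ m / (1 - s)"] conjI log_remainder_deriv) auto
  qed
  then show ?thesis by (simp add: log_remainder_0)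
qed

text \<open>The next remainder is nonnegative, so the first term of the tail is a lower
  bound.\<close>

lemma log_remainder_ge:
  assumes "0 \<le> t" "t < 1"
  shows "t ^ Suc m / real (Suc m) \<le> log_remainder m t"
  using log_remainder_nonneg[OF assms, of "Suc m"] log_remainder_Suc[of m t] by simp

text \<open>Comparison of derivatives: 1 / (1 - s) \<le> 2 for s \<le> 1/2.\<close>

lemma log_remainder_le:
  assumes "0 \<le> t" "t \<le> 1/2"
  shows "log_remainder m t \<le> 2 * t ^ Suc m"
proof -
  define g where "g t = 2 * t ^ Suc m / real (Suc m) - log_remainder m t" for t
  have "g 0 \<le> g t"
  proof (rule DERIV_nonneg_imp_nondecreasing[OF assms(1)])
    fix s assume s: "0 \<le> s" "s \<le> t"
    have "(g has_real_derivative (2 * (real (Suc m) * s ^ m)) / real (Suc m) - s ^ m / (1 - s)) (at s)"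
      unfolding g_def[abs_def] using s assms
      by (intro DERIV_diff log_remainder_deriv DERIV_cdivide DERIV_cmult DERIV_power_Suc) auto
    moreover have "s ^ m / (1 - s) \<le> s ^ m / (1/2)"
      using s assms by (intro divide_left_mono) auto
    ultimately show "\<exists>y. (g has_real_derivative y) (at s) \<and> 0 \<le> y"
      by (intro exI conjI) (auto simp del: of_nat_Suc)
  qed
  then have "log_remainder m t \<le> 2 * t ^ Suc m / real (Suc m)"
    by (simp add: g_def log_remainder_0)
  also have "\<dots> \<le> 2 * t ^ Suc m / 1"
    using assms by (intro divide_left_mono) auto
  finally show ?thesis by simp
qed

context square_summable_variation
begin

text \<open>In each increment log (1 - x_n) and the symbol of the Taylor part combine to -
  \<open>weight_mean m\<close> times a remainder; what is left over are the bounded sums of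
  \<open>Bseq_log_moment\<close>.\<close>

lemma Bseq_szego_integral:
  "Bseq (\<lambda>N. szego_integral m N + weight_mean m * (\<Sum>n<N. log_remainder m (alpha_sq n)))"
proof -
  define P where "P n = (\<Sum>j\<in>{1..m}. alpha_sq n ^ j / real j)" for n
  define R where "R n = Re (((1 - fps_X) ^ (2 * m) * log_step_fps n) $ m)" for n
  have b: "Bseq (\<lambda>N. \<Sum>n<N. R n + (-1) ^ m * real ((2 * m) choose m) / 2 * P n)"
    unfolding R_def P_def
    by (rule Bseq_log_moment[OF u_fps_0 u_fps_Suc log_step_fps_deriv log_step_fps_0])
  have eq: "szego_integral m N + weight_mean m * (\<Sum>n<N. log_remainder m (alpha_sq n))
     = (- 2 * (-1/2) ^ m) * (\<Sum>n<N. R n + (-1) ^ m * real ((2 * m) choose m) / 2 * P n)" for N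
  proof (induction N)
    case 0
    then show ?case by (simp add: szego_integral_0)
  next
    case (Suc N)
    \<comment> \<open>The signs from the weight and from the binomial cancel: (-1/2)^m (-1)^m =
      2^(-m).\<close>
    have wm: "weight_mean m = (-1/2) ^ m * ((-1) ^ m * real ((2 * m) choose m))"
    proof -
      have "(-1/2 :: real) ^ m * (-1) ^ m = (1/2) ^ m" by (simp flip: power_mult_distrib)
      then have "(-1/2) ^ m * ((-1) ^ m * real ((2 * m) choose m)) = (1/2) ^ m * real ((2 * m) choose m)"
        by (simp only: mult.assoc[symmetric])
      then show ?thesis by (simp add: weight_mean_def power_one_over)
    qed
    have lr: "log_remainder m (alpha_sq N) = - ln (1 - (cmod (\<alpha> N))\<^sup>2) - P N"
      by (simp add: log_remainder_def P_def alpha_sq_def)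
    show ?case
      using Suc unfolding szego_integral_Suc R_def[symmetric] sum.lessThan_Suc wm lr
      by (simp add: algebra_simps)
  qed
  show ?thesis unfolding eq
    using b by (rule Bseq_mult[OF Bfun_const])
qed

lemma alpha_sq_less_1: "alpha_sq n < 1"
  using cmod_square_less_1 by (simp add: alpha_sq_def)

lemma alpha_sq_nonneg: "0 \<le> alpha_sq n"
  by (simp add: alpha_sq_def)

lemma weight_mean_pos: "weight_mean m > 0"
  by (simp add: weight_mean_def)

text \<open>Up to a bounded error the left side is a negative multiple of a sum of nonnegative
  remainders. These dominate a multiple of x_n^(m+1) always and are dominated by one when x_n \<le>
  1/2.\<close>

lemma szego_integral_bounded_below_iff:
  "(\<exists>B. \<forall>N. - B \<le> szego_integral m N) \<longleftrightarrow> summable (\<lambda>n. alpha_sq n ^ Suc m)"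
proof -
  define E where "E n = log_remainder m (alpha_sq n)" for n
  obtain K where K: "\<And>N. \<bar>szego_integral m N + weight_mean m * (\<Sum>n<N. E n)\<bar> \<le> K"
    using Bseq_szego_integral[of m] unfolding Bseq_def E_def by auto
  have E0: "0 \<le> E n" for n unfolding E_def by (rule log_remainder_nonneg[OF alpha_sq_nonneg alpha_sq_less_1])
  show ?thesis
  proof
    assume "\<exists>B. \<forall>N. - B \<le> szego_integral m N"
    then obtain B where B: "\<And>N. - B \<le> szego_integral m N" by blast
    have "summable E"
    proof (rule summableI_nonneg_bounded[OF E0])
      fix N
      have "weight_mean m * (\<Sum>n<N. E n) \<le> K + B" using K[of N] B[of N] by linarith
      then show "(\<Sum>n<N. E n) \<le> (K + B) / weight_mean m"
        using weight_mean_pos[of m] by (simp add: field_simps)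
    qed
    then have "summable (\<lambda>n. real (Suc m) * E n)" by (rule summable_mult)
    then show "summable (\<lambda>n. alpha_sq n ^ Suc m)"
    proof (rule summable_comparison_test'[where N = 0])
      fix n
      have "alpha_sq n ^ Suc m / real (Suc m) \<le> E n"
        unfolding E_def by (rule log_remainder_ge[OF alpha_sq_nonneg alpha_sq_less_1])
      then show "norm (alpha_sq n ^ Suc m) \<le> real (Suc m) * E n"
        using alpha_sq_nonneg[of n] by (simp add: field_simps del: of_nat_Suc power_Suc)
    qed
  next
    assume s: "summable (\<lambda>n. alpha_sq n ^ Suc m)"
    then have "(\<lambda>n. alpha_sq n ^ Suc m) \<longlonglongrightarrow> 0" by (rule summable_LIMSEQ_zero)
    \<comment> \<open>Eventually x_n < 1/2, the range in which \<open>log_remainder_le\<close>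
      applies.\<close>
    then have "eventually (\<lambda>n. alpha_sq n ^ Suc m < (1/2) ^ Suc m) sequentially"
      by (rule order_tendstoD) simp
    then have "eventually (\<lambda>n. norm (E n) \<le> 2 * alpha_sq n ^ Suc m) sequentially"
    proof eventually_elim
      case (elim n)
      then have "alpha_sq n < 1/2" by (rule power_less_imp_less_base) simp
      then have "E n \<le> 2 * alpha_sq n ^ Suc m"
        unfolding E_def by (intro log_remainder_le alpha_sq_nonneg) simp
      then show ?case using E0[of n] by simp
    qed
    then have "summable E"
      by (rule summable_comparison_test_ev) (rule summable_mult[OF s])
    have "- (K + weight_mean m * suminf E) \<le> szego_integral m N" for N
    proof -
      have "(\<Sum>n<N. E n) \<le> suminf E"
        by (rule sum_le_suminf[OF \<open>summable E\<close>]) (use E0 in auto)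
      then have "weight_mean m * (\<Sum>n<N. E n) \<le> weight_mean m * suminf E"
        using weight_mean_pos[of m] by simp
      then show ?thesis using K[of N] by linarith
    qed
    then show "\<exists>B. \<forall>N. - B \<le> szego_integral m N" by blast
  qed
qed

end

theorem theorem1p4:
  fixes m :: nat
  shows "\<exists>l::nat. 1 \<le> l \<and> l \<le> m + 1 \<and>
    (\<forall>(\<mu> :: complex measure) (w :: real \<Rightarrow> real) (\<mu>\<^sub>s :: complex measure) (\<alpha> :: nat \<Rightarrow> complex).
       nontrivial_circle_prob \<mu> \<longrightarrow>
       circle_lebesgue_decomposition \<mu> w \<mu>\<^sub>s \<longrightarrow>
       verblunsky_coeffs \<mu> \<alpha> \<longrightarrow>
       in_ell 2 (forward_diff \<alpha>) \<longrightarrow>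
       (ext_integral angle_measure (\<lambda>\<theta>. ereal ((1 - cos \<theta>) ^ m) * ext_log (w \<theta>)) > - \<infinity>
        \<longleftrightarrow> in_ell (2 * l) \<alpha>))"
proof (intro exI[of _ "m + 1"] conjI allI impI)
  fix \<mu> \<mu>\<^sub>s :: "complex measure" and w :: "real \<Rightarrow> real" and \<alpha> :: "nat \<Rightarrow> complex"
  assume \<mu>: "nontrivial_circle_prob \<mu>" and dec: "circle_lebesgue_decomposition \<mu> w \<mu>\<^sub>s"
    and coeffs: "verblunsky_coeffs \<mu> \<alpha>" and diff: "in_ell 2 (forward_diff \<alpha>)"
  have less: "cmod (\<alpha> n) < 1" for n
    using coeffs by (simp add: verblunsky_coeffs_def)
  interpret D: verblunsky_decomposition \<alpha> \<mu> w \<mu>\<^sub>s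
    by (intro verblunsky_decomposition.intro verblunsky_measure.intro verblunsky_sequence.intro
        verblunsky_measure_axioms.intro verblunsky_decomposition_axioms.intro less dec coeffs)
       (use \<mu> in \<open>simp_all only: nontrivial_circle_prob_def\<close>)
  interpret V: square_summable_variation \<alpha>
    by (intro square_summable_variation.intro verblunsky_sequence.intro
        square_summable_variation_axioms.intro less)
       (use diff in \<open>simp add: in_ell_def forward_diff_def sq_summable_def\<close>)
  have "ext_integral angle_measure (\<lambda>\<theta>. ereal ((1 - cos \<theta>) ^ m) * ext_log (w \<theta>)) > - \<infinity>
      \<longleftrightarrow> summable (\<lambda>n. V.alpha_sq n ^ Suc m)"
    unfolding D.ext_integral_iff_bounded_below by (rule V.szego_integral_bounded_below_iff)
  also have "(\<lambda>n. V.alpha_sq n ^ Suc m) = (\<lambda>n. cmod (\<alpha> n) ^ (2 * (m + 1)))"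
    by (simp only: V.alpha_sq_def power_mult Suc_eq_plus1)
  finally show "ext_integral angle_measure (\<lambda>\<theta>. ereal ((1 - cos \<theta>) ^ m) * ext_log (w \<theta>)) > - \<infinity>
      \<longleftrightarrow> in_ell (2 * (m + 1)) \<alpha>"
    by (simp only: in_ell_def)
qed auto

end
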